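(* Let $\Phi$ be a crystallographic finite root system, or a non-twisted (untwisted) affine root system, with positive roots $\Phi^+$ in the vector space $V$. Take any ordering $\gamma_1,\gamma_2,\gamma_3,\ldots$ of $\Phi^+$ which refines the root poset on $\Phi^+$. Then this ordering is suitable (as an ordering of $X=\Phi^+\subseteq V$).
   Context: Root systems are (symmetrizable, crystallographic, real, reduced) root systems in a real vector space $V$ with symmetric bilinear form, base $\Pi$, positive roots $\Phi^+=\Phi\cap\mathrm{Span}_+\Pi$ ($\mathrm{Span}_+$ = nonnegative combinations). Untwisted affine root systems are affinizations $\{\alpha+k\delta:\alpha\in\Phi_0,k\in\mathbb{Z}\}\subseteq V_0\oplus\mathbb{R}\delta$ of finite irreducible root systems $\Phi_0\subseteq V_0$ with $(\delta,\cdot)=0$, base $\Pi_0\cup\{\delta-\theta\}$ ($\theta$ highest root), imaginary roots $k\delta$ excluded. Root poset: $\alpha\le\beta$ iff $\beta-\alpha\in\mathrm{Span}_+\Pi$. For $Z\subseteq V$, $B\subseteq Z$: closed in $Z$ if $\alpha,\beta\in B$, $\gamma\in\mathrm{Span}_+(\alpha,\beta)\cap Z$ imply $\gamma\in B$; coclosed if $Z\setminus B$ closed; biclosed if both; weakly separable if $\mathrm{Span}_+(B)\cap\mathrm{Span}_+(Z\setminus B)=\{0\}$; $Z$ clean if every biclosed subset is weakly separable. For $X\subseteq V$: a linear subset is $X\cap L$ for a subspace $L$; a $2$-dimensional linear subset $Y$ has fundamental vectors $\alpha,\beta\in Y$ if $Y\subseteq\mathrm{Span}_+\{\alpha,\beta\}$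 and neither lies in the nonnegative span of the other elements of $Y$; $F\subseteq X$ is full if $F\cap\mathrm{Span}\{\alpha,\beta\}=X\cap\mathrm{Span}\{\alpha,\beta\}$ for all $\alpha,\beta\in F$. An ordering of $X$ with initial segments $X_i=\{\gamma_1,\ldots,\gamma_i\}$ is suitable if (1) in every $2$-dimensional linear subset the fundamental vectors precede all its other vectors, and (2) for every $i$ and $\alpha,\beta,\gamma\in X_i$ there is a full $F\subseteq X$ containing them with $F\cap X_i$ clean. *)

theory Defs
  imports "HOL-Analysis.Analysis"
begin

definition nonneg_span :: "'v::real_vector set \<Rightarrow> 'v set" where
  "nonneg_span S = {x. \<exists>T c. finite T \<and> T \<subseteq> S \<and> (\<forall>v\<in>T. 0 \<le> c v) \<and> x = (\<Sum>v\<in>T. c v *\<^sub>R v)}"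

definition finite_root_system :: "'v::real_inner set \<Rightarrow> bool" where
  "finite_root_system \<Phi> \<longleftrightarrow> finite \<Phi> \<and> 0 \<notin> \<Phi> \<and>
     (\<forall>\<alpha>\<in>\<Phi>. \<forall>\<beta>\<in>\<Phi>. \<beta> - (2 * (\<beta> \<bullet> \<alpha>) / (\<alpha> \<bullet> \<alpha>)) *\<^sub>R \<alpha> \<in> \<Phi>) \<and>
     (\<forall>\<alpha>\<in>\<Phi>. \<forall>\<beta>\<in>\<Phi>. 2 * (\<beta> \<bullet> \<alpha>) / (\<alpha> \<bullet> \<alpha>) \<in> \<int>) \<and>
     (\<forall>\<alpha>\<in>\<Phi>. \<forall>c::real. c *\<^sub>R \<alpha> \<in> \<Phi> \<longrightarrow> c = 1 \<or> c = -1)"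

definition irreducible_rs :: "'v::real_inner set \<Rightarrow> bool" where
  "irreducible_rs \<Phi> \<longleftrightarrow> \<Phi> \<noteq> {} \<and>
     \<not> (\<exists>A B. A \<noteq> {} \<and> B \<noteq> {} \<and> A \<union> B = \<Phi> \<and> A \<inter> B = {} \<and> (\<forall>a\<in>A. \<forall>b\<in>B. a \<bullet> b = 0))"

definition is_base :: "'v::real_vector set \<Rightarrow> 'v set \<Rightarrow> bool" where
  "is_base \<Phi> \<Delta> \<longleftrightarrow> \<Delta> \<subseteq> \<Phi> \<and> independent \<Delta> \<and>
     (\<forall>\<beta>\<in>\<Phi>. \<exists>c::'v \<Rightarrow> int. \<beta> = (\<Sum>\<alpha>\<in>\<Delta>. of_int (c \<alpha>) *\<^sub>R \<alpha>) \<and>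
        ((\<forall>\<alpha>\<in>\<Delta>. 0 \<le> c \<alpha>) \<or> (\<forall>\<alpha>\<in>\<Delta>. c \<alpha> \<le> 0)))"

definition root_le :: "'v::real_vector set \<Rightarrow> 'v \<Rightarrow> 'v \<Rightarrow> bool" where
  "root_le \<Delta> \<alpha> \<beta> \<longleftrightarrow> \<beta> - \<alpha> \<in> nonneg_span \<Delta>"

definition pos_roots :: "'v::real_vector set \<Rightarrow> 'v set \<Rightarrow> 'v set" where
  "pos_roots \<Phi> \<Delta> = \<Phi> \<inter> nonneg_span \<Delta>"

definition highest_root :: "'v::real_vector set \<Rightarrow> 'v set \<Rightarrow> 'v \<Rightarrow> bool" where
  "highest_root \<Phi> \<Delta> \<theta> \<longleftrightarrow> \<theta> \<in> \<Phi> \<and> (\<forall>\<beta>\<in>\<Phi>. root_le \<Delta> \<beta> \<theta>)"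

text \<open>Untwisted affinization (real roots only).\<close>
definition affinization :: "'v::real_vector set \<Rightarrow> 'v \<Rightarrow> 'v set" where
  "affinization \<Phi>0 \<delta> = {\<alpha> + of_int k *\<^sub>R \<delta> | \<alpha> k. \<alpha> \<in> \<Phi>0}"

definition closed_in_set :: "'v::real_vector set \<Rightarrow> 'v set \<Rightarrow> bool" where
  "closed_in_set Z B \<longleftrightarrow> (\<forall>\<alpha>\<in>B. \<forall>\<beta>\<in>B. \<forall>\<gamma>\<in>Z. \<gamma> \<in> nonneg_span {\<alpha>, \<beta>} \<longrightarrow> \<gamma> \<in> B)"

definition coclosed_in_set :: "'v::real_vector set \<Rightarrow> 'v set \<Rightarrow> bool" where
  "coclosed_in_set Z B \<longleftrightarrow> closed_in_set Z (Z - B)"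

definition biclosed_in_set :: "'v::real_vector set \<Rightarrow> 'v set \<Rightarrow> bool" where
  "biclosed_in_set Z B \<longleftrightarrow> closed_in_set Z B \<and> coclosed_in_set Z B"

definition weakly_separable :: "'v::real_vector set \<Rightarrow> 'v set \<Rightarrow> bool" where
  "weakly_separable Z B \<longleftrightarrow> nonneg_span B \<inter> nonneg_span (Z - B) = {0}"

definition clean :: "'v::real_vector set \<Rightarrow> bool" where
  "clean Z \<longleftrightarrow> (\<forall>B. B \<subseteq> Z \<longrightarrow> biclosed_in_set Z B \<longrightarrow> weakly_separable Z B)"

definition linear_subset :: "'v::real_vector set \<Rightarrow> 'v set \<Rightarrow> bool" where
  "linear_subset X Y \<longleftrightarrow> (\<exists>L. subspace L \<and> Y = X \<inter> L)"

definition two_dim_linear_subset :: "'v::real_vector set \<Rightarrow> 'v set \<Rightarrow> bool" where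
  "two_dim_linear_subset X Y \<longleftrightarrow> linear_subset X Y \<and> dim (span Y) = 2"

definition fundamental_vectors :: "'v::real_vector set \<Rightarrow> 'v \<Rightarrow> 'v \<Rightarrow> bool" where
  "fundamental_vectors Y \<alpha> \<beta> \<longleftrightarrow> \<alpha> \<in> Y \<and> \<beta> \<in> Y \<and> Y \<subseteq> nonneg_span {\<alpha>, \<beta>} \<and>
     \<alpha> \<notin> nonneg_span (Y - {\<alpha>}) \<and> \<beta> \<notin> nonneg_span (Y - {\<beta>})"

definition full_subset :: "'v::real_vector set \<Rightarrow> 'v set \<Rightarrow> bool" where
  "full_subset X F \<longleftrightarrow> F \<subseteq> X \<and>
     (\<forall>\<alpha>\<in>F. \<forall>\<beta>\<in>F. F \<inter> span {\<alpha>, \<beta>} = X \<inter> span {\<alpha>, \<beta>})"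

text \<open>An ordering of X is an enumeration \<gamma>_0, \<gamma>_1, ... (0-based here), i.e. a bijection
  from {..<card X} (X finite) or from all of nat (X infinite) onto X.\<close>
definition ord_index :: "'a set \<Rightarrow> nat set" where
  "ord_index X = (if finite X then {..<card X} else UNIV)"

definition is_ordering :: "'a set \<Rightarrow> (nat \<Rightarrow> 'a) \<Rightarrow> bool" where
  "is_ordering X g \<longleftrightarrow> bij_betw g (ord_index X) X"

definition init_seg :: "'a set \<Rightarrow> (nat \<Rightarrow> 'a) \<Rightarrow> nat \<Rightarrow> 'a set" where
  "init_seg X g i = g ` ({..<i} \<inter> ord_index X)"

definition refines_root_poset :: "'v::real_vector set \<Rightarrow> 'v set \<Rightarrow> (nat \<Rightarrow> 'v) \<Rightarrow> bool" where
  "refines_root_poset \<Delta> X g \<longleftrightarrow>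
     (\<forall>i\<in>ord_index X. \<forall>j\<in>ord_index X. root_le \<Delta> (g i) (g j) \<longrightarrow> i \<le> j)"

definition suitable :: "'v::real_vector set \<Rightarrow> (nat \<Rightarrow> 'v) \<Rightarrow> bool" where
  "suitable X g \<longleftrightarrow> is_ordering X g \<and>
     (\<forall>Y \<alpha> \<beta>. two_dim_linear_subset X Y \<and> fundamental_vectors Y \<alpha> \<beta> \<longrightarrow>
        (\<forall>i\<in>ord_index X. \<forall>j\<in>ord_index X. g i \<in> {\<alpha>, \<beta>} \<and> g j \<in> Y - {\<alpha>, \<beta>} \<longrightarrow> i < j)) \<and>
     (\<forall>i. \<forall>\<alpha>\<in>init_seg X g i. \<forall>\<beta>\<in>init_seg X g i. \<forall>\<gamma>\<in>init_seg X g i.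
        \<exists>F. full_subset X F \<and> \<alpha> \<in> F \<and> \<beta> \<in> F \<and> \<gamma> \<in> F \<and> clean (F \<inter> init_seg X g i))"

end

theory Submission
  imports Defs
begin

text \<open>Let \<open>B\<close> be biclosed in an order ideal \<open>Z\<close> of the positive roots, and \<open>C = Z - B\<close>. If the cones of \<open>B\<close> and
  \<open>C\<close> met outside \<open>0\<close>, there would be an integer relation \<open>\<Sum>\<beta>\<^sub>i = \<Sum>\<gamma>\<^sub>j = v\<close>. From \<open>(v, v) > 0\<close> some
  \<open>(\<beta>\<^sub>i, \<gamma>\<^sub>j) > 0\<close>, so \<open>\<beta>\<^sub>i - \<gamma>\<^sub>j\<close> is up to sign a root of \<open>Z\<close>, whose side is forced, and the relation can be
  shortened. For finite systems every order ideal is therefore clean. In the affine case the argument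
  only breaks down if \<open>\<delta>\<close> lies in both cones. That is excluded for the affinization of a rank-two
  irreducible system by induction on \<open>Z\<close>: removing a highest root \<open>\<gamma>\<close> leaves a separable pair, and
  the separating functional together with the ways to write \<open>\<gamma>\<close> as a sum of two roots gives a contradiction;
  if all of \<open>Z\<close> lies below \<open>\<delta>\<close>, the same descent leads to two orthogonal strings instead.
  For \<open>\<alpha>, \<beta>, \<gamma>\<close> one takes the section of \<open>\<Phi>\<^sup>+\<close> by their span, except in type \<open>A1 \<times> A1\<close>.\<close>

section \<open>Nonnegative spans and integer relations\<close>

text \<open>The affine form is only semidefinite. Its radical is spanned by \<delta>, so the norm
  argument ends with a common vector of both cones that is a multiple of \<delta> instead of 0. This
  can really happen: for \<open>A1 \<times> A1\<close> with orthogonal roots \<open>r\<close>,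
  \<open>s\<close>, the positive lifts of \<open>r\<close>, \<open>- r\<close> and those of
  \<open>s\<close>, \<open>- s\<close> are both closed, and
  \<open>low r + low (- r) = \<delta> = low s + low (- s)\<close>. In an irreducible rank-two system
  a root orthogonal to neither \<open>r\<close> nor \<open>s\<close> rules out this configuration.
  Rank two is enough because three roots whose span contains \<delta> leave at most two dimensions
  for the finite parts. The inner product of the type is positive definite; the affine form is
  obtained by pulling it back along a linear map \<pi> that kills \<delta>. With \<delta> = 0 and
  \<pi> the identity, the same descent covers finite systems.\<close>

lemma nonneg_span_zero [simp]: "0 \<in> nonneg_span S"
  unfolding nonneg_span_def by (intro CollectI exI[of _ "{}"]) simp

lemma nonneg_span_base: "v \<in> S \<Longrightarrow> v \<in> nonneg_span S"
  unfolding nonneg_span_def by (intro CollectI exI[of _ "{v}"] exI[of _ "\<lambda>_. 1"]) simp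

lemma nonneg_span_add:
  assumes "x \<in> nonneg_span S" "y \<in> nonneg_span S"
  shows "x + y \<in> nonneg_span S"
proof -
  obtain T c where T: "finite T" "T \<subseteq> S" "\<forall>v\<in>T. 0 \<le> c v" "x = (\<Sum>v\<in>T. c v *\<^sub>R v)"
    using assms(1) unfolding nonneg_span_def by blast
  obtain U d where U: "finite U" "U \<subseteq> S" "\<forall>v\<in>U. 0 \<le> d v" "y = (\<Sum>v\<in>U. d v *\<^sub>R v)"
    using assms(2) unfolding nonneg_span_def by blast
  define e where "e v = (if v \<in> T then c v else 0) + (if v \<in> U then d v else 0)" for v
  have "(\<Sum>v\<in>T \<union> U. (if v \<in> T then c v else 0) *\<^sub>R v) = x"
    unfolding T(4) by (rule sum.mono_neutral_cong_right) (use T(1) U(1) in auto)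
  moreover have "(\<Sum>v\<in>T \<union> U. (if v \<in> U then d v else 0) *\<^sub>R v) = y"
    unfolding U(4) by (rule sum.mono_neutral_cong_right) (use T(1) U(1) in auto)
  ultimately have "x + y = (\<Sum>v\<in>T \<union> U. e v *\<^sub>R v)"
    by (simp add: e_def scaleR_add_left sum.distrib)
  moreover have "\<forall>v\<in>T \<union> U. 0 \<le> e v" using T(3) U(3) by (simp add: e_def)
  ultimately show ?thesis
    unfolding nonneg_span_def using T(1,2) U(1,2) by (intro CollectI exI[of _ "T \<union> U"] exI[of _ e]) simp
qed

lemma nonneg_span_scale:
  assumes "x \<in> nonneg_span S" "0 \<le> a"
  shows "a *\<^sub>R x \<in> nonneg_span S"
proof -
  obtain T c where "finite T" "T \<subseteq> S" "\<forall>v\<in>T. 0 \<le> c v" "x = (\<Sum>v\<in>T. c v *\<^sub>R v)"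
    using assms(1) unfolding nonneg_span_def by blast
  then show ?thesis
    unfolding nonneg_span_def using assms(2)
    by (intro CollectI exI[of _ T] exI[of _ "\<lambda>v. a * c v"]) (simp add: scaleR_sum_right)
qed

lemma nonneg_span_mono: "S \<subseteq> T \<Longrightarrow> nonneg_span S \<subseteq> nonneg_span T"
  unfolding nonneg_span_def by blast

lemma nonneg_span_sum:
  "(\<And>i. i \<in> I \<Longrightarrow> h i \<in> nonneg_span S) \<Longrightarrow> (\<Sum>i\<in>I. h i) \<in> nonneg_span S"
  by (induction I rule: infinite_finite_induct) (simp_all add: nonneg_span_add)

lemma nonneg_span_sum_mset:
  "set_mset M \<subseteq> S \<Longrightarrow> sum_mset M \<in> nonneg_span S"
  by (induction M) (simp_all add: nonneg_span_add nonneg_span_base)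

lemma nonneg_span_minimal:
  assumes "S \<subseteq> nonneg_span T" shows "nonneg_span S \<subseteq> nonneg_span T"
proof
  fix x assume "x \<in> nonneg_span S"
  then obtain U c where "U \<subseteq> S" "\<forall>v\<in>U. 0 \<le> c v" "x = (\<Sum>v\<in>U. c v *\<^sub>R v)"
    unfolding nonneg_span_def by blast
  then show "x \<in> nonneg_span T"
    using assms by (simp add: nonneg_span_sum nonneg_span_scale subset_iff)
qed

lemma nonneg_span_subset_span: "nonneg_span S \<subseteq> span S"
proof
  fix x assume "x \<in> nonneg_span S"
  then obtain U c where "U \<subseteq> S" "x = (\<Sum>v\<in>U. c v *\<^sub>R v)"
    unfolding nonneg_span_def by blast
  then show "x \<in> span S"
    by (simp add: span_sum span_scale span_base subset_iff)
qed

lemma nonneg_span_finite: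
  assumes "finite S" "x \<in> nonneg_span S"
  shows "\<exists>c. (\<forall>v. 0 \<le> c v) \<and> x = (\<Sum>v\<in>S. c v *\<^sub>R v)"
proof -
  obtain T c where T: "finite T" "T \<subseteq> S" "\<forall>v\<in>T. 0 \<le> c v" "x = (\<Sum>v\<in>T. c v *\<^sub>R v)"
    using assms(2) unfolding nonneg_span_def by blast
  have "x = (\<Sum>v\<in>S. (if v \<in> T then c v else 0) *\<^sub>R v)"
    unfolding T(4) by (rule sum.mono_neutral_cong_left) (use T assms in auto)
  moreover have "0 \<le> (if v \<in> T then c v else 0)" for v using T(3) by simp
  ultimately show ?thesis by (intro exI conjI allI)
qed

lemma nonneg_span_pairI:
  assumes "0 \<le> a" "0 \<le> b" shows "a *\<^sub>R x + b *\<^sub>R y \<in> nonneg_span {x, y}"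
  using assms by (simp add: nonneg_span_add nonneg_span_scale nonneg_span_base)

lemma nonneg_span_pairE:
  assumes "z \<in> nonneg_span {x, y}"
  obtains a b where "0 \<le> a" "0 \<le> b" "z = a *\<^sub>R x + b *\<^sub>R y"
proof -
  have "finite {x, y}" by simp
  from nonneg_span_finite[OF this assms] obtain c
    where c: "\<forall>v. 0 \<le> c v" "z = (\<Sum>v\<in>{x, y}. c v *\<^sub>R v)"
    by blast
  show thesis
  proof (cases "x = y")
    case True
    then show thesis using that[of "c x" 0] c by simp
  next
    case False
    then show thesis using that[of "c x" "c y"] c by simp
  qed
qed

lemma closed_in_setD:
  assumes "closed_in_set Z B" "x \<in> B" "y \<in> B" "z \<in> Z" "z = a *\<^sub>R x + b *\<^sub>R y" "0 \<le> a" "0 \<le> b"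
  shows "z \<in> B"
proof -
  have "z \<in> nonneg_span {x, y}" using assms(5-7) nonneg_span_pairI[of a b x y] by simp
  then show ?thesis using assms(1-4) unfolding closed_in_set_def by blast
qed

lemma closed_in_set_addD:
  assumes "closed_in_set Z B" "x \<in> B" "y \<in> B" "x + y \<in> Z" shows "x + y \<in> B"
  using closed_in_setD[OF assms(1-4), of 1 1] by simp

lemma independent_sum_eq_0:
  assumes "finite \<Delta>" "independent \<Delta>" "(\<Sum>a\<in>\<Delta>. u a *\<^sub>R a) = 0" "a \<in> \<Delta>"
  shows "u a = 0"
  using assms independentD by blast

lemma sum_mset_replicate_scaleR:
  fixes S :: "'v::real_vector set"
  shows "sum_mset (\<Sum>z\<in>S. replicate_mset (n z) z) = (\<Sum>z\<in>S. real (n z) *\<^sub>R z)"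
proof -
  have "sum_mset (replicate_mset k z) = real k *\<^sub>R z" for k and z :: 'v
    by (induction k) (auto simp: scaleR_add_left)
  then show ?thesis
    by (induction S rule: infinite_finite_induct) auto
qed

text \<open>Simultaneous Diophantine approximation turns a real relation between lattice vectors into
  an integer one: the error of the rounded relation is a lattice vector of norm below one.\<close>

lemma natural_relation:
  fixes B C \<Delta> :: "'v::real_vector set"
  assumes fin: "finite B" "finite C" and disj: "B \<inter> C = {}"
    and \<Delta>: "finite \<Delta>" "independent \<Delta>"
    and int: "\<And>z. z \<in> B \<union> C \<Longrightarrow> \<exists>c::'v \<Rightarrow> int. z = (\<Sum>a\<in>\<Delta>. of_int (c a) *\<^sub>R a)"
    and v: "v \<in> nonneg_span B" "v \<in> nonneg_span C" "v \<noteq> 0"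
  obtains M N where "set_mset M \<subseteq> B" "set_mset N \<subseteq> C" "M \<noteq> {#}" "sum_mset M = sum_mset N"
proof -
  obtain b where b: "\<forall>z. 0 \<le> b z" "v = (\<Sum>z\<in>B. b z *\<^sub>R z)"
    using nonneg_span_finite[OF fin(1) v(1)] by blast
  obtain c where c: "\<forall>z. 0 \<le> c z" "v = (\<Sum>z\<in>C. c z *\<^sub>R z)"
    using nonneg_span_finite[OF fin(2) v(2)] by blast
  obtain z0 where z0: "z0 \<in> B" "b z0 \<noteq> 0"
  proof -
    have "\<not> (\<forall>z\<in>B. b z *\<^sub>R z = 0)"
    proof
      assume "\<forall>z\<in>B. b z *\<^sub>R z = 0"
      then have "v = 0" unfolding b(2) by (rule sum.neutral)
      then show False using v(3) by contradiction
    qed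
    then show thesis using that by auto
  qed
  define Z where "Z = B \<union> C"
  \<comment> \<open>Dividing by \<open>b z0\<close> gives \<open>z0\<close> weight exactly 1, so its
    rounded multiplicity \<open>P z0\<close> is positive and the integer relation is
    nonempty.\<close>
  define w where "w z = (if z \<in> B then b z else c z) / b z0" for z
  define s :: "'v \<Rightarrow> real" where "s z = (if z \<in> B then 1 else - 1)" for z
  have finZ: "finite Z" using fin by (simp add: Z_def)
  have w0: "w z0 = 1" using z0 by (simp add: w_def)
  have wnn: "0 \<le> w z" for z using b(1) c(1) by (simp add: w_def)
  have split: "(\<Sum>z\<in>Z. s z *\<^sub>R (u z *\<^sub>R z)) = (\<Sum>z\<in>B. u z *\<^sub>R z) - (\<Sum>z\<in>C. u z *\<^sub>R z)" for u
  proof -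
    have "(\<Sum>z\<in>Z. s z *\<^sub>R (u z *\<^sub>R z))
        = (\<Sum>z\<in>B. s z *\<^sub>R (u z *\<^sub>R z)) + (\<Sum>z\<in>C. s z *\<^sub>R (u z *\<^sub>R z))"
      unfolding Z_def using fin disj by (rule sum.union_disjoint)
    moreover have "(\<Sum>z\<in>B. s z *\<^sub>R (u z *\<^sub>R z)) = (\<Sum>z\<in>B. u z *\<^sub>R z)"
      by (rule sum.cong) (auto simp: s_def)
    moreover have "(\<Sum>z\<in>C. s z *\<^sub>R (u z *\<^sub>R z)) = (\<Sum>z\<in>C. - (u z *\<^sub>R z))"
      by (rule sum.cong) (use disj in \<open>auto simp: s_def\<close>)
    ultimately show ?thesis by (simp add: sum_negf)
  qed
  have rel: "(\<Sum>z\<in>Z. s z *\<^sub>R (w z *\<^sub>R z)) = 0"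
  proof -
    have "(\<Sum>z\<in>B. w z *\<^sub>R z) = (1 / b z0) *\<^sub>R v"
      unfolding b(2) scaleR_sum_right by (rule sum.cong) (auto simp: w_def)
    moreover have "(\<Sum>z\<in>C. w z *\<^sub>R z) = (1 / b z0) *\<^sub>R v"
      unfolding c(2) scaleR_sum_right by (rule sum.cong) (use disj in \<open>auto simp: w_def\<close>)
    ultimately show ?thesis unfolding split by simp
  qed
  obtain \<kappa> :: "'v \<Rightarrow> 'v \<Rightarrow> int" where \<kappa>: "\<And>z. z \<in> Z \<Longrightarrow> z = (\<Sum>a\<in>\<Delta>. of_int (\<kappa> z a) *\<^sub>R a)"
    using int unfolding Z_def by metis
  have coord: "(\<Sum>z\<in>Z. s z *\<^sub>R (u z *\<^sub>R z))
      = (\<Sum>a\<in>\<Delta>. (\<Sum>z\<in>Z. s z * u z * of_int (\<kappa> z a)) *\<^sub>R a)" for u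
  proof -
    have "(\<Sum>z\<in>Z. s z *\<^sub>R (u z *\<^sub>R z))
        = (\<Sum>z\<in>Z. \<Sum>a\<in>\<Delta>. (s z * u z * of_int (\<kappa> z a)) *\<^sub>R a)"
    proof (rule sum.cong[OF refl])
      fix z assume "z \<in> Z"
      have "s z *\<^sub>R (u z *\<^sub>R z) = (s z * u z) *\<^sub>R (\<Sum>a\<in>\<Delta>. of_int (\<kappa> z a) *\<^sub>R a)"
        using \<kappa>[OF \<open>z \<in> Z\<close>] by simp
      then show "s z *\<^sub>R (u z *\<^sub>R z) = (\<Sum>a\<in>\<Delta>. (s z * u z * of_int (\<kappa> z a)) *\<^sub>R a)"
        by (simp add: scaleR_sum_right)
    qed
    then show ?thesis by (subst (asm) sum.swap) (simp add: scaleR_sum_left)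
  qed
  \<comment> \<open>\<open>K\<close> exceeds the sum of all absolute coordinates, so rounding errors
    below \<open>1 / K\<close> move each coordinate of the relation by less than 1; an integer that
    small is 0.\<close>
  define K where "K = (\<Sum>z\<in>Z. \<Sum>a\<in>\<Delta>. \<bar>\<kappa> z a\<bar>) + 1"
  have Kpos: "K > 0" unfolding K_def by (simp add: sum_nonneg add_nonneg_pos)
  obtain h where h: "bij_betw h {..<card Z} Z"
    using ex_bij_betw_nat_finite[OF finZ] by (auto simp: atLeast0LessThan)
  obtain q p where q: "0 < q" and
    p: "\<And>i. i < card Z \<Longrightarrow> \<bar>of_int q * w (h i) - of_int (p i)\<bar> < 1 / real (nat K)"
    using Dirichlet_approx_simult[of "nat K" "card Z" "\<lambda>i. w (h i)"] Kpos by (metis zero_less_nat_eq)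
  define P where "P z = p (inv_into {..<card Z} h z)" for z
  have P: "\<bar>of_int q * w z - of_int (P z)\<bar> < 1 / of_int K" if "z \<in> Z" for z
  proof -
    have "inv_into {..<card Z} h z \<in> {..<card Z}" "h (inv_into {..<card Z} h z) = z"
      using h that inv_into_into[of z h "{..<card Z}"] f_inv_into_f[of z h "{..<card Z}"]
      by (simp_all add: bij_betw_def)
    then show ?thesis using p[of "inv_into {..<card Z} h z"] Kpos by (simp add: P_def)
  qed
  have K1: "1 / of_int K \<le> (1::real)" using Kpos by simp
  have Pnn: "0 \<le> P z" if "z \<in> Z" for z
  proof -
    have "0 \<le> of_int q * w z" using q wnn by simp
    then have "of_int (P z) > (-1::real)" using P[OF that] K1 by linarith
    then show ?thesis by linarith
  qed
  have P0: "0 < P z0"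
  proof -
    have "z0 \<in> Z" using z0 by (simp add: Z_def)
    have "of_int q \<ge> (1::real)" using q by simp
    then have "of_int (P z0) > (0::real)" using P[OF \<open>z0 \<in> Z\<close>] K1 unfolding w0 by linarith
    then show ?thesis by simp
  qed
  have zero: "(\<Sum>z\<in>Z. s z * of_int (P z) * of_int (\<kappa> z a)) = 0" if a: "a \<in> \<Delta>" for a
  proof -
    have w0: "(\<Sum>z\<in>Z. s z * w z * of_int (\<kappa> z a)) = 0"
      by (rule independent_sum_eq_0[OF \<Delta> _ a]) (use rel in \<open>simp only: coord\<close>)
    have "(\<Sum>z\<in>Z. s z * of_int (P z) * of_int (\<kappa> z a))
        = (\<Sum>z\<in>Z. s z * (of_int (P z) - of_int q * w z) * of_int (\<kappa> z a))
          + of_int q * (\<Sum>z\<in>Z. s z * w z * of_int (\<kappa> z a))"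
      unfolding sum_distrib_left sum.distrib[symmetric] by (rule sum.cong) (auto simp: algebra_simps)
    then have eq: "(\<Sum>z\<in>Z. s z * of_int (P z) * of_int (\<kappa> z a))
        = (\<Sum>z\<in>Z. s z * (of_int (P z) - of_int q * w z) * of_int (\<kappa> z a))"
      using w0 by simp
    have "\<bar>\<Sum>z\<in>Z. s z * (of_int (P z) - of_int q * w z) * of_int (\<kappa> z a)\<bar>
        \<le> (\<Sum>z\<in>Z. (1 / of_int K) * \<bar>of_int (\<kappa> z a)\<bar>)"
    proof (rule order_trans[OF sum_abs], rule sum_mono)
      fix z assume "z \<in> Z"
      have "\<bar>s z\<bar> = 1" by (simp add: s_def)
      moreover have "\<bar>of_int (P z) - of_int q * w z\<bar> \<le> 1 / of_int K"
        using P[OF \<open>z \<in> Z\<close>] by (simp add: abs_minus_commute)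
      ultimately show "\<bar>s z * (of_int (P z) - of_int q * w z) * of_int (\<kappa> z a)\<bar>
          \<le> (1 / of_int K) * \<bar>of_int (\<kappa> z a)\<bar>"
        unfolding abs_mult by (intro mult_right_mono) auto
    qed
    also have "\<dots> = (1 / of_int K) * of_int (\<Sum>z\<in>Z. \<bar>\<kappa> z a\<bar>)"
      by (simp add: sum_distrib_left)
    also have "\<dots> < 1"
    proof -
      have "(\<Sum>z\<in>Z. \<bar>\<kappa> z a\<bar>) \<le> (\<Sum>z\<in>Z. \<Sum>a\<in>\<Delta>. \<bar>\<kappa> z a\<bar>)"
        by (intro sum_mono member_le_sum) (use a \<Delta> in auto)
      then have "(\<Sum>z\<in>Z. \<bar>\<kappa> z a\<bar>) < K" by (simp add: K_def)
      then have "real_of_int (\<Sum>z\<in>Z. \<bar>\<kappa> z a\<bar>) < of_int K" by (simp only: of_int_less_iff)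
      then show ?thesis using Kpos by (simp add: divide_simps del: of_int_sum)
    qed
    finally have lt: "\<bar>\<Sum>z\<in>Z. s z * of_int (P z) * of_int (\<kappa> z a)\<bar> < 1" using eq by simp
    obtain n :: int where n: "(\<Sum>z\<in>Z. s z * of_int (P z) * of_int (\<kappa> z a)) = of_int n"
    proof
      show "(\<Sum>z\<in>Z. s z * of_int (P z) * of_int (\<kappa> z a))
          = of_int (\<Sum>z\<in>Z. (if z \<in> B then 1 else - 1) * P z * \<kappa> z a)"
        unfolding of_int_sum by (rule sum.cong) (auto simp: s_def)
    qed
    have "n = 0" using lt unfolding n by linarith
    then show ?thesis by (simp add: n)
  qed
  have "(\<Sum>z\<in>Z. s z *\<^sub>R (of_int (P z) *\<^sub>R z)) = 0"
    unfolding coord by (rule sum.neutral) (simp add: zero)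
  then have eq: "(\<Sum>z\<in>B. of_int (P z) *\<^sub>R z) = (\<Sum>z\<in>C. of_int (P z) *\<^sub>R z)"
    unfolding split by simp
  define M where "M = (\<Sum>z\<in>B. replicate_mset (nat (P z)) z)"
  define N where "N = (\<Sum>z\<in>C. replicate_mset (nat (P z)) z)"
  have "z0 \<in># M"
    unfolding M_def using fin z0 P0 by (auto simp: set_mset_sum)
  have "sum_mset M = (\<Sum>z\<in>B. of_int (P z) *\<^sub>R z)"
    unfolding M_def sum_mset_replicate_scaleR
    by (rule sum.cong) (use Pnn in \<open>auto simp: Z_def\<close>)
  moreover have "sum_mset N = (\<Sum>z\<in>C. of_int (P z) *\<^sub>R z)"
    unfolding N_def sum_mset_replicate_scaleR
    by (rule sum.cong) (use Pnn in \<open>auto simp: Z_def\<close>)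
  moreover have "set_mset M \<subseteq> B" "set_mset N \<subseteq> C"
    unfolding M_def N_def using fin by (auto simp: set_mset_sum split: if_splits)
  moreover have "M \<noteq> {#}" using \<open>z0 \<in># M\<close> by auto
  ultimately show thesis using eq by (intro that[of M N]) simp_all
qed

section \<open>Descent along positive inner products\<close>

lemma inner_sum_mset_nonpos:
  fixes \<pi> :: "'v::real_vector \<Rightarrow> 'w::real_inner"
  assumes lin: "linear \<pi>" and "\<And>\<beta>. \<beta> \<in># M \<Longrightarrow> \<pi> \<beta> \<bullet> y \<le> 0"
  shows "\<pi> (sum_mset M) \<bullet> y \<le> 0"
  using assms(2)
proof (induction M)
  case empty
  then show ?case by (simp add: linear_0[OF lin])
next
  case (add \<beta> M)
  have "\<pi> \<beta> \<bullet> y \<le> 0" "\<pi> (sum_mset M) \<bullet> y \<le> 0" using add by auto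
  then show ?case by (simp add: linear_add[OF lin] inner_add_left)
qed

lemma inner_sum_mset_pairs_nonpos:
  fixes \<pi> :: "'v::real_vector \<Rightarrow> 'w::real_inner"
  assumes lin: "linear \<pi>" and le: "\<And>\<beta> \<gamma>. \<beta> \<in># M \<Longrightarrow> \<gamma> \<in># N \<Longrightarrow> \<pi> \<beta> \<bullet> \<pi> \<gamma> \<le> 0"
  shows "\<pi> (sum_mset M) \<bullet> \<pi> (sum_mset N) \<le> 0"
proof (rule inner_sum_mset_nonpos[OF lin])
  fix \<beta> assume "\<beta> \<in># M"
  have "\<pi> (sum_mset N) \<bullet> \<pi> \<beta> \<le> 0"
    by (rule inner_sum_mset_nonpos[OF lin]) (use le[OF \<open>\<beta> \<in># M\<close>] in \<open>simp add: inner_commute\<close>)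
  then show "\<pi> \<beta> \<bullet> \<pi> (sum_mset N) \<le> 0" by (simp add: inner_commute)
qed

lemma linear_sum_mset_nonneg:
  fixes ht :: "'v::real_vector \<Rightarrow> real"
  assumes "linear ht" "\<And>z. z \<in># M \<Longrightarrow> 0 \<le> ht z"
  shows "0 \<le> ht (sum_mset M)"
  using assms(2)
  by (induction M) (simp_all add: linear_0[OF assms(1)] linear_add[OF assms(1)])

lemma linear_sum_mset_pos:
  fixes ht :: "'v::real_vector \<Rightarrow> real"
  assumes "linear ht" "\<And>z. z \<in># M \<Longrightarrow> 0 < ht z" "M \<noteq> {#}"
  shows "0 < ht (sum_mset M)"
proof -
  obtain z where "z \<in># M" using assms(3) by blast
  then have M: "M = add_mset z (M - {#z#})" by simp
  have "0 \<le> ht (sum_mset (M - {#z#}))"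
    by (rule linear_sum_mset_nonneg[OF assms(1)]) (use assms(2) in \<open>auto dest: in_diffD simp: less_imp_le\<close>)
  moreover have "0 < ht z" using assms(2) \<open>z \<in># M\<close> .
  ultimately show ?thesis by (subst M) (simp add: linear_add[OF assms(1)])
qed

text \<open>If \<open>\<beta> \<in> B\<close> and \<open>\<gamma> \<in> C\<close> have positive product then they differ by an element of \<open>Z\<close> (or by a
  multiple of \<open>\<delta>\<close>), and biclosedness decides on which side that difference lies; cancelling
  shortens the relation. The process stops when no positive product is left.\<close>

lemma descent:
  fixes \<pi> :: "'v::real_vector \<Rightarrow> 'w::real_inner" and ht :: "'v \<Rightarrow> real"
  assumes cl: "closed_in_set Z B" "closed_in_set Z C" and Z: "B \<union> C = Z" "B \<inter> C = {}"
    and lin: "linear ht" and ht: "\<And>z. z \<in> Z \<Longrightarrow> 0 < ht z" "\<delta> \<noteq> 0 \<Longrightarrow> 0 < ht \<delta>"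
    and step: "\<And>\<beta> \<gamma>. \<beta> \<in> B \<Longrightarrow> \<gamma> \<in> C \<Longrightarrow> 0 < \<pi> \<beta> \<bullet> \<pi> \<gamma> \<Longrightarrow>
      (\<exists>\<rho>\<in>Z. \<beta> = \<gamma> + \<rho> \<or> \<gamma> = \<beta> + \<rho>) \<or> (\<exists>k::nat. 0 < k \<and> \<delta> \<noteq> 0 \<and> \<beta> = \<gamma> + real k *\<^sub>R \<delta>)"
  shows "set_mset M \<subseteq> B \<Longrightarrow> set_mset N \<subseteq> C \<Longrightarrow> sum_mset M + real m *\<^sub>R \<delta> = sum_mset N \<Longrightarrow>
    sum_mset N \<noteq> 0 \<Longrightarrow>
    \<exists>M' N' m'. set_mset M' \<subseteq> B \<and> set_mset N' \<subseteq> C \<and> sum_mset M' + real m' *\<^sub>R \<delta> = sum_mset N' \<and>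
      sum_mset N' \<noteq> 0 \<and> (\<forall>\<beta>\<in>#M'. \<forall>\<gamma>\<in>#N'. \<pi> \<beta> \<bullet> \<pi> \<gamma> \<le> 0)"
proof (induction "size M + size N" arbitrary: M N m rule: less_induct)
  case less
  note MB = less.prems(1) and NC = less.prems(2) and eq = less.prems(3)
  have ht0: "0 \<le> ht (real k *\<^sub>R \<delta>)" for k
    using ht(2) linear_0[OF lin] by (cases "\<delta> = 0") (auto simp: linear_scale[OF lin])
  show ?case
  proof (cases "\<forall>\<beta>\<in>#M. \<forall>\<gamma>\<in>#N. \<pi> \<beta> \<bullet> \<pi> \<gamma> \<le> 0")
    case True
    then show ?thesis using less.prems by blast
  next
    case False
    then obtain \<beta> \<gamma> where bg: "\<beta> \<in># M" "\<gamma> \<in># N" "0 < \<pi> \<beta> \<bullet> \<pi> \<gamma>" by (auto simp: not_le)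
    define M0 where "M0 = M - {#\<beta>#}"
    define N0 where "N0 = N - {#\<gamma>#}"
    have M: "M = add_mset \<beta> M0" and N: "N = add_mset \<gamma> N0" using bg by (simp_all add: M0_def N0_def)
    have B0: "\<beta> \<in> B" "set_mset M0 \<subseteq> B" and C0: "\<gamma> \<in> C" "set_mset N0 \<subseteq> C"
      using MB NC M N by auto
    have htM: "0 \<le> ht (sum_mset M0)"
      by (rule linear_sum_mset_nonneg[OF lin], rule less_imp_le[OF ht(1)]) (use B0(2) Z in blast)
    have htN: "0 \<le> ht (sum_mset N0)"
      by (rule linear_sum_mset_nonneg[OF lin], rule less_imp_le[OF ht(1)]) (use C0(2) Z in blast)
    consider (a) \<rho> where "\<rho> \<in> Z" "\<beta> = \<gamma> + \<rho>" | (b) \<rho> where "\<rho> \<in> Z" "\<gamma> = \<beta> + \<rho>"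
      | (c) k :: nat where "0 < k" "\<delta> \<noteq> 0" "\<beta> = \<gamma> + real k *\<^sub>R \<delta>"
      using step[OF B0(1) C0(1) bg(3)] by blast
    then show ?thesis
    proof cases
      case a
      have "\<rho> \<in> B"
      proof (rule ccontr)
        assume "\<rho> \<notin> B"
        then have "\<rho> \<in> C" using a Z by blast
        then have "\<beta> \<in> C" using closed_in_set_addD[OF cl(2) C0(1)] a B0(1) Z by auto
        then show False using B0(1) Z by blast
      qed
      have e: "sum_mset (add_mset \<rho> M0) + real m *\<^sub>R \<delta> = sum_mset N0"
        using eq unfolding M N a(2) by (simp add: add.assoc)
      have "0 < ht (sum_mset N0)"
        unfolding e[symmetric] using ht(1)[OF a(1)] htM ht0[of m] by (simp add: linear_add[OF lin])
      then have "sum_mset N0 \<noteq> 0" using linear_0[OF lin] by auto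
      then show ?thesis
        using less.hyps[of "add_mset \<rho> M0" N0 m] B0 C0 \<open>\<rho> \<in> B\<close> e unfolding M N by simp
    next
      case b
      have "\<rho> \<in> C"
      proof (rule ccontr)
        assume "\<rho> \<notin> C"
        then have "\<rho> \<in> B" using b Z by blast
        then have "\<gamma> \<in> B" using closed_in_set_addD[OF cl(1) B0(1)] b C0(1) Z by auto
        then show False using C0(1) Z by blast
      qed
      have e: "sum_mset M0 + real m *\<^sub>R \<delta> = sum_mset (add_mset \<rho> N0)"
        using eq unfolding M N b(2) by (simp add: add.assoc)
      have "0 < ht (sum_mset (add_mset \<rho> N0))"
        using ht(1)[OF b(1)] htN by (simp add: linear_add[OF lin])
      then have "sum_mset (add_mset \<rho> N0) \<noteq> 0" using linear_0[OF lin] by auto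
      then show ?thesis
        using less.hyps[of M0 "add_mset \<rho> N0" m] B0 C0 \<open>\<rho> \<in> C\<close> e unfolding M N by simp
    next
      case c
      \<comment> \<open>Copies of \<delta> are collected on the \<open>B\<close> side only, which is
        why \<open>step\<close> admits string differences in one direction.\<close>
      have e: "sum_mset M0 + real (m + k) *\<^sub>R \<delta> = sum_mset N0"
        using eq unfolding M N c(3) by (simp add: algebra_simps)
      have "0 < ht (sum_mset N0)"
        unfolding e[symmetric] using ht(2)[OF c(2)] htM c(1)
        by (simp add: linear_add[OF lin] linear_scale[OF lin] add_nonneg_pos)
      then have "sum_mset N0 \<noteq> 0" using linear_0[OF lin] by auto
      then show ?thesis
        using less.hyps[of M0 N0 "m + k"] B0 C0 e unfolding M N by simp
    qed
  qed
qed

text \<open>After the descent both sums have the same image under \<pi>, and the product of these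
  images is nonpositive, so the image is 0 and the common sum is a positive multiple of \<delta> in
  the cone of \<open>C\<close>, which is excluded. The descent cannot absorb \<gamma> = \<beta> +
  k\<delta>. There the partner \<epsilon> decides: on the \<open>C\<close> side it puts a multiple
  of \<delta> into the cone of \<open>C\<close>, on the \<open>B\<close> side closedness pulls
  \<gamma> into \<open>B\<close>.\<close>

lemma nonneg_span_Int_subset_0:
  fixes \<pi> :: "'v::real_vector \<Rightarrow> 'w::real_inner" and ht :: "'v \<Rightarrow> real"
  assumes finZ: "finite Z" and \<Delta>: "finite \<Delta>" "independent \<Delta>"
    and int: "\<And>z. z \<in> Z \<Longrightarrow> \<exists>c::'v \<Rightarrow> int. z = (\<Sum>a\<in>\<Delta>. of_int (c a) *\<^sub>R a)"
    and cl: "closed_in_set Z B" "closed_in_set Z C" and Z: "B \<union> C = Z" "B \<inter> C = {}"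
    and lin: "linear \<pi>" "linear ht" and ht: "\<And>z. z \<in> Z \<Longrightarrow> 0 < ht z" "\<delta> \<noteq> 0 \<Longrightarrow> 0 < ht \<delta>"
    and ker: "\<pi> \<delta> = 0" "\<And>v. v \<in> span Z \<Longrightarrow> \<pi> v = 0 \<Longrightarrow> v \<in> span {\<delta>}"
    and step: "\<And>\<beta> \<gamma>. \<beta> \<in> Z \<Longrightarrow> \<gamma> \<in> Z \<Longrightarrow> \<beta> \<noteq> \<gamma> \<Longrightarrow> 0 < \<pi> \<beta> \<bullet> \<pi> \<gamma> \<Longrightarrow>
      (\<exists>\<rho>\<in>Z. \<beta> = \<gamma> + \<rho> \<or> \<gamma> = \<beta> + \<rho>) \<or>
      (\<delta> \<noteq> 0 \<and> (\<exists>k::nat. \<exists>m>0. \<exists>\<epsilon>\<in>Z. 0 < k \<and>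
        (\<beta> = \<gamma> + real k *\<^sub>R \<delta> \<and> \<gamma> + \<epsilon> = m *\<^sub>R \<delta> \<or> \<gamma> = \<beta> + real k *\<^sub>R \<delta> \<and> \<beta> + \<epsilon> = m *\<^sub>R \<delta>)))"
    and C\<delta>: "\<delta> \<noteq> 0 \<Longrightarrow> \<delta> \<notin> nonneg_span C"
  shows "nonneg_span B \<inter> nonneg_span C \<subseteq> {0}"
proof (rule ccontr)
  assume "\<not> nonneg_span B \<inter> nonneg_span C \<subseteq> {0}"
  then obtain v where v: "v \<in> nonneg_span B" "v \<in> nonneg_span C" "v \<noteq> 0" by blast
  have fin: "finite B" "finite C" using finZ Z by auto
  obtain M N where MN: "set_mset M \<subseteq> B" "set_mset N \<subseteq> C" "M \<noteq> {#}" "sum_mset M = sum_mset N"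
    using natural_relation[OF fin Z(2) \<Delta> _ v] int Z(1) by blast
  have "0 < ht (sum_mset M)"
    by (rule linear_sum_mset_pos[OF lin(2) _ MN(3)]) (use MN(1) Z ht(1) in blast)
  then have N0: "sum_mset N \<noteq> 0" using MN(4) linear_0[OF lin(2)] by auto
  have step': "(\<exists>\<rho>\<in>Z. \<beta> = \<gamma> + \<rho> \<or> \<gamma> = \<beta> + \<rho>) \<or> (\<exists>k::nat. 0 < k \<and> \<delta> \<noteq> 0 \<and> \<beta> = \<gamma> + real k *\<^sub>R \<delta>)"
    if bg: "\<beta> \<in> B" "\<gamma> \<in> C" "0 < \<pi> \<beta> \<bullet> \<pi> \<gamma>" for \<beta> \<gamma>
  proof (rule ccontr)
    assume neg: "\<not> ?thesis"
    have Zbg: "\<beta> \<in> Z" "\<gamma> \<in> Z" "\<beta> \<noteq> \<gamma>" using bg Z by auto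
    obtain k :: nat and m \<epsilon> where k: "\<delta> \<noteq> 0" "0 < k" "0 < m" "\<epsilon> \<in> Z" "\<gamma> = \<beta> + real k *\<^sub>R \<delta>" "\<beta> + \<epsilon> = m *\<^sub>R \<delta>"
      using step[OF Zbg bg(3)] neg by blast
    show False
    proof (cases "\<epsilon> \<in> C")
      case True
      have "\<gamma> + \<epsilon> = (m + real k) *\<^sub>R \<delta>" using k(5,6) by (simp add: algebra_simps)
      then have "\<delta> = (1 / (m + real k)) *\<^sub>R (\<gamma> + \<epsilon>)" using k(3) by simp
      moreover have "\<gamma> + \<epsilon> \<in> nonneg_span C"
        using True bg(2) by (simp add: nonneg_span_add nonneg_span_base)
      then have "(1 / (m + real k)) *\<^sub>R (\<gamma> + \<epsilon>) \<in> nonneg_span C"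
        by (rule nonneg_span_scale) (use k(3) in simp)
      ultimately show False using C\<delta> k(1) by simp
    next
      case False
      then have "\<epsilon> \<in> B" using k(4) Z by blast
      have "\<gamma> = (1 + real k / m) *\<^sub>R \<beta> + (real k / m) *\<^sub>R \<epsilon>"
      proof -
        have "real k *\<^sub>R \<delta> = (real k / m) *\<^sub>R (\<beta> + \<epsilon>)" unfolding k(6) using k(3) by simp
        then show ?thesis unfolding k(5) by (simp add: algebra_simps)
      qed
      then have "\<gamma> \<in> B"
        by (rule closed_in_setD[OF cl(1) bg(1) \<open>\<epsilon> \<in> B\<close> Zbg(2)]) (use k(3) in simp_all)
      then show False using bg(2) Z by blast
    qed
  qed
  have eq0: "sum_mset M + real 0 *\<^sub>R \<delta> = sum_mset N" using MN(4) by simp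
  obtain M' N' m' where *: "set_mset M' \<subseteq> B" "set_mset N' \<subseteq> C" "sum_mset M' + real m' *\<^sub>R \<delta> = sum_mset N'"
      "sum_mset N' \<noteq> 0" "\<forall>\<beta>\<in>#M'. \<forall>\<gamma>\<in>#N'. \<pi> \<beta> \<bullet> \<pi> \<gamma> \<le> 0"
    using descent[OF cl Z lin(2) ht step' MN(1,2) eq0 N0] by blast
  have "\<pi> (sum_mset M') = \<pi> (sum_mset N')"
    unfolding *(3)[symmetric] by (simp add: linear_add[OF lin(1)] linear_scale[OF lin(1)] ker(1))
  moreover have "\<pi> (sum_mset M') \<bullet> \<pi> (sum_mset N') \<le> 0"
    by (rule inner_sum_mset_pairs_nonpos[OF lin(1)]) (use *(5) in blast)
  ultimately have "\<pi> (sum_mset N') \<bullet> \<pi> (sum_mset N') \<le> 0" by simp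
  then have "\<pi> (sum_mset N') = 0" by (metis inner_ge_zero inner_eq_zero_iff order_antisym)
  have NC: "sum_mset N' \<in> nonneg_span C" using *(2) by (rule nonneg_span_sum_mset)
  then have "sum_mset N' \<in> span Z"
    using nonneg_span_subset_span span_mono[of C Z] Z(1) by blast
  then obtain c where c: "sum_mset N' = c *\<^sub>R \<delta>"
    using ker(2) \<open>\<pi> (sum_mset N') = 0\<close> by (auto simp: span_singleton)
  then have "\<delta> \<noteq> 0" "c \<noteq> 0" using *(4) by auto
  have "N' \<noteq> {#}" using *(4) by auto
  have "0 < ht (sum_mset N')"
    by (rule linear_sum_mset_pos[OF lin(2) _ \<open>N' \<noteq> {#}\<close>]) (use *(2) Z ht(1) in blast)
  then have "0 < c" using ht(2)[OF \<open>\<delta> \<noteq> 0\<close>] c by (simp add: linear_scale[OF lin(2)] zero_less_mult_iff)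
  then have "\<delta> = (1 / c) *\<^sub>R sum_mset N'" using c by simp
  moreover have "(1 / c) *\<^sub>R sum_mset N' \<in> nonneg_span C"
    by (rule nonneg_span_scale[OF NC]) (use \<open>0 < c\<close> in simp)
  ultimately show False using C\<delta> \<open>\<delta> \<noteq> 0\<close> by simp
qed

text \<open>The hypotheses are symmetric in \<open>B\<close> and \<open>C\<close>, so the one-sided
  version applies with the cone that misses \<delta> in the role of \<open>C\<close>.\<close>

lemma nonneg_span_Int_eq_0:
  fixes \<pi> :: "'v::real_vector \<Rightarrow> 'w::real_inner" and ht :: "'v \<Rightarrow> real"
  assumes finZ: "finite Z" and \<Delta>: "finite \<Delta>" "independent \<Delta>"
    and int: "\<And>z. z \<in> Z \<Longrightarrow> \<exists>c::'v \<Rightarrow> int. z = (\<Sum>a\<in>\<Delta>. of_int (c a) *\<^sub>R a)"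
    and cl: "closed_in_set Z B" "closed_in_set Z C" and Z: "B \<union> C = Z" "B \<inter> C = {}"
    and lin: "linear \<pi>" "linear ht" and ht: "\<And>z. z \<in> Z \<Longrightarrow> 0 < ht z" "\<delta> \<noteq> 0 \<Longrightarrow> 0 < ht \<delta>"
    and ker: "\<pi> \<delta> = 0" "\<And>v. v \<in> span Z \<Longrightarrow> \<pi> v = 0 \<Longrightarrow> v \<in> span {\<delta>}"
    and step: "\<And>\<beta> \<gamma>. \<beta> \<in> Z \<Longrightarrow> \<gamma> \<in> Z \<Longrightarrow> \<beta> \<noteq> \<gamma> \<Longrightarrow> 0 < \<pi> \<beta> \<bullet> \<pi> \<gamma> \<Longrightarrow>
      (\<exists>\<rho>\<in>Z. \<beta> = \<gamma> + \<rho> \<or> \<gamma> = \<beta> + \<rho>) \<or>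
      (\<delta> \<noteq> 0 \<and> (\<exists>k::nat. \<exists>m>0. \<exists>\<epsilon>\<in>Z. 0 < k \<and>
        (\<beta> = \<gamma> + real k *\<^sub>R \<delta> \<and> \<gamma> + \<epsilon> = m *\<^sub>R \<delta> \<or> \<gamma> = \<beta> + real k *\<^sub>R \<delta> \<and> \<beta> + \<epsilon> = m *\<^sub>R \<delta>)))"
    and BC\<delta>: "\<delta> \<noteq> 0 \<Longrightarrow> \<delta> \<notin> nonneg_span B \<or> \<delta> \<notin> nonneg_span C"
  shows "nonneg_span B \<inter> nonneg_span C = {0}"
proof -
  have "nonneg_span B \<inter> nonneg_span C \<subseteq> {0}"
  proof (cases "\<delta> \<noteq> 0 \<longrightarrow> \<delta> \<notin> nonneg_span C")
    case True
    then show ?thesis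
      by (intro nonneg_span_Int_subset_0[OF finZ \<Delta> int cl Z lin ht ker step]) auto
  next
    case False
    have "nonneg_span C \<inter> nonneg_span B \<subseteq> {0}"
      by (rule nonneg_span_Int_subset_0[OF finZ \<Delta> int cl(2,1) _ _ lin ht ker step])
        (use Z False BC\<delta> in auto)
    then show ?thesis by blast
  qed
  then show ?thesis by (auto intro: nonneg_span_zero)
qed

text \<open>The vector is the point of least norm in the convex hull of \<open>- B\<close> and
  \<open>C\<close>. The hull avoids 0: a vanishing convex combination yields a vector in both cones,
  hence 0, and positivity of \<open>ht\<close> then kills all coefficients.\<close>

lemma separating_vector:
  fixes B C :: "'v::real_inner set" and ht :: "'v \<Rightarrow> real"
  assumes fin: "finite B" "finite C" and sep: "nonneg_span B \<inter> nonneg_span C = {0}"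
    and lin: "linear ht" and ht: "\<And>z. z \<in> B \<union> C \<Longrightarrow> 0 < ht z"
  shows "\<exists>w. (\<forall>b\<in>B. w \<bullet> b < 0) \<and> (\<forall>c\<in>C. 0 < w \<bullet> c)"
proof (cases "B \<union> C = {}")
  case False
  define S where "S = convex hull (uminus ` B \<union> C)"
  have comp: "compact S" unfolding S_def using fin by (intro finite_imp_compact_convex_hull) auto
  have ne: "S \<noteq> {}" unfolding S_def using False by auto
  have "0 \<notin> S"
  proof
    assume "0 \<in> S"
    moreover have "S = {\<Sum>x\<in>uminus ` B \<union> C. u x *\<^sub>R x |u. (\<forall>x\<in>uminus ` B \<union> C. 0 \<le> u x) \<and> sum u (uminus ` B \<union> C) = 1}"
      unfolding S_def using fin by (subst convex_hull_finite) auto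
    ultimately obtain u where u: "\<forall>x\<in>uminus ` B \<union> C. 0 \<le> u x" "sum u (uminus ` B \<union> C) = 1"
      "(\<Sum>x\<in>uminus ` B \<union> C. u x *\<^sub>R x) = 0" by auto
    have disj: "uminus ` B \<inter> C = {}"
    proof (rule ccontr)
      assume "uminus ` B \<inter> C \<noteq> {}"
      then obtain b where "b \<in> B" "- b \<in> C" by auto
      then have "0 < ht b" "0 < ht (- b)" using ht by auto
      then show False using linear_neg[OF lin] by simp
    qed
    define v where "v = (\<Sum>b\<in>B. u (- b) *\<^sub>R b)"
    have "(\<Sum>x\<in>uminus ` B. u x *\<^sub>R x) = - v"
      unfolding v_def by (subst sum.reindex) (auto simp: inj_on_def sum_negf)
    moreover have "(\<Sum>x\<in>uminus ` B \<union> C. u x *\<^sub>R x) = (\<Sum>x\<in>uminus ` B. u x *\<^sub>R x) + (\<Sum>x\<in>C. u x *\<^sub>R x)"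
      by (rule sum.union_disjoint) (use fin disj in auto)
    ultimately have vC: "v = (\<Sum>x\<in>C. u x *\<^sub>R x)" using u(3) by simp
    have "v \<in> nonneg_span B" unfolding v_def
      by (rule nonneg_span_sum) (use u(1) in \<open>simp add: nonneg_span_scale nonneg_span_base\<close>)
    moreover have "v \<in> nonneg_span C" unfolding vC
      by (rule nonneg_span_sum) (use u(1) in \<open>simp add: nonneg_span_scale nonneg_span_base\<close>)
    ultimately have "v = 0" using sep by blast
    then have "ht v = 0" using linear_0[OF lin] by simp
    have "ht v = (\<Sum>b\<in>B. u (- b) * ht b)"
      unfolding v_def by (simp add: linear_sum[OF lin] linear_scale[OF lin])
    then have "(\<Sum>b\<in>B. u (- b) * ht b) = 0" using \<open>ht v = 0\<close> by simp
    moreover have "\<forall>b\<in>B. 0 \<le> u (- b) * ht b" using u(1) ht by (simp add: less_imp_le)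
    ultimately have "\<forall>b\<in>B. u (- b) * ht b = 0" using sum_nonneg_eq_0_iff[OF fin(1), of "\<lambda>b. u (- b) * ht b"] by simp
    then have uB: "\<forall>b\<in>B. u (- b) = 0" using ht by fastforce
    have "ht v = (\<Sum>c\<in>C. u c * ht c)"
      unfolding vC by (simp add: linear_sum[OF lin] linear_scale[OF lin])
    then have "(\<Sum>c\<in>C. u c * ht c) = 0" using \<open>ht v = 0\<close> by simp
    moreover have "\<forall>c\<in>C. 0 \<le> u c * ht c" using u(1) ht by (simp add: less_imp_le)
    ultimately have "\<forall>c\<in>C. u c * ht c = 0" using sum_nonneg_eq_0_iff[OF fin(2), of "\<lambda>c. u c * ht c"] by simp
    then have uC: "\<forall>c\<in>C. u c = 0" using ht by fastforce
    have "sum u (uminus ` B \<union> C) = 0" by (rule sum.neutral) (use uB uC in auto)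
    then show False using u(2) by simp
  qed
  obtain w where w: "w \<in> S" "\<And>y. y \<in> S \<Longrightarrow> norm w \<le> norm y"
    using continuous_attains_inf[OF comp ne continuous_on_norm_id] by blast
  have "w \<noteq> 0" using w(1) \<open>0 \<notin> S\<close> by auto
  have "convex S" unfolding S_def by (rule convex_convex_hull)
  have pos: "0 < w \<bullet> y" if "y \<in> S" for y
  proof -
    have "(0 - w) \<bullet> (y - w) \<le> 0"
      by (rule any_closest_point_dot[OF \<open>convex S\<close> compact_imp_closed[OF comp] w(1) that])
        (use w(2) in \<open>simp add: dist_norm\<close>)
    then have "w \<bullet> w \<le> w \<bullet> y" by (simp add: inner_diff_right)
    then show ?thesis using \<open>w \<noteq> 0\<close> by (metis inner_gt_zero_iff less_le_trans)
  qed
  have "w \<bullet> b < 0" if "b \<in> B" for b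
  proof -
    have "- b \<in> S" unfolding S_def using that by (intro hull_inc) auto
    then show ?thesis using pos[of "- b"] by simp
  qed
  moreover have "0 < w \<bullet> c" if "c \<in> C" for c
    using pos[of c] that unfolding S_def by (simp add: hull_inc)
  ultimately show ?thesis by blast
qed auto

section \<open>Finite root systems: Cartan integers and differences of roots\<close>

lemma neg_mem_root_system:
  assumes "finite_root_system \<Phi>" "\<alpha> \<in> \<Phi>" shows "- \<alpha> \<in> \<Phi>"
proof -
  have "\<alpha> \<noteq> 0" using assms unfolding finite_root_system_def by auto
  then have "2 * (\<alpha> \<bullet> \<alpha>) / (\<alpha> \<bullet> \<alpha>) = 2" by simp
  moreover have "\<alpha> - (2 * (\<alpha> \<bullet> \<alpha>) / (\<alpha> \<bullet> \<alpha>)) *\<^sub>R \<alpha> \<in> \<Phi>"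
    using assms unfolding finite_root_system_def by blast
  moreover have "\<alpha> - 2 *\<^sub>R \<alpha> = - \<alpha>" by (simp add: scaleR_2)
  ultimately show ?thesis by simp
qed

lemma root_eq_if_dependent:
  assumes "finite_root_system \<Phi>" "\<alpha> \<in> \<Phi>" "c *\<^sub>R \<alpha> \<in> \<Phi>" shows "c = 1 \<or> c = -1"
  using assms unfolding finite_root_system_def by blast

text \<open>Strict Cauchy-Schwarz bounds the product of the two Cartan integers by 3. One of them is
  therefore 1, and the corresponding reflection subtracts one root from the other exactly
  once.\<close>

lemma root_pos_inner:
  fixes \<Phi> :: "'v::real_inner set"
  assumes rs: "finite_root_system \<Phi>" and ab: "\<alpha> \<in> \<Phi>" "\<beta> \<in> \<Phi>" "0 < \<alpha> \<bullet> \<beta>" "\<alpha> \<noteq> \<beta>"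
  shows root_diff: "\<alpha> - \<beta> \<in> \<Phi>"
    and cartan_cases: "2 * (\<alpha> \<bullet> \<beta>) = \<beta> \<bullet> \<beta> \<or> 2 * (\<alpha> \<bullet> \<beta>) = 2 * (\<beta> \<bullet> \<beta>) \<or> 2 * (\<alpha> \<bullet> \<beta>) = 3 * (\<beta> \<bullet> \<beta>)"
proof -
  have nz: "\<alpha> \<noteq> 0" "\<beta> \<noteq> 0" using rs ab unfolding finite_root_system_def by auto
  have pos: "0 < \<alpha> \<bullet> \<alpha>" "0 < \<beta> \<bullet> \<beta>" using nz by simp_all
  have "2 * (\<alpha> \<bullet> \<beta>) / (\<beta> \<bullet> \<beta>) \<in> \<int>" "2 * (\<beta> \<bullet> \<alpha>) / (\<alpha> \<bullet> \<alpha>) \<in> \<int>"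
    using rs ab unfolding finite_root_system_def by blast+
  then obtain a b :: int where a: "2 * (\<alpha> \<bullet> \<beta>) / (\<beta> \<bullet> \<beta>) = of_int a" and b: "2 * (\<beta> \<bullet> \<alpha>) / (\<alpha> \<bullet> \<alpha>) = of_int b"
    by (auto elim!: Ints_cases)
  have a': "2 * (\<alpha> \<bullet> \<beta>) = of_int a * (\<beta> \<bullet> \<beta>)" and b': "2 * (\<alpha> \<bullet> \<beta>) = of_int b * (\<alpha> \<bullet> \<alpha>)"
    using a b pos by (simp_all add: field_simps inner_commute)
  have "0 < of_int a * (\<beta> \<bullet> \<beta>)" "0 < of_int b * (\<alpha> \<bullet> \<alpha>)" using a' b' ab(3) by linarith+
  then have ab0: "0 < a" "0 < b" using pos by (simp_all add: zero_less_mult_iff)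
  \<comment> \<open>The component of \<alpha> orthogonal to \<beta>. Reducedness makes it nonzero,
    and that makes Cauchy-Schwarz strict.\<close>
  have nprop: "\<alpha> - (\<alpha> \<bullet> \<beta> / (\<beta> \<bullet> \<beta>)) *\<^sub>R \<beta> \<noteq> 0"
  proof
    assume "\<alpha> - (\<alpha> \<bullet> \<beta> / (\<beta> \<bullet> \<beta>)) *\<^sub>R \<beta> = 0"
    then have e: "\<alpha> = (\<alpha> \<bullet> \<beta> / (\<beta> \<bullet> \<beta>)) *\<^sub>R \<beta>" by simp
    have "(\<alpha> \<bullet> \<beta> / (\<beta> \<bullet> \<beta>)) *\<^sub>R \<beta> \<in> \<Phi>" using e ab(1) by simp
    then have "\<alpha> \<bullet> \<beta> / (\<beta> \<bullet> \<beta>) = 1 \<or> \<alpha> \<bullet> \<beta> / (\<beta> \<bullet> \<beta>) = -1"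
      using root_eq_if_dependent[OF rs ab(2)] by blast
    moreover have "0 < \<alpha> \<bullet> \<beta> / (\<beta> \<bullet> \<beta>)" using ab(3) pos by simp
    ultimately have "\<alpha> \<bullet> \<beta> / (\<beta> \<bullet> \<beta>) = 1" by linarith
    then have "\<alpha> = 1 *\<^sub>R \<beta>" using e by metis
    then show False using ab(4) by simp
  qed
  then have "0 < (\<alpha> - (\<alpha> \<bullet> \<beta> / (\<beta> \<bullet> \<beta>)) *\<^sub>R \<beta>) \<bullet> (\<alpha> - (\<alpha> \<bullet> \<beta> / (\<beta> \<bullet> \<beta>)) *\<^sub>R \<beta>)" by simp
  also have "\<dots> = \<alpha> \<bullet> \<alpha> - (\<alpha> \<bullet> \<beta>) * (\<alpha> \<bullet> \<beta>) / (\<beta> \<bullet> \<beta>)"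
    using pos by (simp add: inner_diff_left inner_diff_right inner_commute field_simps)
  finally have lt: "(\<alpha> \<bullet> \<beta>) * (\<alpha> \<bullet> \<beta>) < (\<alpha> \<bullet> \<alpha>) * (\<beta> \<bullet> \<beta>)" using pos by (simp add: field_simps)
  have "(2 * (\<alpha> \<bullet> \<beta>)) * (2 * (\<alpha> \<bullet> \<beta>)) = of_int (a * b) * ((\<alpha> \<bullet> \<alpha>) * (\<beta> \<bullet> \<beta>))"
    by (subst a', subst b') simp
  then have "of_int (a * b) * ((\<alpha> \<bullet> \<alpha>) * (\<beta> \<bullet> \<beta>)) < 4 * ((\<alpha> \<bullet> \<alpha>) * (\<beta> \<bullet> \<beta>))" using lt by simp
  then have "of_int (a * b) < (4::real)" using pos by (simp add: mult_less_cancel_right)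
  then have ab4: "a * b < 4" by linarith
  have a3: "a \<le> 3"
  proof -
    have "a * 1 \<le> a * b" using ab0 by (intro mult_left_mono) auto
    then show ?thesis using ab4 by simp
  qed
  have "a = 1 \<or> a = 2 \<or> a = 3" using a3 ab0 by linarith
  then show "2 * (\<alpha> \<bullet> \<beta>) = \<beta> \<bullet> \<beta> \<or> 2 * (\<alpha> \<bullet> \<beta>) = 2 * (\<beta> \<bullet> \<beta>) \<or> 2 * (\<alpha> \<bullet> \<beta>) = 3 * (\<beta> \<bullet> \<beta>)"
    unfolding a' by auto
  have "a = 1 \<or> b = 1"
  proof (rule ccontr)
    assume "\<not> ?thesis"
    then have "2 * 2 \<le> a * b" using ab0 by (intro mult_mono) auto
    then show False using ab4 by simp
  qed
  then show "\<alpha> - \<beta> \<in> \<Phi>"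
  proof
    assume "a = 1"
    have "\<alpha> - (2 * (\<alpha> \<bullet> \<beta>) / (\<beta> \<bullet> \<beta>)) *\<^sub>R \<beta> \<in> \<Phi>"
      using rs ab unfolding finite_root_system_def by blast
    then show ?thesis unfolding a \<open>a = 1\<close> by simp
  next
    assume "b = 1"
    have "\<beta> - (2 * (\<beta> \<bullet> \<alpha>) / (\<alpha> \<bullet> \<alpha>)) *\<^sub>R \<alpha> \<in> \<Phi>"
      using rs ab unfolding finite_root_system_def by blast
    then have "\<beta> - \<alpha> \<in> \<Phi>" unfolding b \<open>b = 1\<close> by simp
    then show ?thesis using neg_mem_root_system[OF rs] by fastforce
  qed
qed

section \<open>Affinizations\<close>

text \<open>\<open>\<Psi>\<close> is the finite system and \<open>j0 p\<close> the least \<open>k\<close> for which \<open>p + k \<delta>\<close> is a positive root;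
  \<open>\<pi>\<close> projects along \<open>\<delta>\<close> and \<open>ht\<close> is the height.\<close>

locale affine_roots =
  fixes \<Psi> :: "'v::real_inner set" and \<delta> :: 'v and \<pi> :: "'v \<Rightarrow> 'v" and j0 :: "'v \<Rightarrow> int"
    and ht :: "'v \<Rightarrow> real" and \<Delta> :: "'v set"
  assumes rs: "finite_root_system \<Psi>"
    and lin_\<pi>: "linear \<pi>" and \<pi>_\<delta>: "\<pi> \<delta> = 0" and \<pi>_root: "p \<in> \<Psi> \<Longrightarrow> \<pi> p = p"
    and \<delta>_nz: "\<delta> \<noteq> 0"
    and j0_range: "p \<in> \<Psi> \<Longrightarrow> j0 p = 0 \<or> j0 p = 1"
    and j0_neg: "p \<in> \<Psi> \<Longrightarrow> j0 (- p) = 1 - j0 p"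
    and lin_ht: "linear ht" and ht_\<delta>: "0 < ht \<delta>"
    and ht_low: "p \<in> \<Psi> \<Longrightarrow> 0 < ht (p + of_int (j0 p) *\<^sub>R \<delta>)"
    and \<Delta>: "finite \<Delta>" "independent \<Delta>"
    and int_\<Delta>: "p \<in> \<Psi> \<Longrightarrow> \<exists>c::'v \<Rightarrow> int. p + of_int k *\<^sub>R \<delta> = (\<Sum>a\<in>\<Delta>. of_int (c a) *\<^sub>R a)"
begin

definition af :: "'v \<Rightarrow> int \<Rightarrow> 'v" where "af p k = p + of_int k *\<^sub>R \<delta>"

definition F :: "'v set" where "F = {af p k | p k. p \<in> \<Psi> \<and> j0 p \<le> k}"

abbreviation low :: "'v \<Rightarrow> 'v" where "low p \<equiv> af p (j0 p)"

text \<open>Order ideals are encoded by three closure properties that mention only \<Psi>, \<delta>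
  and \<open>j0\<close>, so the notion makes sense for every section of the system. As \<delta> is
  not a real root, the clause on sums does not cover the removal of copies of \<delta>; the last
  clause does. The middle clause supplies \<open>low (- p)\<close>, which completes a lift of
  \<open>p\<close> to a multiple of \<delta>.\<close>

definition ideal :: "'v set \<Rightarrow> bool" where
  "ideal Z \<longleftrightarrow> finite Z \<and> Z \<subseteq> F \<and> (\<forall>\<rho>\<in>F. \<forall>\<sigma>\<in>F. \<rho> + \<sigma> \<in> Z \<longrightarrow> \<rho> \<in> Z) \<and>
     (\<forall>p\<in>\<Psi>. \<forall>k. af p k \<in> Z \<and> j0 p < k \<longrightarrow> low (- p) \<in> Z) \<and>
     (\<forall>p\<in>\<Psi>. \<forall>k l. af p k \<in> Z \<and> j0 p \<le> l \<and> l \<le> k \<longrightarrow> af p l \<in> Z)"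

lemma root_nz: "p \<in> \<Psi> \<Longrightarrow> p \<noteq> 0"
  using rs unfolding finite_root_system_def by auto

lemma root_inner_pos: "p \<in> \<Psi> \<Longrightarrow> 0 < p \<bullet> p"
  using root_nz by simp

lemma neg_root [intro]: "p \<in> \<Psi> \<Longrightarrow> - p \<in> \<Psi>"
  using neg_mem_root_system[OF rs] .

lemma j0_nonneg: "p \<in> \<Psi> \<Longrightarrow> 0 \<le> j0 p"
  using j0_range by force

lemma af_add: "af p k + af q l = af (p + q) (k + l)"
  by (simp add: af_def algebra_simps)

lemma low_neg: "p \<in> \<Psi> \<Longrightarrow> low (- p) = \<delta> - low p"
  by (simp add: af_def j0_neg algebra_simps)

lemma \<pi>_af [simp]: "p \<in> \<Psi> \<Longrightarrow> \<pi> (af p k) = p"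
  unfolding af_def by (simp add: linear_add[OF lin_\<pi>] linear_scale[OF lin_\<pi>] \<pi>_\<delta> \<pi>_root)

lemma af_eq_iff:
  assumes "p \<in> \<Psi>" "q \<in> \<Psi>" shows "af p k = af q l \<longleftrightarrow> p = q \<and> k = l"
proof
  assume eq: "af p k = af q l"
  then have "\<pi> (af p k) = \<pi> (af q l)" by simp
  then have "p = q" using assms by simp
  then show "p = q \<and> k = l" using eq \<delta>_nz by (simp add: af_def)
qed simp

lemma af_in_F: "p \<in> \<Psi> \<Longrightarrow> af p k \<in> F \<longleftrightarrow> j0 p \<le> k"
  unfolding F_def by (auto simp: af_eq_iff)

lemma F_cases:
  assumes "z \<in> F" obtains p k where "p \<in> \<Psi>" "j0 p \<le> k" "z = af p k"
  using assms unfolding F_def by blast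

lemma ht_af: "ht (af p k) = ht p + of_int k * ht \<delta>"
  unfolding af_def by (simp add: linear_add[OF lin_ht] linear_scale[OF lin_ht])

lemma ht_low_pos: "p \<in> \<Psi> \<Longrightarrow> 0 < ht (low p)"
  using ht_low by (simp add: af_def)

lemma ht_pos: "z \<in> F \<Longrightarrow> 0 < ht z"
proof (erule F_cases)
  fix p k assume p: "p \<in> \<Psi>" "j0 p \<le> k" and z: "z = af p k"
  have "of_int (j0 p) * ht \<delta> \<le> of_int k * ht \<delta>" using p(2) ht_\<delta> by (intro mult_right_mono) auto
  then have "ht (low p) \<le> ht z" unfolding z by (simp add: ht_af)
  then show "0 < ht z" using ht_low_pos[OF p(1)] by linarith
qed

lemma ht_low_less: "p \<in> \<Psi> \<Longrightarrow> ht (low p) < ht \<delta>"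
  using ht_low_pos[of "- p"] low_neg[of p] neg_root by (simp add: linear_diff[OF lin_ht])

text \<open>Heights of the lowest lifts lie strictly between \<open>0\<close> and \<open>ht \<delta>\<close>.\<close>

lemma j0_add:
  assumes "p \<in> \<Psi>" "q \<in> \<Psi>" "p + q \<in> \<Psi>"
  shows "j0 (p + q) = j0 p + j0 q \<or> j0 p + j0 q = j0 (p + q) + 1"
proof -
  define d where "d = j0 p + j0 q - j0 (p + q)"
  have "ht (low p) + ht (low q) = ht (low (p + q)) + of_int d * ht \<delta>"
    by (simp add: ht_af d_def algebra_simps linear_add[OF lin_ht])
  moreover have "ht (low p) < ht \<delta>" "ht (low q) < ht \<delta>" "ht (low (p + q)) < ht \<delta>"
    "0 < ht (low p)" "0 < ht (low q)" "0 < ht (low (p + q))"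
    using assms ht_low_less ht_low_pos by auto
  ultimately have "of_int d * ht \<delta> < 2 * ht \<delta>" "(-1) * ht \<delta> < of_int d * ht \<delta>" by linarith+
  then have "of_int d < (2::real)" "-1 < (of_int d::real)" using ht_\<delta> by (simp_all only: mult_less_cancel_right)
  then have "d = 0 \<or> d = 1" by linarith
  then show ?thesis by (auto simp: d_def)
qed

lemma idealD:
  assumes "ideal Z"
  shows ideal_finite: "finite Z" and ideal_subset: "Z \<subseteq> F"
    and ideal_add: "\<rho> \<in> F \<Longrightarrow> \<sigma> \<in> F \<Longrightarrow> \<rho> + \<sigma> \<in> Z \<Longrightarrow> \<rho> \<in> Z"
    and ideal_neg: "p \<in> \<Psi> \<Longrightarrow> af p k \<in> Z \<Longrightarrow> j0 p < k \<Longrightarrow> low (- p) \<in> Z"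
    and ideal_string: "p \<in> \<Psi> \<Longrightarrow> af p k \<in> Z \<Longrightarrow> j0 p \<le> l \<Longrightarrow> l \<le> k \<Longrightarrow> af p l \<in> Z"
  using assms unfolding ideal_def by blast+

lemma ideal_mem_cases:
  assumes "ideal Z" "z \<in> Z" obtains p k where "p \<in> \<Psi>" "j0 p \<le> k" "z = af p k"
  using assms ideal_subset F_cases by blast

text \<open>Of the opposite vectors \<open>af (p - q) (k - l)\<close> and
  \<open>af (q - p) (l - k)\<close> exactly one is positive, because \<open>j0\<close> of opposite
  roots adds up to 1; the clause on sums then places it in \<open>Z\<close>.\<close>

lemma diff_in_ideal:
  assumes Z: "ideal Z" and z: "af p k \<in> Z" "af q l \<in> Z" and pq: "p \<in> \<Psi>" "q \<in> \<Psi>" "p \<noteq> q" "0 < p \<bullet> q"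
  shows "\<exists>\<rho>\<in>Z. af p k = af q l + \<rho> \<or> af q l = af p k + \<rho>"
proof -
  have d: "p - q \<in> \<Psi>" using root_diff[OF rs pq(1,2,4,3)] .
  then have d': "q - p \<in> \<Psi>" using neg_root by fastforce
  have F: "af p k \<in> F" "af q l \<in> F" using z ideal_subset[OF Z] by auto
  have e1: "af p k = af q l + af (p - q) (k - l)" "af p k = af (p - q) (k - l) + af q l"
    and e2: "af q l = af p k + af (q - p) (l - k)" "af q l = af (q - p) (l - k) + af p k"
    by (simp_all add: af_add)
  show ?thesis
  proof (cases "j0 (p - q) \<le> k - l")
    case True
    then have "af (p - q) (k - l) \<in> F" using d by (simp add: af_in_F)
    then show ?thesis using ideal_add[OF Z _ F(2)] e1 z(1) by metis
  next
    case False
    have "j0 (q - p) = 1 - j0 (p - q)" using j0_neg[OF d] by simp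
    then have "af (q - p) (l - k) \<in> F" using d' False by (simp add: af_in_F)
    then show ?thesis using ideal_add[OF Z _ F(1)] e2 z(2) by metis
  qed
qed

lemma diff_\<pi>_in_span: "v \<in> span F \<Longrightarrow> v - \<pi> v \<in> span {\<delta>}"
proof (induction rule: span_induct_alt)
  case base
  then show ?case by (simp add: linear_0[OF lin_\<pi>] span_zero)
next
  case (step c x y)
  obtain p k where x: "p \<in> \<Psi>" "x = af p k" using step(1) by (auto elim: F_cases)
  have "x - \<pi> x = of_int k *\<^sub>R \<delta>" unfolding x(2) using x(1) by simp (simp add: af_def)
  then have "x - \<pi> x \<in> span {\<delta>}" by (simp add: span_scale span_base)
  then have "c *\<^sub>R (x - \<pi> x) + (y - \<pi> y) \<in> span {\<delta>}"
    using step(2) by (intro span_add span_scale)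
  then show ?case by (simp add: linear_add[OF lin_\<pi>] linear_scale[OF lin_\<pi>] algebra_simps)
qed

text \<open>Elements with different finite parts differ by a root of \<open>Z\<close>. Two lifts of
  the same \<open>p\<close> differ by a multiple of \<delta>, and \<open>low (- p)\<close> is then
  the partner \<epsilon>. Only the position of \<delta> remains as a condition.\<close>

lemma ideal_weakly_separable:
  assumes Z: "ideal Z" and cl: "closed_in_set Z B" "closed_in_set Z C"
    and BC: "B \<union> C = Z" "B \<inter> C = {}"
    and \<delta>: "\<delta> \<notin> nonneg_span B \<or> \<delta> \<notin> nonneg_span C"
  shows "nonneg_span B \<inter> nonneg_span C = {0}"
proof (rule nonneg_span_Int_eq_0[OF ideal_finite[OF Z] \<Delta> _ cl BC lin_\<pi> lin_ht])
  show "\<exists>c::'v \<Rightarrow> int. z = (\<Sum>a\<in>\<Delta>. of_int (c a) *\<^sub>R a)" if z: "z \<in> Z" for z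
    using ideal_mem_cases[OF Z z] int_\<Delta> unfolding af_def by metis
  show "0 < ht z" if "z \<in> Z" for z using that ht_pos ideal_subset[OF Z] by blast
  show "0 < ht \<delta>" by (rule ht_\<delta>)
  show "\<pi> \<delta> = 0" by (rule \<pi>_\<delta>)
  show "v \<in> span {\<delta>}" if "v \<in> span Z" "\<pi> v = 0" for v
    using diff_\<pi>_in_span[of v] that span_mono[OF ideal_subset[OF Z]] by auto
  show "\<delta> \<notin> nonneg_span B \<or> \<delta> \<notin> nonneg_span C" by (rule \<delta>)
  have string: "\<exists>k::nat. \<exists>m>0. \<exists>\<epsilon>\<in>Z. 0 < k \<and> af p b = af p a + real k *\<^sub>R \<delta> \<and> af p a + \<epsilon> = m *\<^sub>R \<delta>"
    if p: "p \<in> \<Psi>" "af p a \<in> Z" "af p b \<in> Z" "a < b" for p a b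
  proof (intro exI conjI bexI)
    have a: "j0 p \<le> a" using p ideal_subset[OF Z] af_in_F by blast
    show "low (- p) \<in> Z" using ideal_neg[OF Z p(1,3)] a p(4) by simp
    show "0 < nat (b - a)" using p(4) by simp
    show "af p b = af p a + real (nat (b - a)) *\<^sub>R \<delta>" using p(4) by (simp add: af_def algebra_simps)
    show "(0::real) < of_int (a + j0 (- p))" using a j0_neg[OF p(1)] by simp
    show "af p a + low (- p) = of_int (a + j0 (- p)) *\<^sub>R \<delta>" unfolding af_add by (simp add: af_def)
  qed
  fix \<beta> \<gamma> assume bg: "\<beta> \<in> Z" "\<gamma> \<in> Z" "\<beta> \<noteq> \<gamma>" "0 < \<pi> \<beta> \<bullet> \<pi> \<gamma>"
  obtain p a where p: "p \<in> \<Psi>" "j0 p \<le> a" "\<beta> = af p a" using ideal_mem_cases[OF Z bg(1)] .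
  obtain q b where q: "q \<in> \<Psi>" "j0 q \<le> b" "\<gamma> = af q b" using ideal_mem_cases[OF Z bg(2)] .
  show "(\<exists>\<rho>\<in>Z. \<beta> = \<gamma> + \<rho> \<or> \<gamma> = \<beta> + \<rho>) \<or>
      (\<delta> \<noteq> 0 \<and> (\<exists>k::nat. \<exists>m>0. \<exists>\<epsilon>\<in>Z. 0 < k \<and>
        (\<beta> = \<gamma> + real k *\<^sub>R \<delta> \<and> \<gamma> + \<epsilon> = m *\<^sub>R \<delta> \<or> \<gamma> = \<beta> + real k *\<^sub>R \<delta> \<and> \<beta> + \<epsilon> = m *\<^sub>R \<delta>)))"
  proof (cases "p = q")
    case False
    then show ?thesis using diff_in_ideal[OF Z, of p a q b] bg p q by simp
  next
    case True
    then consider "a < b" | "b < a" using bg(3) p q by fastforce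
    then show ?thesis
    proof cases
      case 1
      then show ?thesis using string[of p a b] bg(1,2) p q True \<delta>_nz by blast
    next
      case 2
      then show ?thesis using string[of p b a] bg(1,2) p q True \<delta>_nz by blast
    qed
  qed
qed

end

text \<open>Irreducible of rank at most two: without orthogonal pairs of roots, as in \<open>A1\<close> and \<open>A2\<close>, both
  assumptions are vacuous.\<close>

locale affine_rank2 = affine_roots +
  assumes orth_span: "r \<in> \<Psi> \<Longrightarrow> s \<in> \<Psi> \<Longrightarrow> r \<bullet> s = 0 \<Longrightarrow> \<Psi> \<subseteq> span {r, s}"
    and orth_link: "r \<in> \<Psi> \<Longrightarrow> s \<in> \<Psi> \<Longrightarrow> r \<bullet> s = 0 \<Longrightarrow> \<exists>e\<in>\<Psi>. e \<bullet> r \<noteq> 0 \<and> e \<bullet> s \<noteq> 0"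
begin

section \<open>Orthogonal pairs of roots in rank two\<close>

lemma orth_coords:
  assumes "r \<in> \<Psi>" "s \<in> \<Psi>" "r \<bullet> s = 0" "e \<in> \<Psi>"
  shows "e = (e \<bullet> r / (r \<bullet> r)) *\<^sub>R r + (e \<bullet> s / (s \<bullet> s)) *\<^sub>R s"
proof -
  have "e \<in> span {r, s}" using orth_span assms by blast
  then obtain a b where e: "e = a *\<^sub>R r + b *\<^sub>R s"
    by (auto simp: span_insert span_singleton algebra_simps)
  have "s \<bullet> r = 0" using assms(3) by (simp add: inner_commute)
  then show ?thesis
    using root_inner_pos[OF assms(1)] root_inner_pos[OF assms(2)] assms(3)
    unfolding e by (simp add: inner_add_left)
qed

text \<open>The reflections in \<open>r\<close> and \<open>s\<close> change the sign of one
  coordinate and keep the other, so they carry a linking root into the open positive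
  quadrant.\<close>

lemma quadrant_root:
  assumes rs': "r \<in> \<Psi>" "s \<in> \<Psi>" "r \<bullet> s = 0"
  shows "\<exists>e\<in>\<Psi>. 0 < e \<bullet> r \<and> 0 < e \<bullet> s"
proof -
  have flip: "\<exists>e'\<in>\<Psi>. e' \<bullet> u = - (e \<bullet> u) \<and> e' \<bullet> u' = e \<bullet> u'"
    if "u \<in> \<Psi>" "e \<in> \<Psi>" "u \<bullet> u' = 0" for u u' e
  proof -
    have "e - (2 * (e \<bullet> u) / (u \<bullet> u)) *\<^sub>R u \<in> \<Psi>"
      using rs that unfolding finite_root_system_def by blast
    then show ?thesis using root_inner_pos[OF that(1)] that(3)
      by (intro bexI) (auto simp: inner_diff_left)
  qed
  obtain e where e: "e \<in> \<Psi>" "e \<bullet> r \<noteq> 0" "e \<bullet> s \<noteq> 0" using orth_link[OF assms] by blast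
  obtain e1 where e1: "e1 \<in> \<Psi>" "0 < e1 \<bullet> r" "e1 \<bullet> s \<noteq> 0"
    using flip[OF rs'(1) e(1) rs'(3)] e by (cases "0 < e \<bullet> r") (force simp: not_less)+
  have "s \<bullet> r = 0" using rs'(3) by (simp add: inner_commute)
  then obtain e2 where e2: "e2 \<in> \<Psi>" "e2 \<bullet> s = - (e1 \<bullet> s)" "e2 \<bullet> r = e1 \<bullet> r"
    using flip[OF rs'(2) e1(1), of r] by blast
  have "0 < e1 \<bullet> s \<or> 0 < e2 \<bullet> s" using e1(3) e2(2) by linarith
  then show ?thesis
  proof
    assume "0 < e1 \<bullet> s"
    then show ?thesis using e1 by blast
  next
    assume "0 < e2 \<bullet> s"
    moreover have "0 < e2 \<bullet> r" using e1(2) e2(3) by simp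
    ultimately show ?thesis using e2(1) by blast
  qed
qed

text \<open>A positive coordinate along \<open>u\<close> is 1/2, 1 or 3/2. In the last case
  subtracting \<open>u\<close> gives a root with coordinate 1/2 and leaves the other coordinate
  alone.\<close>

lemma quadrant_root_small:
  assumes rs': "r \<in> \<Psi>" "s \<in> \<Psi>" "r \<bullet> s = 0"
  shows "\<exists>e\<in>\<Psi>. (2 * (e \<bullet> r) = r \<bullet> r \<or> e \<bullet> r = r \<bullet> r) \<and> (2 * (e \<bullet> s) = s \<bullet> s \<or> e \<bullet> s = s \<bullet> s)"
proof -
  have sr: "s \<bullet> r = 0" using rs'(3) by (simp add: inner_commute)
  have red: "\<exists>e'\<in>\<Psi>. (2 * (e' \<bullet> u) = u \<bullet> u \<or> e' \<bullet> u = u \<bullet> u) \<and> e' \<bullet> u' = e \<bullet> u'"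
    if u: "u \<in> \<Psi>" "e \<in> \<Psi>" "u \<bullet> u' = 0" "0 < e \<bullet> u" "e \<bullet> u' \<noteq> 0" for u u' e
  proof -
    have ne: "e \<noteq> u" using u by auto
    consider "2 * (e \<bullet> u) = u \<bullet> u \<or> e \<bullet> u = u \<bullet> u" | "2 * (e \<bullet> u) = 3 * (u \<bullet> u)"
      using cartan_cases[OF rs u(2,1,4) ne] by fastforce
    then show ?thesis
    proof cases
      case 1
      then show ?thesis using u(2) by blast
    next
      case 2
      have "e - u \<in> \<Psi>" using root_diff[OF rs u(2,1,4) ne] .
      moreover have "2 * ((e - u) \<bullet> u) = u \<bullet> u" using 2 by (simp add: inner_diff_left)
      moreover have "(e - u) \<bullet> u' = e \<bullet> u'" using u(3) by (simp add: inner_diff_left)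
      ultimately show ?thesis by blast
    qed
  qed
  obtain e where e: "e \<in> \<Psi>" "0 < e \<bullet> r" "0 < e \<bullet> s" using quadrant_root[OF assms] by blast
  obtain e1 where e1: "e1 \<in> \<Psi>" "2 * (e1 \<bullet> r) = r \<bullet> r \<or> e1 \<bullet> r = r \<bullet> r" "e1 \<bullet> s = e \<bullet> s"
    using red[OF rs'(1) e(1) rs'(3) e(2)] e(3) by force
  have "e1 \<bullet> r \<noteq> 0" using e1(2) root_inner_pos[OF rs'(1)] by auto
  then obtain e2 where e2: "e2 \<in> \<Psi>" "2 * (e2 \<bullet> s) = s \<bullet> s \<or> e2 \<bullet> s = s \<bullet> s" "e2 \<bullet> r = e1 \<bullet> r"
    using red[OF rs'(2) e1(1) sr] e1(3) e(3) by auto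
  have "2 * (e2 \<bullet> r) = r \<bullet> r \<or> e2 \<bullet> r = r \<bullet> r" using e1(2) unfolding e2(3) .
  then show ?thesis using e2(1,2) by blast
qed

text \<open>A root in the quadrant has coordinates 1/2 or 1. Equal coordinates give the two
  alternatives; unequal ones would make half of \<open>r\<close> or of \<open>s\<close> a root. The
  first case is a short pair in \<open>B2\<close>, the second a long pair in \<open>B2\<close> or an
  orthogonal pair in \<open>G2\<close>.\<close>

lemma orth_cases:
  assumes rs': "r \<in> \<Psi>" "s \<in> \<Psi>" "r \<bullet> s = 0"
  obtains "r + s \<in> \<Psi>" | e e' where "e \<in> \<Psi>" "e' \<in> \<Psi>" "r = e + e'" "s = e - e'"
proof -
  obtain e where e: "e \<in> \<Psi>" "2 * (e \<bullet> r) = r \<bullet> r \<or> e \<bullet> r = r \<bullet> r" "2 * (e \<bullet> s) = s \<bullet> s \<or> e \<bullet> s = s \<bullet> s"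
    using quadrant_root_small[OF assms] by blast
  have p: "0 < r \<bullet> r" "0 < s \<bullet> s" using root_inner_pos rs' by auto
  have er: "0 < e \<bullet> r" "0 < e \<bullet> s" using e p by linarith+
  have ne: "e \<noteq> r" "e \<noteq> s" using er rs'(3) by (auto simp: inner_commute)
  have dr: "e - r \<in> \<Psi>" and ds: "e - s \<in> \<Psi>" using root_diff[OF rs e(1)] rs' er ne by auto
  define a where "a = e \<bullet> r / (r \<bullet> r)"
  define b where "b = e \<bullet> s / (s \<bullet> s)"
  have c: "e = a *\<^sub>R r + b *\<^sub>R s" unfolding a_def b_def using orth_coords[OF rs' e(1)] .
  have v: "a = 1/2 \<or> a = 1" "b = 1/2 \<or> b = 1"
    unfolding a_def b_def using e p by (auto simp: field_simps)
  have half: "(1/2) *\<^sub>R u \<notin> \<Psi>" if "u \<in> \<Psi>" for u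
    using root_eq_if_dependent[OF rs that, of "1/2"] by auto
  consider "e = (1/2) *\<^sub>R r + (1/2) *\<^sub>R s" | "e = r + s" | "e - s = (1/2) *\<^sub>R r" | "e - r = (1/2) *\<^sub>R s"
  proof -
    note that
    moreover have "e = (1/2) *\<^sub>R r + (1/2) *\<^sub>R s" if "a = 1/2" "b = 1/2" using c unfolding that .
    moreover have "e = r + s" if "a = 1" "b = 1" using c unfolding that by simp
    moreover have "e - s = (1/2) *\<^sub>R r" if "a = 1/2" "b = 1" using c unfolding that by simp
    moreover have "e - r = (1/2) *\<^sub>R s" if "a = 1" "b = 1/2" using c unfolding that by simp
    ultimately show thesis using v by blast
  qed
  then show thesis
  proof cases
    case 1
    have "r - e \<in> \<Psi>" using neg_root[OF dr] by simp
    moreover have "r = (1/2) *\<^sub>R r + (1/2) *\<^sub>R r" "s = (1/2) *\<^sub>R s + (1/2) *\<^sub>R s" by (simp_all flip: scaleR_add_left)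
    then have "r = e + (r - e)" "s = e - (r - e)" using 1 by (auto simp: algebra_simps)
    ultimately show thesis using that(2) e(1) by blast
  next
    case 2
    then show thesis using that(1) e(1) by simp
  next
    case 3
    then show thesis using ds half[OF rs'(1)] by simp
  next
    case 4
    then show thesis using dr half[OF rs'(2)] by simp
  qed
qed

text \<open>The common core of the orthogonal case: \<open>b - c = c' - b' = n \<tau>\<close> leaves no side for \<open>\<tau>\<close>.\<close>

lemma no_common_difference:
  assumes cl: "closed_in_set Z B" "closed_in_set Z C" and BC: "B \<union> C = Z" "B \<inter> C = {}"
    and "b \<in> B" "b' \<in> B" "c \<in> C" "c' \<in> C" "\<tau> \<in> Z" "b = c + n *\<^sub>R \<tau>" "c' = b' + n *\<^sub>R \<tau>" "0 \<le> n"
  shows False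
proof (cases "\<tau> \<in> B")
  case True
  then have "c' \<in> B" using closed_in_setD[OF cl(1), of b' \<tau> c' 1 n] assms by auto
  then show False using assms by blast
next
  case False
  then have "b \<in> C" using closed_in_setD[OF cl(2), of c \<tau> b 1 n] assms by auto
  then show False using assms by blast
qed

text \<open>The roots \<open>e + e'\<close> and \<open>e - e'\<close> differ by twice
  \<open>e'\<close>, and \<open>e + e'\<close> and \<open>- (e - e')\<close> differ by twice
  \<open>e\<close>. Whether a \<delta> is carried in \<open>(e - e') + e' = e\<close> decides which
  of the two differences also holds for the lowest lifts; hence the factor 2 below.\<close>

lemma no_orth_half:
  assumes Z: "ideal Z" and cl: "closed_in_set Z B" "closed_in_set Z C" and BC: "B \<union> C = Z" "B \<inter> C = {}"
    and e: "e \<in> \<Psi>" "e' \<in> \<Psi>" "e + e' \<in> \<Psi>" "e - e' \<in> \<Psi>"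
    and mem: "low (e + e') \<in> B" "low (- (e + e')) \<in> B" "low (e - e') \<in> C" "low (- (e - e')) \<in> C"
    and j: "j0 (e + e') = j0 e + j0 e'"
  shows False
proof -
  have sum: "low (e + e') = low e + low e'" "low (e + e') = low e' + low e" using j by (simp_all add: af_add add.commute)
  have "low e \<in> F" "low e' \<in> F" using e by (simp_all add: af_in_F)
  then have Ze: "low e \<in> Z" "low e' \<in> Z" using ideal_add[OF Z] mem(1) BC(1) sum by (metis UnI1)+
  have n: "low (- (e + e')) = \<delta> - low (e + e')" "low (- (e - e')) = \<delta> - low (e - e')"
    using e low_neg by blast+
  have "j0 (e - e' + e') = j0 (e - e') + j0 e' \<or> j0 (e - e') + j0 e' = j0 (e - e' + e') + 1"
    by (rule j0_add) (use e in simp_all)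
  then consider "j0 e = j0 (e - e') + j0 e'" | "j0 (e - e') + j0 e' = j0 e + 1" by auto
  then show False
  proof cases
    case 1
    then have s: "low e = low (e - e') + low e'" by (simp add: af_add)
    have "low (e + e') = low (e - e') + 2 *\<^sub>R low e'" unfolding sum(1) s by (simp add: scaleR_2)
    moreover from this have "low (- (e - e')) = low (- (e + e')) + 2 *\<^sub>R low e'" unfolding n by simp
    ultimately show False
      using no_common_difference[OF cl BC mem(1,2,3,4) Ze(2), of 2] by simp
  next
    case 2
    then have "low (e - e') + low e' = af e (j0 e + 1)" by (simp add: af_add)
    also have "\<dots> = low e + \<delta>" by (simp add: af_def scaleR_add_left)
    finally have s: "low e' = low e + low (- (e - e'))" unfolding n(2) by (simp add: algebra_simps)
    have a: "low (e + e') = low (- (e - e')) + 2 *\<^sub>R low e" unfolding sum(1) s by (simp add: scaleR_2)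
    then have "low (e - e') = low (- (e + e')) + 2 *\<^sub>R low e" unfolding n by (simp add: algebra_simps)
    then show False
      using no_common_difference[OF cl BC mem(1,2,4,3) Ze(1), of 2] a by simp
  qed
qed

text \<open>Both opposite pairs add up to \<delta>, so a difference between an element of one pair
  and an element of the other reappears between the two remaining elements. A root linking
  \<open>r\<close> and \<open>s\<close> makes such a difference a positive multiple of an element of
  \<open>Z\<close>.\<close>

lemma no_orth_quadruple:
  assumes Z: "ideal Z" and cl: "closed_in_set Z B" "closed_in_set Z C" and BC: "B \<union> C = Z" "B \<inter> C = {}"
    and rs': "r \<in> \<Psi>" "s \<in> \<Psi>" "r \<bullet> s = 0"
    and mem: "low r \<in> B" "low (- r) \<in> B" "low s \<in> C" "low (- s) \<in> C"
  shows False
  using rs'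
proof (cases rule: orth_cases)
  case 1
  have n: "low (- r) = \<delta> - low r" "low (- s) = \<delta> - low s" using rs' low_neg by blast+
  have F: "low (r + s) \<in> F" "low (- (r + s)) \<in> F" "low r \<in> F" "low s \<in> F" "low (- r) \<in> F"
    using 1 neg_root[OF 1] rs' by (simp_all add: af_in_F neg_root)
  consider "j0 (r + s) = j0 r + j0 s" | "j0 r + j0 s = j0 (r + s) + 1" using j0_add[OF rs'(1,2) 1] by blast
  then show False
  proof cases
    case a: 1
    then have "low (r + s) = low r + low s" by (simp add: af_add)
    then have t: "low (- (r + s)) = \<delta> - low r - low s" using low_neg[OF 1] by simp
    then have *: "low (- r) = low s + 1 *\<^sub>R low (- (r + s))" "low (- s) = low r + 1 *\<^sub>R low (- (r + s))"
      "low (- (r + s)) + low s = low (- r)"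
      unfolding n by simp_all
    have "low (- (r + s)) \<in> Z" using ideal_add[OF Z F(2,4)] *(3) mem(2) BC(1) by auto
    then show False using no_common_difference[OF cl BC mem(2,1,3,4) _ *(1,2)] by simp
  next
    case b: 2
    then have "low r + low s = af (r + s) (j0 (r + s) + 1)" by (simp add: af_add)
    also have "\<dots> = low (r + s) + \<delta>" by (simp add: af_def scaleR_add_left)
    finally have "low (r + s) = low r + low s - \<delta>" by simp
    then have *: "low r = low (- s) + 1 *\<^sub>R low (r + s)" "low s = low (- r) + 1 *\<^sub>R low (r + s)"
      "low (r + s) + low (- r) = low s"
      unfolding n by simp_all
    have "low (r + s) \<in> Z" using ideal_add[OF Z F(1,5)] *(3) mem(3) BC(1) by auto
    then show False using no_common_difference[OF cl BC mem(1,2,4,3) _ *(1,2)] by simp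
  qed
next
  case (2 e e')
  have e: "e + e' \<in> \<Psi>" "e - e' \<in> \<Psi>" using 2 rs' by simp_all
  consider "j0 (e + e') = j0 e + j0 e'" | "j0 e + j0 e' = j0 (e + e') + 1" using j0_add[OF 2(1,2) e(1)] by blast
  then show False
  proof cases
    case 1
    then show False using no_orth_half[OF Z cl BC 2(1,2) e] mem unfolding 2(3,4) by blast
  next
    case b: 2
    \<comment> \<open>Passing from \<open>(e, e')\<close> to \<open>(- e', - e)\<close> replaces
      \<open>r\<close> by \<open>- r\<close>, keeps \<open>s\<close>, and removes the carry.\<close>
    have n: "- e' + - e = - (e + e')" "- e' - - e = e - e'" by simp_all
    have "j0 (- e' + - e) = j0 (- e') + j0 (- e)"
      unfolding n using j0_neg[OF 2(1)] j0_neg[OF 2(2)] j0_neg[OF e(1)] b by simp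
    moreover have "- e' + - e \<in> \<Psi>" "- e' - - e \<in> \<Psi>" unfolding n using e neg_root by blast+
    ultimately show False
      using no_orth_half[OF Z cl BC neg_root[OF 2(2)] neg_root[OF 2(1)]] mem
      unfolding 2(3,4) n minus_minus by blast
  qed
qed

end

section \<open>The imaginary root lies in at most one of the two cones\<close>

context affine_rank2
begin

text \<open>In rank two the roots orthogonal to \<open>s\<close> lie on one line, so by reducedness
  every projection is \<open>r\<close> or \<open>- r\<close>. As the projections add up to 0, both
  signs occur.\<close>

lemma opposite_in_relation:
  assumes M: "\<beta>0 \<in># M" "\<And>\<beta>. \<beta> \<in># M \<Longrightarrow> \<exists>p\<in>\<Psi>. \<beta> = low p"
    and sum: "\<pi> (sum_mset M) = 0" and s: "s \<in> \<Psi>" "\<And>\<beta>. \<beta> \<in># M \<Longrightarrow> \<pi> \<beta> \<bullet> s = 0"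
  shows "low (- \<pi> \<beta>0) \<in># M"
proof -
  obtain r where r: "r \<in> \<Psi>" "\<beta>0 = low r" using M by blast
  have rs': "r \<bullet> s = 0" using s(2)[OF M(1)] r by simp
  define M0 where "M0 = M - {#\<beta>0#}"
  have Meq: "M = add_mset \<beta>0 M0" using M(1) by (simp add: M0_def)
  have "\<exists>\<beta>\<in>#M. \<pi> \<beta> \<bullet> r < 0"
  proof (rule ccontr)
    assume neg: "\<not> ?thesis"
    have "\<pi> (sum_mset M0) \<bullet> (- r) \<le> 0"
    proof (rule inner_sum_mset_nonpos[OF lin_\<pi>])
      fix \<beta> assume "\<beta> \<in># M0"
      then show "\<pi> \<beta> \<bullet> (- r) \<le> 0" using neg Meq by (auto simp: not_less)
    qed
    moreover have "r + \<pi> (sum_mset M0) = 0"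
      using sum r unfolding Meq by (simp add: linear_add[OF lin_\<pi>])
    then have "r \<bullet> r + \<pi> (sum_mset M0) \<bullet> r = 0"
      by (metis inner_add_left inner_zero_left)
    ultimately show False using root_inner_pos[OF r(1)] by simp
  qed
  then obtain \<beta> where b: "\<beta> \<in># M" "\<pi> \<beta> \<bullet> r < 0" by blast
  obtain q where q: "q \<in> \<Psi>" "\<beta> = low q" using M(2)[OF b(1)] by blast
  have qs: "q \<bullet> s = 0" "q \<bullet> r < 0" using s(2)[OF b(1)] b(2) q by simp_all
  have c: "q = (q \<bullet> r / (r \<bullet> r)) *\<^sub>R r" using orth_coords[OF r(1) s(1) rs' q(1)] qs by simp
  have "(q \<bullet> r / (r \<bullet> r)) *\<^sub>R r \<in> \<Psi>" using c q(1) by simp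
  then have "q \<bullet> r / (r \<bullet> r) = 1 \<or> q \<bullet> r / (r \<bullet> r) = -1" by (rule root_eq_if_dependent[OF rs r(1)])
  moreover have "q \<bullet> r / (r \<bullet> r) < 0" using qs root_inner_pos[OF r(1)] by (simp add: divide_neg_pos)
  ultimately have "q \<bullet> r / (r \<bullet> r) = -1" by linarith
  then have "q = (-1) *\<^sub>R r" using c by metis
  then have "q = - r" by simp
  then show ?thesis using b(1) q r by simp
qed

text \<open>The descent ends with two multisets whose projections sum to 0 and are mutually
  orthogonal. Each contains an opposite pair of lowest lifts, which is the configuration ruled out
  by \<open>no_orth_quadruple\<close>.\<close>

lemma \<delta>_not_in_both_low:
  assumes Z: "ideal Z" and cl: "closed_in_set Z B" "closed_in_set Z C" and BC: "B \<union> C = Z" "B \<inter> C = {}"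
    and low: "\<And>z. z \<in> Z \<Longrightarrow> \<exists>p\<in>\<Psi>. z = low p"
    and \<delta>B: "\<delta> \<in> nonneg_span B" and \<delta>C: "\<delta> \<in> nonneg_span C"
  shows False
proof -
  have fin: "finite B" "finite C" using ideal_finite[OF Z] BC by auto
  have int: "\<exists>c. z = (\<Sum>a\<in>\<Delta>. real_of_int (c a) *\<^sub>R a)" if "z \<in> B \<union> C" for z
    using low[of z] that BC(1) int_\<Delta> unfolding af_def by metis
  obtain M N where MN: "set_mset M \<subseteq> B" "set_mset N \<subseteq> C" "M \<noteq> {#}" "sum_mset M = sum_mset N"
    using natural_relation[OF fin BC(2) \<Delta> int \<delta>B \<delta>C \<delta>_nz] by blast
  have hZ: "0 < ht z" if "z \<in> Z" for z using that ht_pos ideal_subset[OF Z] by blast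
  have "0 < ht (sum_mset M)"
    by (rule linear_sum_mset_pos[OF lin_ht _ MN(3)]) (use MN(1) BC hZ in blast)
  then have N0: "sum_mset N \<noteq> 0" using MN(4) linear_0[OF lin_ht] by auto
  \<comment> \<open>The descent is run with 0 in place of \<delta>: distinct lowest lifts have
    distinct finite parts, so string differences never arise.\<close>
  have step: "(\<exists>\<rho>\<in>Z. \<beta> = \<gamma> + \<rho> \<or> \<gamma> = \<beta> + \<rho>) \<or> (\<exists>k::nat. 0 < k \<and> (0::'a) \<noteq> 0 \<and> \<beta> = \<gamma> + real k *\<^sub>R 0)"
    if bg: "\<beta> \<in> B" "\<gamma> \<in> C" "0 < \<pi> \<beta> \<bullet> \<pi> \<gamma>" for \<beta> \<gamma>
  proof -
    have bz: "\<beta> \<in> Z" "\<gamma> \<in> Z" "\<beta> \<noteq> \<gamma>" using bg BC by auto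
    obtain p where p: "p \<in> \<Psi>" "\<beta> = low p" using low bz(1) by blast
    obtain q where q: "q \<in> \<Psi>" "\<gamma> = low q" using low bz(2) by blast
    have "p \<noteq> q" using bz(3) p q by auto
    then show ?thesis using diff_in_ideal[OF Z, of p "j0 p" q "j0 q"] bz bg(3) p q by simp
  qed
  have eq0: "sum_mset M + real 0 *\<^sub>R 0 = sum_mset N" using MN(4) by simp
  have h0: "(0::'a) \<noteq> 0 \<Longrightarrow> 0 < ht 0" by simp
  obtain M' N' m' where *: "set_mset M' \<subseteq> B" "set_mset N' \<subseteq> C" "sum_mset M' + real m' *\<^sub>R 0 = sum_mset N'"
      "sum_mset N' \<noteq> 0" "\<forall>\<beta>\<in>#M'. \<forall>\<gamma>\<in>#N'. \<pi> \<beta> \<bullet> \<pi> \<gamma> \<le> 0"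
    using descent[OF cl BC lin_ht hZ h0 step MN(1,2) eq0 N0] by blast
  have eq: "sum_mset M' = sum_mset N'" using *(3) by simp
  have "\<pi> (sum_mset M') \<bullet> \<pi> (sum_mset N') \<le> 0"
    by (rule inner_sum_mset_pairs_nonpos[OF lin_\<pi>]) (use *(5) in blast)
  then have "\<pi> (sum_mset N') \<bullet> \<pi> (sum_mset N') \<le> 0" using eq by simp
  then have \<pi>N: "\<pi> (sum_mset N') = 0" by (metis inner_ge_zero inner_eq_zero_iff order_antisym)
  have \<pi>M: "\<pi> (sum_mset M') = 0" using \<pi>N eq by simp
  \<comment> \<open>For fixed \<beta> the products are nonpositive and add up to 0, so each of them
    vanishes.\<close>
  have orth: "\<pi> \<beta> \<bullet> \<pi> \<gamma> = 0" if bg: "\<beta> \<in># M'" "\<gamma> \<in># N'" for \<beta> \<gamma>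
  proof -
    define N0 where "N0 = N' - {#\<gamma>#}"
    have Neq: "N' = add_mset \<gamma> N0" using bg(2) by (simp add: N0_def)
    have "\<pi> (sum_mset N0) \<bullet> \<pi> \<beta> \<le> 0"
    proof (rule inner_sum_mset_nonpos[OF lin_\<pi>])
      fix \<gamma>' assume "\<gamma>' \<in># N0"
      then have "\<gamma>' \<in># N'" using Neq by simp
      then show "\<pi> \<gamma>' \<bullet> \<pi> \<beta> \<le> 0" using *(5) bg(1) by (simp add: inner_commute)
    qed
    moreover have "\<pi> \<gamma> + \<pi> (sum_mset N0) = 0" using \<pi>N unfolding Neq by (simp add: linear_add[OF lin_\<pi>])
    then have "\<pi> \<gamma> \<bullet> \<pi> \<beta> + \<pi> (sum_mset N0) \<bullet> \<pi> \<beta> = 0" by (metis inner_add_left inner_zero_left)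
    moreover have "\<pi> \<beta> \<bullet> \<pi> \<gamma> \<le> 0" using *(5) bg by blast
    ultimately show ?thesis by (simp add: inner_commute)
  qed
  have "M' \<noteq> {#}" "N' \<noteq> {#}" using eq *(4) by auto
  then obtain \<beta> \<gamma> where bg: "\<beta> \<in># M'" "\<gamma> \<in># N'" by blast
  have lowM: "\<exists>p\<in>\<Psi>. z = low p" if "z \<in># M'" for z using that *(1) BC(1) low by blast
  have lowN: "\<exists>p\<in>\<Psi>. z = low p" if "z \<in># N'" for z using that *(2) BC(1) low by blast
  obtain r where r: "r \<in> \<Psi>" "\<beta> = low r" using lowM bg by blast
  obtain s where s: "s \<in> \<Psi>" "\<gamma> = low s" using lowN bg by blast
  have "low (- \<pi> \<beta>) \<in># M'"
  proof (rule opposite_in_relation[OF bg(1) lowM \<pi>M s(1)])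
    show "\<pi> \<beta>' \<bullet> s = 0" if "\<beta>' \<in># M'" for \<beta>' using orth[OF that bg(2)] s by simp
  qed
  moreover have "low (- \<pi> \<gamma>) \<in># N'"
  proof (rule opposite_in_relation[OF bg(2) lowN \<pi>N r(1)])
    show "\<pi> \<gamma>' \<bullet> r = 0" if "\<gamma>' \<in># N'" for \<gamma>' using orth[OF bg(1) that] r by (simp add: inner_commute)
  qed
  moreover have "r \<bullet> s = 0" using orth[OF bg] r s by simp
  ultimately show False
    using no_orth_quadruple[OF Z cl BC r(1) s(1)] bg *(1,2) r s by auto
qed

text \<open>Let \<open>\<gamma> = x + k \<delta>\<close> be a highest element of \<open>Z\<close> that lies above \<open>\<delta>\<close>, and let \<open>f\<close> separate \<open>B\<close>
  without \<open>\<gamma>\<close> from \<open>C\<close>. Every decomposition of \<open>x\<close> lifts to decompositions of \<open>\<gamma>\<close>, one part of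
  which is in \<open>B\<close>; this controls the sign of \<open>f\<close> on all finite roots.\<close>

lemma \<delta>_not_in_both_high:
  assumes Z: "ideal Z" and cl: "closed_in_set Z B" "closed_in_set Z C" and BC: "B \<union> C = Z" "B \<inter> C = {}"
    and x: "x \<in> \<Psi>" "j0 x < k" and \<gamma>: "af x k \<in> B"
    and max: "\<And>z. z \<in> Z \<Longrightarrow> ht z \<le> ht (af x k)"
    and f: "linear f" "f \<delta> = (1::real)" "\<And>b. b \<in> B \<Longrightarrow> b \<noteq> af x k \<Longrightarrow> f b < 0" "\<And>c. c \<in> C \<Longrightarrow> 0 < f c"
    and \<delta>B: "\<delta> \<in> nonneg_span B" and \<delta>C: "\<delta> \<in> nonneg_span C"
  shows False
proof -
  have fin: "finite B" "finite C" using ideal_finite[OF Z] BC by auto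
  have f_af: "f (af p l) = f p + of_int l" for p l
    unfolding af_def by (simp add: linear_add[OF f(1)] linear_scale[OF f(1)] f(2))
  have f_diff: "f (u - v) = f u - f v" and f_add: "f (u + v) = f u + f v" and f_neg: "f (- u) = - f u" for u v
    by (simp_all add: linear_diff[OF f(1)] linear_add[OF f(1)] linear_neg[OF f(1)])
  have B_cases: "\<exists>p l. p \<in> \<Psi> \<and> j0 p \<le> l \<and> b = af p l" if "b \<in> B" for b
    using ideal_mem_cases[OF Z, of b] that BC(1) by blast
  have C_cases: "\<exists>p l. p \<in> \<Psi> \<and> j0 p \<le> l \<and> c = af p l" if "c \<in> C" for c
    using ideal_mem_cases[OF Z, of c] that BC(1) by blast
  have \<gamma>Z: "af x k \<in> Z" using \<gamma> BC by blast
  have notC: "z \<in> B" if "z \<in> Z" "f z \<le> 0" for z using that f(4) BC(1) by force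
  have notB: "z \<in> C" if "z \<in> Z" "0 \<le> f z" "z \<noteq> af x k" for z using that f(3) BC(1) by force
  have above: False if "z \<in> Z" "z = af x k + \<rho>" "\<rho> \<in> F" for z \<rho>
    using max[OF that(1)] ht_pos[OF that(3)] that(2) by (simp add: linear_add[OF lin_ht])
  \<comment> \<open>If \<open>x = u + z\<close> and \<open>f u\<close> is nonnegative, then
    \<open>low u\<close> is in \<open>C\<close>. The complementary lift of \<open>z\<close> must be
    in \<open>B\<close>, since otherwise closedness of \<open>C\<close> would put
    \<open>af x k\<close> into \<open>C\<close>.\<close>
  have dec: "j0 z \<le> k - j0 u \<and> f z + of_int (k - j0 u) < 0 \<and> af z (k - j0 u) \<in> B"
    if u: "u \<in> \<Psi>" "z \<in> \<Psi>" "x = u + z" "0 \<le> f u" for u z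
  proof -
    have j: "j0 u + j0 z \<le> k" using j0_add[OF u(1,2)] u(3) x by auto
    have F: "low u \<in> F" "af z (k - j0 u) \<in> F" using u j by (simp_all add: af_in_F)
    have s: "low u + af z (k - j0 u) = af x k" "af z (k - j0 u) + low u = af x k"
      using u(3) by (simp_all add: af_add add.commute)
    have inZ: "low u \<in> Z" "af z (k - j0 u) \<in> Z"
      using ideal_add[OF Z F] ideal_add[OF Z F(2,1)] s \<gamma>Z by simp_all
    have ne: "low u \<noteq> af x k" "af z (k - j0 u) \<noteq> af x k"
      using u x root_nz[OF u(1)] root_nz[OF u(2)] by (auto simp: af_eq_iff)
    have "low u \<in> C" by (rule notB[OF inZ(1) _ ne(1)]) (use u j0_nonneg[OF u(1)] in \<open>simp add: f_af\<close>)
    then have "af z (k - j0 u) \<notin> C"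
      using closed_in_set_addD[OF cl(2), of "low u" "af z (k - j0 u)"] s \<gamma>Z \<gamma> BC(2) by auto
    then have "af z (k - j0 u) \<in> B" using inZ BC(1) by blast
    then show ?thesis using f(3)[OF _ ne(2)] j by (auto simp: f_af)
  qed
  obtain cB where cB: "\<forall>b. 0 \<le> cB b" "\<delta> = (\<Sum>b\<in>B. cB b *\<^sub>R b)"
    using nonneg_span_finite[OF fin(1) \<delta>B] by blast
  define B0 where "B0 = B - {af x k}"
  define g where "g = cB (af x k)"
  have finB0: "finite B0" using fin by (simp add: B0_def)
  have \<delta>_split: "\<delta> = g *\<^sub>R af x k + (\<Sum>b\<in>B0. cB b *\<^sub>R b)"
    unfolding B0_def g_def using cB(2) sum.remove[OF fin(1) \<gamma>, of "\<lambda>b. cB b *\<^sub>R b"] by simp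
  have fB0: "f b < 0" if "b \<in> B0" for b using f(3) that by (simp add: B0_def)
  have f\<pi>B0: "f (\<pi> b) < 0" if b: "b \<in> B0" for b
  proof -
    have "b \<in> B" using b by (simp add: B0_def)
    then obtain p l where p: "p \<in> \<Psi>" "j0 p \<le> l" "b = af p l" using B_cases by blast
    then have "f p + of_int l < 0" using fB0[OF b] by (simp add: f_af)
    moreover have "0 \<le> l" using p j0_nonneg[OF p(1)] by simp
    ultimately show ?thesis using p by simp
  qed
  \<comment> \<open>As \<open>f\<close> is 1 at \<delta> and negative on the rest of
    \<open>B\<close>, the root \<open>af x k\<close> must take part in the representation of
    \<delta>.\<close>
  have "0 < g"
  proof (rule ccontr)
    assume "\<not> 0 < g"
    then have "g = 0" using cB(1) by (simp add: g_def order_antisym)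
    have "1 = (\<Sum>b\<in>B0. cB b * f b)"
      using arg_cong[OF \<delta>_split, of f] \<open>g = 0\<close>
      by (simp add: f(2) linear_0[OF f(1)] linear_sum[OF f(1)] linear_scale[OF f(1)])
    also have "\<dots> \<le> 0" by (rule sum_nonpos) (use cB(1) fB0 in \<open>simp add: mult_nonneg_nonpos less_imp_le\<close>)
    finally show False by simp
  qed
  have bal: "g *\<^sub>R x + (\<Sum>b\<in>B0. cB b *\<^sub>R \<pi> b) = 0"
    using arg_cong[OF \<delta>_split, of \<pi>] x(1)
    by (simp add: \<pi>_\<delta> linear_add[OF lin_\<pi>] linear_sum[OF lin_\<pi>] linear_scale[OF lin_\<pi>])
  have "\<exists>b\<in>B0. cB b \<noteq> 0"
  proof (rule ccontr)
    assume "\<not> ?thesis"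
    then have "(\<Sum>b\<in>B0. cB b *\<^sub>R \<pi> b) = 0" by (intro sum.neutral) simp
    then show False using bal \<open>0 < g\<close> root_nz[OF x(1)] by simp
  qed
  then obtain b0 where b0: "b0 \<in> B0" "0 < cB b0" using cB(1) by (metis order_le_less)
  have f_bal: "g * f x + (\<Sum>b\<in>B0. cB b * f (\<pi> b)) = 0"
    using arg_cong[OF bal, of f]
    by (simp add: f_add linear_0[OF f(1)] linear_sum[OF f(1)] linear_scale[OF f(1)])
  \<comment> \<open>Projection turns the representation of \<delta> into a vanishing combination of
    finite parts; \<open>f\<close> is negative on all of them except \<open>x\<close>, which must
    compensate.\<close>
  have fx: "0 < f x"
  proof -
    have "0 < (\<Sum>b\<in>B0. - (cB b * f (\<pi> b)))"
    proof (rule sum_pos2[OF finB0 b0(1)])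
      show "0 < - (cB b0 * f (\<pi> b0))" using b0(2) f\<pi>B0[OF b0(1)] by (simp add: mult_pos_neg)
      show "0 \<le> - (cB b * f (\<pi> b))" if "b \<in> B0" for b
        using cB(1) f\<pi>B0[OF that] by (simp add: mult_nonneg_nonpos less_imp_le)
    qed
    then have "0 < g * f x" using f_bal by (simp add: sum_negf)
    then show ?thesis using \<open>0 < g\<close> by (simp add: zero_less_mult_iff)
  qed
  have xx: "0 < x \<bullet> x" using root_inner_pos[OF x(1)] .
  \<comment> \<open>The right-hand side is the linear functional that agrees with \<open>f\<close>
    at \<open>x\<close> and vanishes on the orthogonal complement of \<open>x\<close>. For
    \<open>p \<bullet> x < 0\<close>, applying \<open>dec\<close> to
    \<open>x = - p + (p + x)\<close> gives \<open>f p < - f x\<close>; the ratio -3/2 needs a second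
    such step.\<close>
  have slope: "f p < (p \<bullet> x) / (x \<bullet> x) * f x" if p: "p \<in> \<Psi>" "p \<noteq> - x" "f p < 0" for p
  proof (cases "0 \<le> p \<bullet> x")
    case True
    then have "0 \<le> (p \<bullet> x) / (x \<bullet> x) * f x" using xx fx by simp
    then show ?thesis using p(3) by linarith
  next
    case False
    have np: "- p \<in> \<Psi>" "0 < (- p) \<bullet> x" "- p \<noteq> x" using p False by auto
    have y: "p + x \<in> \<Psi>" using neg_root[OF root_diff[OF rs np(1) x(1) np(2,3)]] by (simp add: add.commute)
    have "f (p + x) < 0"
      using dec[OF np(1) y] p(3) j0_nonneg[OF y] by (auto simp: f_neg)
    then have fy: "f p < - f x" by (simp add: f_add)
    have "- (x \<bullet> x) \<le> p \<bullet> x \<or> 2 * ((- p) \<bullet> x) = 3 * (x \<bullet> x)"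
      using cartan_cases[OF rs np(1) x(1) np(2,3)] xx unfolding inner_minus_left
      by (elim disjE) linarith+
    then consider "-1 \<le> (p \<bullet> x) / (x \<bullet> x)" | "2 * ((- p) \<bullet> x) = 3 * (x \<bullet> x)"
      using xx by (auto simp: pos_le_divide_eq)
    then show ?thesis
    proof cases
      case 1
      have "-1 * f x \<le> (p \<bullet> x) / (x \<bullet> x) * f x" using 1 fx by (intro mult_right_mono) auto
      then show ?thesis using fy by simp
    next
      case 2
      have px: "2 * (p \<bullet> x) = - 3 * (x \<bullet> x)" using 2 by simp
      have ny: "- (p + x) \<in> \<Psi>" using neg_root[OF y] .
      have "(- (p + x)) \<bullet> x = - (p \<bullet> x) - x \<bullet> x" by (simp add: inner_diff_left)
      then have "0 < (- (p + x)) \<bullet> x" using px xx by linarith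
      moreover have "- (p + x) \<noteq> x"
      proof
        assume "- (p + x) = x"
        then have "p + x = - x" by (metis minus_minus)
        then have "p = - x - x" by (simp only: eq_diff_eq)
        moreover have "(-2) *\<^sub>R x = - x - x" by (simp add: scaleR_2)
        ultimately have "(-2) *\<^sub>R x \<in> \<Psi>" using p(1) by simp
        then show False using root_eq_if_dependent[OF rs x(1)] by fastforce
      qed
      ultimately have "- (p + x) - x \<in> \<Psi>" using root_diff[OF rs ny x(1)] by blast
      then have "- (- (p + x) - x) \<in> \<Psi>" by (rule neg_root)
      then have y2: "p + x + x \<in> \<Psi>" by (simp add: algebra_simps)
      have "0 \<le> f (- (p + x))" unfolding f_neg using \<open>f (p + x) < 0\<close> by simp
      then have "j0 (p + x + x) \<le> k - j0 (- (p + x)) \<and> f (p + x + x) + of_int (k - j0 (- (p + x))) < 0"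
        using dec[OF ny y2] by simp
      then have "f (p + x + x) < 0" using j0_nonneg[OF y2] by linarith
      then have "f p < - 2 * f x" by (simp add: f_add)
      moreover have "(p \<bullet> x) / (x \<bullet> x) = - 3 / 2" using px xx by (simp add: field_simps)
      ultimately show ?thesis using fx by simp
    qed
  qed
  \<comment> \<open>Otherwise \<open>f\<close> minus the functional of \<open>slope\<close> would
    vanish at \<open>x\<close> and be negative at every other finite part occurring in
    \<open>bal\<close>, so that its weighted sum could not be 0.\<close>
  have "\<exists>b\<in>B. \<pi> b = - x"
  proof (rule ccontr)
    assume neg: "\<not> ?thesis"
    have sl: "f (\<pi> b) < (\<pi> b \<bullet> x) / (x \<bullet> x) * f x" if b: "b \<in> B0" for b
    proof (rule slope)
      have "b \<in> B" using b by (simp add: B0_def)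
      then show "\<pi> b \<in> \<Psi>" using B_cases by fastforce
      show "\<pi> b \<noteq> - x" using neg b by (auto simp: B0_def)
      show "f (\<pi> b) < 0" using f\<pi>B0[OF b] .
    qed
    have "0 < (\<Sum>b\<in>B0. cB b * ((\<pi> b \<bullet> x) / (x \<bullet> x) * f x - f (\<pi> b)))"
    proof (rule sum_pos2[OF finB0 b0(1)])
      show "0 < cB b0 * ((\<pi> b0 \<bullet> x) / (x \<bullet> x) * f x - f (\<pi> b0))"
        using b0(2) sl[OF b0(1)] by simp
      show "0 \<le> cB b * ((\<pi> b \<bullet> x) / (x \<bullet> x) * f x - f (\<pi> b))" if "b \<in> B0" for b
        using cB(1) sl[OF that] by simp
    qed
    also have "\<dots> = (f x / (x \<bullet> x)) * (\<Sum>b\<in>B0. cB b * (\<pi> b \<bullet> x)) - (\<Sum>b\<in>B0. cB b * f (\<pi> b))"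
      by (simp add: sum_distrib_left sum_subtractf right_diff_distrib mult_ac)
    also have "(\<Sum>b\<in>B0. cB b * (\<pi> b \<bullet> x)) = - g * (x \<bullet> x)"
    proof -
      have "g * (x \<bullet> x) + (\<Sum>b\<in>B0. cB b * (\<pi> b \<bullet> x)) = 0"
        using arg_cong[OF bal, of "\<lambda>v. v \<bullet> x"] by (simp add: inner_add_left inner_sum_left)
      then show ?thesis by simp
    qed
    finally have "0 < (f x / (x \<bullet> x)) * (- g * (x \<bullet> x)) - (\<Sum>b\<in>B0. cB b * f (\<pi> b))" .
    moreover have "(f x / (x \<bullet> x)) * (- g * (x \<bullet> x)) = - (g * f x)" using xx by simp
    ultimately show False using f_bal by linarith
  qed
  then obtain l where l: "j0 (- x) \<le> l" "af (- x) l \<in> B"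
    using B_cases by (metis \<pi>_af)
  have nx: "- x \<in> \<Psi>" "- x \<noteq> x" using neg_root[OF x(1)] f_neg[of x] fx by auto
  define l0 where "l0 = j0 (- x)"
  have l0: "0 \<le> l0" "l0 \<le> 1" using j0_range[OF nx(1)] by (auto simp: l0_def)
  have \<beta>Z: "af (- x) l0 \<in> Z" unfolding l0_def using ideal_string[OF Z nx(1) _ order_refl l(1)] l(2) BC(1) by blast
  have "af (- x) l \<noteq> af x k" using nx x(1) by (simp add: af_eq_iff)
  then have "f (af (- x) l) < 0" using f(3) l(2) by blast
  then have f\<beta>: "f (af (- x) l0) < 0" using l(1) by (simp add: f_af l0_def)
  then have \<beta>: "af (- x) l0 \<in> B" using notC \<beta>Z by simp
  \<comment> \<open>The roots \<open>af x k\<close> and \<open>af (- x) l0\<close> lie in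
    \<open>B\<close> and add up to \<open>(k + l0)\<close> copies of \<delta>, so every higher lift
    of \<open>- x\<close> is a nonnegative combination of them.\<close>
  have no_neg_x: False if c: "af (- x) l' \<in> C" for l'
  proof -
    have "0 < f (- x) + of_int l'" "f (- x) + of_int l0 < 0" using f(4)[OF c] f\<beta> by (simp_all add: f_af)
    then have less: "l0 < l'" by linarith
    have kl: "(0::real) < of_int (k + l0)" using l0 x(2) j0_nonneg[OF x(1)] by simp
    define t where "t = real_of_int (l' - l0) / of_int (k + l0)"
    have t: "0 \<le> t" "t * of_int (k + l0) = of_int (l' - l0)" using less kl by (simp_all add: t_def)
    have "af x k + af (- x) l0 = of_int (k + l0) *\<^sub>R \<delta>" unfolding af_add by (simp add: af_def)
    then have "t *\<^sub>R (af x k + af (- x) l0) = of_int (l' - l0) *\<^sub>R \<delta>" using t(2) by simp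
    then have eq: "af (- x) l' = t *\<^sub>R af x k + (1 + t) *\<^sub>R af (- x) l0"
      by (simp add: af_def algebra_simps)
    have "af (- x) l' \<in> Z" using c BC(1) by blast
    then have "af (- x) l' \<in> B"
      by (rule closed_in_setD[OF cl(1) \<gamma> \<beta> _ eq]) (use t in simp_all)
    then show False using c BC(2) by blast
  qed
  \<comment> \<open>Without orthogonality, \<open>af w j\<close> itself or what remains after
    removing \<open>af (- x) l0\<close> would be \<open>af x k\<close> plus a positive root, against
    the maximality of \<open>af x k\<close>.\<close>
  have orth: "w \<bullet> x = 0" if w: "w \<in> \<Psi>" "af w j \<in> C" "f w \<le> 0" for w j
  proof (rule ccontr)
    assume "w \<bullet> x \<noteq> 0"
    note fw = w(3)
    have jw: "j0 w \<le> j" using w BC(1) ideal_subset[OF Z] af_in_F by blast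
    have fwj: "0 < f w + of_int j" using f(4)[OF w(2)] by (simp add: f_af)
    have wx: "w \<noteq> x" "w \<noteq> - x" using fw fx no_neg_x w(2) by auto
    from \<open>w \<bullet> x \<noteq> 0\<close> consider "0 < w \<bullet> x" | "w \<bullet> x < 0" by linarith
    then show False
    proof cases
      case 1
      define z where "z = x - w"
      have "w - x \<in> \<Psi>" using root_diff[OF rs w(1) x(1) 1 wx(1)] .
      then have z: "z \<in> \<Psi>" unfolding z_def using neg_root by fastforce
      have "0 \<le> f z" using fw fx by (simp add: z_def f_diff)
      then have d: "f w + of_int (k - j0 z) < 0" using dec[OF z w(1)] by (simp add: z_def)
      then have "j > k - j0 z" using fwj by linarith
      then have "j0 (- z) \<le> j - k" using j0_neg[OF z] by simp
      then have "af (- z) (j - k) \<in> F" using neg_root[OF z] by (simp add: af_in_F)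
      moreover have "af w j = af x k + af (- z) (j - k)" by (simp add: af_add z_def)
      ultimately show False using above w(2) BC(1) by blast
    next
      case 2
      define y where "y = w + x"
      have nw: "- w \<in> \<Psi>" "- w \<noteq> x" "0 < (- w) \<bullet> x" using 2 wx w(1) by (auto simp: neg_root)
      have y: "y \<in> \<Psi>" unfolding y_def using neg_root[OF root_diff[OF rs nw(1) x(1) nw(3,2)]] by (simp add: add.commute)
      have d: "j0 y \<le> k - j0 (- w)" "f y + of_int (k - j0 (- w)) < 0"
        using dec[OF nw(1) y] fw by (simp_all add: y_def f_neg)
      have "f y = f w + f x" by (simp add: y_def f_add)
      then have "of_int (k - j0 (- w)) < real_of_int j" using d(2) fwj fx by linarith
      then have j1: "k - j0 (- w) + 1 \<le> j" by linarith
      then have "j0 y \<le> j - l0" using d(1) l0 by linarith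
      then have F: "af y (j - l0) \<in> F" using y by (simp add: af_in_F)
      have s: "af y (j - l0) + af (- x) l0 = af w j" by (simp add: af_add y_def)
      have yZ: "af y (j - l0) \<in> Z"
        using ideal_add[OF Z F, of "af (- x) l0"] s w(2) BC(1) \<beta>Z ideal_subset[OF Z] by auto
      have "af y (j - l0) \<notin> B"
        using closed_in_set_addD[OF cl(1) _ \<beta>, of "af y (j - l0)"] s w(2) BC by auto
      then have "0 < f (af y (j - l0))" using yZ BC(1) f(4) by blast
      then have "of_int (k - j0 (- w)) < real_of_int (j - l0)" using d(2) by (simp add: f_af)
      then have "j0 w \<le> j - l0 - k" using j0_neg[OF w(1)] by linarith
      then have "af w (j - l0 - k) \<in> F" using w(1) by (simp add: af_in_F)
      moreover have "af y (j - l0) = af x k + af w (j - l0 - k)" by (simp add: af_add y_def add.commute)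
      ultimately show False using above[OF yZ] by blast
    qed
  qed
  obtain cC where cC: "\<forall>c. 0 \<le> cC c" "\<delta> = (\<Sum>c\<in>C. cC c *\<^sub>R c)"
    using nonneg_span_finite[OF fin(2) \<delta>C] by blast
  \<comment> \<open>\<delta> lies in the cone of \<open>C\<close> and projects to 0, so the finite
    parts of \<open>C\<close> cannot all have positive \<open>f\<close>.\<close>
  have "\<exists>c\<in>C. f (\<pi> c) \<le> 0"
  proof (rule ccontr)
    assume neg: "\<not> ?thesis"
    have "\<exists>c\<in>C. cC c \<noteq> 0"
    proof (rule ccontr)
      assume "\<not> ?thesis"
      then have "(\<Sum>c\<in>C. cC c *\<^sub>R c) = 0" by (intro sum.neutral) simp
      then show False using cC(2) \<delta>_nz by simp
    qed
    then obtain c0 where c0: "c0 \<in> C" "0 < cC c0" using cC(1) by (metis order_le_less)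
    have "0 < (\<Sum>c\<in>C. cC c * f (\<pi> c))"
    proof (rule sum_pos2[OF fin(2) c0(1)])
      show "0 < cC c0 * f (\<pi> c0)" using c0 neg by (simp add: not_le)
      show "0 \<le> cC c * f (\<pi> c)" if "c \<in> C" for c using cC(1) neg that by (simp add: not_le less_imp_le)
    qed
    also have "(\<Sum>c\<in>C. cC c * f (\<pi> c)) = f (\<pi> \<delta>)"
      using arg_cong[OF cC(2), of "\<lambda>u. f (\<pi> u)"]
      by (simp add: linear_sum[OF lin_\<pi>] linear_scale[OF lin_\<pi>] linear_sum[OF f(1)] linear_scale[OF f(1)])
    finally show False by (simp add: \<pi>_\<delta> linear_0[OF f(1)])
  qed
  then obtain w j where w: "w \<in> \<Psi>" "af w j \<in> C" "f w \<le> 0" using C_cases by (metis \<pi>_af)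
  have wx: "w \<bullet> x = 0" "x \<bullet> w = 0" using orth[OF w(1,2)] w(3) by (simp_all add: inner_commute)
  have ww: "0 < w \<bullet> w" using root_inner_pos[OF w(1)] .
  have fwj: "0 < f w + of_int j" using f(4)[OF w(2)] by (simp add: f_af)
  \<comment> \<open>A root in the open quadrant of \<open>x\<close> and \<open>w\<close> with
    coordinates at most 1. Then \<open>x - e\<close> and \<open>w - e\<close> are roots whose
    coordinates have known signs, and with \<open>f x > 0\<close> and \<open>f w \<le> 0\<close>
    these control \<open>f\<close>.\<close>
  obtain e where e: "e \<in> \<Psi>" "2 * (e \<bullet> x) = x \<bullet> x \<or> e \<bullet> x = x \<bullet> x" "2 * (e \<bullet> w) = w \<bullet> w \<or> e \<bullet> w = w \<bullet> w"
    using quadrant_root_small[OF x(1) w(1) wx(2)] by blast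
  have ex: "0 < e \<bullet> x" "e \<bullet> x \<le> x \<bullet> x" and ew: "0 < e \<bullet> w" "e \<bullet> w \<le> w \<bullet> w" using e xx ww by linarith+
  have ne: "e \<noteq> x" "e \<noteq> w" using ex ew wx by auto
  have coord: "f p = (p \<bullet> x) / (x \<bullet> x) * f x + (p \<bullet> w) / (w \<bullet> w) * f w" if "p \<in> \<Psi>" for p
    using arg_cong[OF orth_coords[OF x(1) w(1) wx(2) that], of f] by (simp add: f_add linear_scale[OF f(1)])
  have xe: "x - e \<in> \<Psi>" using neg_root[OF root_diff[OF rs e(1) x(1) ex(1) ne(1)]] by simp
  have we: "w - e \<in> \<Psi>" using neg_root[OF root_diff[OF rs e(1) w(1) ew(1) ne(2)]] by simp
  have fe: "f e < 0"
  proof (rule ccontr)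
    assume "\<not> f e < 0"
    then have "f (x - e) < 0" using dec[OF e(1) xe] j0_nonneg[OF xe] by auto
    moreover have "0 \<le> ((x - e) \<bullet> x) / (x \<bullet> x) * f x"
      using ex xx fx by (simp add: inner_diff_left)
    moreover have "0 \<le> ((x - e) \<bullet> w) / (w \<bullet> w) * f w"
      by (intro mult_nonpos_nonpos divide_nonpos_pos) (use ew ww w(3) wx in \<open>simp_all add: inner_diff_left\<close>)
    ultimately show False using coord[OF xe] by linarith
  qed
  have fd: "f (w - e) \<le> 0"
  proof (rule ccontr)
    assume "\<not> f (w - e) \<le> 0"
    moreover have "((w - e) \<bullet> x) / (x \<bullet> x) * f x \<le> 0"
      by (intro mult_nonpos_nonneg divide_nonpos_pos) (use ex xx fx wx in \<open>simp_all add: inner_diff_left\<close>)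
    moreover have "((w - e) \<bullet> w) / (w \<bullet> w) * f w \<le> 0"
      by (intro mult_nonneg_nonpos divide_nonneg_pos) (use ew ww w(3) in \<open>simp_all add: inner_diff_left\<close>)
    ultimately show False using coord[OF we] by linarith
  qed
  have "0 \<le> f (x - e)" using fx fe by (simp add: f_diff)
  then have d: "j0 e \<le> k - j0 (x - e)" "f e + of_int (k - j0 (x - e)) < 0" "af e (k - j0 (x - e)) \<in> B"
    using dec[OF xe e(1)] by simp_all
  \<comment> \<open>The level at which \<open>dec\<close> puts a lift of \<open>e\<close> into
    \<open>B\<close>. Removing it from \<open>af w j\<close> leaves a lift of \<open>w - e\<close>
    in \<open>C\<close>; by \<open>orth\<close> its finite part would be orthogonal to
    \<open>x\<close>, but it is not.\<close>
  define i where "i = k - j0 (x - e)"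
  have "f w = f (w - e) + f e" by (simp add: f_diff)
  then have "of_int i < real_of_int j" using fd d(2) fwj unfolding i_def by linarith
  then have "1 \<le> j - i" by linarith
  then have F: "af (w - e) (j - i) \<in> F" using we j0_range[OF we] by (auto simp: af_in_F)
  have s: "af (w - e) (j - i) + af e i = af w j" by (simp add: af_add)
  have eB: "af e i \<in> B" using d(3) by (simp add: i_def)
  have dZ: "af (w - e) (j - i) \<in> Z"
    using ideal_add[OF Z F, of "af e i"] s w(2) eB BC(1) ideal_subset[OF Z] by auto
  have "af (w - e) (j - i) \<notin> B"
    using closed_in_set_addD[OF cl(1) _ eB, of "af (w - e) (j - i)"] s w(2) BC by auto
  then have "af (w - e) (j - i) \<in> C" using dZ BC(1) by blast
  then have "(w - e) \<bullet> x = 0" using orth[OF we] fd by blast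
  then show False using ex wx by (simp add: inner_diff_left)
qed

text \<open>The induction hypothesis for the smaller ideal is exactly the condition under which
  \<open>ideal_weakly_separable\<close> separates the two sides, and that separation is the input of
  \<open>\<delta>_not_in_both_high\<close>.\<close>

theorem \<delta>_not_in_both:
  "ideal Z \<Longrightarrow> closed_in_set Z B \<Longrightarrow> closed_in_set Z C \<Longrightarrow> B \<union> C = Z \<Longrightarrow> B \<inter> C = {} \<Longrightarrow>
    \<delta> \<in> nonneg_span B \<Longrightarrow> \<delta> \<in> nonneg_span C \<Longrightarrow> False"
proof (induction "card Z" arbitrary: Z B C rule: less_induct)
  case less
  note Z = less.prems(1) and cl = less.prems(2,3) and BC = less.prems(4,5) and \<delta> = less.prems(6,7)
  have finZ: "finite Z" using ideal_finite[OF Z] .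
  have "Z \<noteq> {}"
  proof
    assume "Z = {}"
    then have "\<delta> \<in> nonneg_span {}" using \<delta>(1) BC(1) by simp
    then show False using \<delta>_nz unfolding nonneg_span_def by auto
  qed
  then have "Max (ht ` Z) \<in> ht ` Z" using finZ by (intro Max_in) auto
  then obtain \<gamma> where \<gamma>: "\<gamma> \<in> Z" "Max (ht ` Z) = ht \<gamma>" by auto
  have max: "ht z \<le> ht \<gamma>" if "z \<in> Z" for z using that finZ \<gamma>(2) by (metis Max_ge finite_imageI imageI)
  obtain x k where x: "x \<in> \<Psi>" "j0 x \<le> k" "\<gamma> = af x k" using ideal_mem_cases[OF Z \<gamma>(1)] .
  show False
  proof (cases "j0 x = k")
    case True
    have "\<exists>p\<in>\<Psi>. z = low p" if "z \<in> Z" for z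
    proof -
      obtain p l where p: "p \<in> \<Psi>" "j0 p \<le> l" "z = af p l" using ideal_mem_cases[OF Z \<open>z \<in> Z\<close>] .
      have "ht \<gamma> < ht \<delta>" unfolding x(3) True[symmetric] using ht_low_less[OF x(1)] .
      then have "ht z < ht \<delta>" using max[OF that] by linarith
      have "l = j0 p"
      proof (rule ccontr)
        assume "l \<noteq> j0 p"
        then have "af p (l - 1) \<in> F" using p by (simp add: af_in_F)
        moreover have "z = af p (l - 1) + \<delta>" unfolding p(3) by (simp add: af_def algebra_simps)
        ultimately have "ht \<delta> < ht z" using ht_pos by (simp add: linear_add[OF lin_ht])
        then show False using \<open>ht z < ht \<delta>\<close> by simp
      qed
      then show ?thesis using p by blast
    qed
    then show False using \<delta>_not_in_both_low[OF Z cl BC _ \<delta>] by blast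
  next
    case False
    have k: "j0 x < k" using x(2) False by simp
    have max': "ht z \<le> ht (af x k)" if "z \<in> Z" for z using max[OF that] x(3) by simp
    define Z0 where "Z0 = Z - {\<gamma>}"
    have Z0: "ideal Z0"
      unfolding ideal_def
    proof (intro conjI ballI allI impI)
      show "finite Z0" "Z0 \<subseteq> F" using finZ ideal_subset[OF Z] by (auto simp: Z0_def)
    next
      fix \<rho> \<sigma> assume F: "\<rho> \<in> F" "\<sigma> \<in> F" and "\<rho> + \<sigma> \<in> Z0"
      then have z: "\<rho> + \<sigma> \<in> Z" by (simp add: Z0_def)
      have "\<rho> \<noteq> \<gamma>" using max[OF z] ht_pos[OF F(2)] by (auto simp: linear_add[OF lin_ht])
      then show "\<rho> \<in> Z0" using ideal_add[OF Z F z] by (simp add: Z0_def)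
    next
      fix p l assume p: "p \<in> \<Psi>" and "af p l \<in> Z0 \<and> j0 p < l"
      then have "low (- p) \<in> Z" using ideal_neg[OF Z p] by (auto simp: Z0_def)
      \<comment> \<open>Here it matters that \<gamma> is not a lowest lift; removing one could
        violate this clause of \<open>ideal\<close>.\<close>
      moreover have "low (- p) \<noteq> \<gamma>" unfolding x(3) using k x(1) neg_root[OF p] by (auto simp: af_eq_iff)
      ultimately show "low (- p) \<in> Z0" by (simp add: Z0_def)
    next
      fix p l m assume p: "p \<in> \<Psi>" and "af p l \<in> Z0 \<and> j0 p \<le> m \<and> m \<le> l"
      then have l: "af p l \<in> Z" "af p l \<noteq> \<gamma>" "j0 p \<le> m" "m \<le> l" by (auto simp: Z0_def)
      have "af p m \<noteq> \<gamma>"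
      proof
        assume eq: "af p m = \<gamma>"
        then have "m < l" using l by (cases "m = l") auto
        then have "of_int m * ht \<delta> < of_int l * ht \<delta>" using ht_\<delta> by (intro mult_strict_right_mono) auto
        then show False using max[OF l(1)] eq[symmetric] by (simp add: ht_af)
      qed
      then show "af p m \<in> Z0" using ideal_string[OF Z p l(1,3,4)] by (simp add: Z0_def)
    qed
    have card: "card Z0 < card Z" unfolding Z0_def using finZ \<gamma>(1) by (rule card_Diff1_less)
    have main: False if b: "\<gamma> \<in> B'" and cl': "closed_in_set Z B'" "closed_in_set Z C'"
      and BC': "B' \<union> C' = Z" "B' \<inter> C' = {}" and \<delta>': "\<delta> \<in> nonneg_span B'" "\<delta> \<in> nonneg_span C'" for B' C'
    proof -
      define B0 where "B0 = B' - {\<gamma>}"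
      have BC0: "B0 \<union> C' = Z0" "B0 \<inter> C' = {}" using b BC' by (auto simp: B0_def Z0_def)
      have cl0: "closed_in_set Z0 B0" "closed_in_set Z0 C'"
        using cl' unfolding closed_in_set_def B0_def Z0_def by blast+
      have "\<delta> \<notin> nonneg_span B0 \<or> \<delta> \<notin> nonneg_span C'"
        using less.hyps[OF card Z0 cl0 BC0] by blast
      then have sep: "nonneg_span B0 \<inter> nonneg_span C' = {0}"
        by (rule ideal_weakly_separable[OF Z0 cl0 BC0])
      have fin0: "finite B0" "finite C'" using finZ BC' by (auto simp: B0_def)
      have "0 < ht z" if "z \<in> B0 \<union> C'" for z
        using that BC0 ht_pos ideal_subset[OF Z0] by blast
      then obtain w where w: "\<forall>b\<in>B0. w \<bullet> b < 0" "\<forall>c\<in>C'. 0 < w \<bullet> c"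
        using separating_vector[OF fin0 sep lin_ht] by blast
      \<comment> \<open>Since \<delta> is a nonzero element of the cone of \<open>C'\<close>, where
        \<open>w\<close> is positive, \<open>w \<bullet> \<delta>\<close> is positive and the
        functional can be scaled to be 1 at \<delta>.\<close>
      obtain c where c: "\<forall>v. 0 \<le> c v" "\<delta> = (\<Sum>v\<in>C'. c v *\<^sub>R v)"
        using nonneg_span_finite[OF fin0(2) \<delta>'(2)] by blast
      have "\<exists>v\<in>C'. c v \<noteq> 0"
      proof (rule ccontr)
        assume "\<not> ?thesis"
        then have "(\<Sum>v\<in>C'. c v *\<^sub>R v) = 0" by (intro sum.neutral) simp
        then show False using c(2) \<delta>_nz by simp
      qed
      then obtain v where v: "v \<in> C'" "0 < c v" using c(1) by (metis order_le_less)
      have "0 < (\<Sum>v\<in>C'. c v * (w \<bullet> v))"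
      proof (rule sum_pos2[OF fin0(2) v(1)])
        show "0 < c v * (w \<bullet> v)" using v w(2) by simp
        show "0 \<le> c u * (w \<bullet> u)" if "u \<in> C'" for u using that c(1) w(2) by (simp add: less_imp_le)
      qed
      also have "(\<Sum>v\<in>C'. c v * (w \<bullet> v)) = w \<bullet> \<delta>"
        using arg_cong[OF c(2), of "\<lambda>u. w \<bullet> u"] by (simp add: inner_sum_right)
      finally have w\<delta>: "0 < w \<bullet> \<delta>" .
      define f where "f v = (w \<bullet> v) / (w \<bullet> \<delta>)" for v
      have "linear f"
        unfolding f_def by (rule linearI) (simp_all add: inner_add_right add_divide_distrib)
      moreover have "f \<delta> = 1" using w\<delta> by (simp add: f_def)
      moreover have "f b < 0" if "b \<in> B'" "b \<noteq> af x k" for b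
        using w(1) that w\<delta> x(3) by (simp add: f_def B0_def divide_neg_pos)
      moreover have "0 < f c" if "c \<in> C'" for c using w(2) that w\<delta> by (simp add: f_def)
      ultimately show False
        using \<delta>_not_in_both_high[OF Z cl' BC' x(1) k _ max' _ _ _ _ \<delta>', of f] b x(3) by blast
    qed
    show False
    proof (cases "\<gamma> \<in> B")
      case True
      then show False using main[OF _ cl BC \<delta>] by blast
    next
      case False
      then have "\<gamma> \<in> C" using \<gamma>(1) BC(1) by blast
      then show False using main[OF _ cl(2,1) _ _ \<delta>(2,1)] BC by blast
    qed
  qed
qed

corollary ideal_clean:
  assumes Z: "ideal Z" shows "clean Z"
  unfolding clean_def
proof (intro allI impI)
  fix B assume B: "B \<subseteq> Z" "biclosed_in_set Z B"
  then have cl: "closed_in_set Z B" "closed_in_set Z (Z - B)"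
    unfolding biclosed_in_set_def coclosed_in_set_def by blast+
  have BC: "B \<union> (Z - B) = Z" "B \<inter> (Z - B) = {}" using B(1) by auto
  show "weakly_separable Z B"
    unfolding weakly_separable_def
    by (rule ideal_weakly_separable[OF Z cl BC]) (use \<delta>_not_in_both[OF Z cl BC] in blast)
qed

end

section \<open>Suitable orderings and the finite case\<close>

lemma finite_init_seg [simp]: "finite (init_seg X g i)"
  unfolding init_seg_def by simp

lemma init_seg_subset: "is_ordering X g \<Longrightarrow> init_seg X g i \<subseteq> X"
  unfolding init_seg_def is_ordering_def bij_betw_def by blast

text \<open>Refinement of the root poset makes initial segments order ideals; this is how the
  ordering enters every proof of cleanness.\<close>

lemma init_seg_downward:
  assumes "is_ordering X g" "refines_root_poset \<Delta> X g" "z \<in> init_seg X g i" "y \<in> X" "root_le \<Delta> y z"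
  shows "y \<in> init_seg X g i"
proof -
  obtain b where b: "b < i" "b \<in> ord_index X" "z = g b" using assms(3) unfolding init_seg_def by blast
  obtain a where a: "a \<in> ord_index X" "y = g a"
    using assms(1,4) unfolding is_ordering_def bij_betw_def by blast
  have "a \<le> b" using assms(2,5) a b unfolding refines_root_poset_def by blast
  then show ?thesis using a b unfolding init_seg_def by simp
qed

lemma precedes:
  assumes "refines_root_poset \<Delta> X g" "i \<in> ord_index X" "j \<in> ord_index X" "root_le \<Delta> (g i) (g j)" "g i \<noteq> g j"
  shows "i < j"
proof -
  have "i \<le> j" using assms(1-4) unfolding refines_root_poset_def by blast
  moreover have "i \<noteq> j" using assms(5) by blast
  ultimately show ?thesis by simp
qed

lemma suitableI:
  assumes "is_ordering X g" "refines_root_poset \<Delta> X g"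
    and "\<And>Y \<alpha> \<beta> \<gamma>. two_dim_linear_subset X Y \<Longrightarrow> fundamental_vectors Y \<alpha> \<beta> \<Longrightarrow> \<gamma> \<in> Y - {\<alpha>, \<beta>} \<Longrightarrow>
      root_le \<Delta> \<alpha> \<gamma> \<and> root_le \<Delta> \<beta> \<gamma>"
    and "\<And>i \<alpha> \<beta> \<gamma>. {\<alpha>, \<beta>, \<gamma>} \<subseteq> init_seg X g i \<Longrightarrow>
      \<exists>F. full_subset X F \<and> {\<alpha>, \<beta>, \<gamma>} \<subseteq> F \<and> clean (F \<inter> init_seg X g i)"
  shows "suitable X g"
  unfolding suitable_def
proof (intro conjI allI impI ballI)
  show "is_ordering X g" by fact
next
  fix Y \<alpha> \<beta> i j
  assume Y: "two_dim_linear_subset X Y \<and> fundamental_vectors Y \<alpha> \<beta>"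
    and ij: "i \<in> ord_index X" "j \<in> ord_index X" and m: "g i \<in> {\<alpha>, \<beta>} \<and> g j \<in> Y - {\<alpha>, \<beta>}"
  have "root_le \<Delta> \<alpha> (g j) \<and> root_le \<Delta> \<beta> (g j)" using assms(3) Y m by blast
  then have "root_le \<Delta> (g i) (g j)" using m by blast
  then show "i < j" by (rule precedes[OF assms(2) ij]) (use m in auto)
next
  fix i \<alpha> \<beta> \<gamma> assume "\<alpha> \<in> init_seg X g i" "\<beta> \<in> init_seg X g i" "\<gamma> \<in> init_seg X g i"
  then show "\<exists>F. full_subset X F \<and> \<alpha> \<in> F \<and> \<beta> \<in> F \<and> \<gamma> \<in> F \<and> clean (F \<inter> init_seg X g i)"
    using assms(4)[of \<alpha> \<beta> \<gamma> i] by auto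
qed

text \<open>The functional is the sum of the coordinates in \<Delta>. Its integrality bounds the
  heights of positive roots below by 1, which lets induction on the height terminate.\<close>

lemma height_exists:
  fixes \<Delta> :: "'v::real_vector set"
  assumes \<Delta>: "finite \<Delta>" "independent \<Delta>"
  shows "\<exists>ht. linear ht \<and> (\<forall>v\<in>nonneg_span \<Delta>. v \<noteq> 0 \<longrightarrow> 0 < ht v) \<and>
    (\<forall>c::'v \<Rightarrow> int. ht (\<Sum>a\<in>\<Delta>. of_int (c a) *\<^sub>R a) \<in> (\<int>::real set))"
proof -
  obtain ht :: "'v \<Rightarrow> real" where ht: "linear ht" "\<forall>a\<in>\<Delta>. ht a = 1"
    using linear_independent_extend[OF \<Delta>(2), of "\<lambda>_. 1"] by blast
  have sum: "ht (\<Sum>a\<in>\<Delta>. c a *\<^sub>R a) = (\<Sum>a\<in>\<Delta>. c a)" for c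
    using ht(2) by (simp add: linear_sum[OF ht(1)] linear_scale[OF ht(1)])
  have "0 < ht v" if v: "v \<in> nonneg_span \<Delta>" "v \<noteq> 0" for v
  proof -
    obtain c where c: "\<forall>a. 0 \<le> c a" "v = (\<Sum>a\<in>\<Delta>. c a *\<^sub>R a)" using nonneg_span_finite[OF \<Delta>(1) v(1)] by blast
    have "\<exists>a\<in>\<Delta>. c a \<noteq> 0"
    proof (rule ccontr)
      assume "\<not> ?thesis"
      then have "(\<Sum>a\<in>\<Delta>. c a *\<^sub>R a) = 0" by (intro sum.neutral) simp
      then show False using c(2) v(2) by simp
    qed
    then obtain a where "a \<in> \<Delta>" "0 < c a" using c(1) by (metis order_le_less)
    then show ?thesis unfolding c(2) sum using c(1) by (intro sum_pos2[OF \<Delta>(1)]) auto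
  qed
  moreover have "ht (\<Sum>a\<in>\<Delta>. of_int (c a) *\<^sub>R a) \<in> \<int>" for c :: "'v \<Rightarrow> int"
    unfolding sum by (simp only: of_int_sum[symmetric] Ints_of_int)
  ultimately show ?thesis using ht(1) by blast
qed

lemma base_sign:
  assumes "is_base \<Phi> \<Delta>" "\<alpha> \<in> \<Phi>"
  shows "\<alpha> \<in> nonneg_span \<Delta> \<or> - \<alpha> \<in> nonneg_span \<Delta>"
proof -
  obtain c :: "'a \<Rightarrow> int" where c: "\<alpha> = (\<Sum>a\<in>\<Delta>. of_int (c a) *\<^sub>R a)"
    "(\<forall>a\<in>\<Delta>. 0 \<le> c a) \<or> (\<forall>a\<in>\<Delta>. c a \<le> 0)"
    using assms unfolding is_base_def by blast
  from c(2) show ?thesis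
  proof
    assume "\<forall>a\<in>\<Delta>. 0 \<le> c a"
    then have "\<alpha> \<in> nonneg_span \<Delta>" unfolding c(1)
      by (intro nonneg_span_sum nonneg_span_scale nonneg_span_base) simp_all
    then show ?thesis ..
  next
    assume neg: "\<forall>a\<in>\<Delta>. c a \<le> 0"
    have "- \<alpha> = (\<Sum>a\<in>\<Delta>. of_int (- c a) *\<^sub>R a)" unfolding c(1) by (simp add: sum_negf)
    also have "\<dots> \<in> nonneg_span \<Delta>"
      by (intro nonneg_span_sum nonneg_span_scale nonneg_span_base) (use neg in simp_all)
    finally show ?thesis ..
  qed
qed

text \<open>Since \<gamma> is a nonnegative combination of \<alpha> and \<beta> with positive norm,
  it has positive product with one of them, say \<open>a\<close>. Extremality of \<open>a\<close>
  leaves only \<gamma> = a + \<tau> with \<tau> in \<open>Y\<close>. Either \<tau> is the other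
  fundamental vector, or induction applies to \<tau>, which is not \<open>a\<close> by
  reducedness.\<close>

lemma fundamental_below:
  fixes \<pi> :: "'v::real_vector \<Rightarrow> 'w::real_inner" and ht :: "'v \<Rightarrow> real"
  assumes lin: "linear \<pi>" "linear ht" and nz: "\<And>y. y \<in> Y \<Longrightarrow> \<pi> y \<noteq> 0" and ht: "\<And>y. y \<in> Y \<Longrightarrow> 1 \<le> ht y"
    and step: "\<And>\<rho> \<sigma>. \<rho> \<in> Y \<Longrightarrow> \<sigma> \<in> Y \<Longrightarrow> \<rho> \<noteq> \<sigma> \<Longrightarrow> 0 < \<pi> \<rho> \<bullet> \<pi> \<sigma> \<Longrightarrow> \<exists>\<tau>\<in>Y. \<rho> = \<sigma> + \<tau> \<or> \<sigma> = \<rho> + \<tau>"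
    and red: "\<And>y. y \<in> Y \<Longrightarrow> 2 *\<^sub>R y \<notin> Y"
    and fv: "fundamental_vectors Y \<alpha> \<beta>" and \<gamma>: "\<gamma> \<in> Y" "\<gamma> \<notin> {\<alpha>, \<beta>}"
  shows "\<gamma> - \<alpha> \<in> nonneg_span Y \<and> \<gamma> - \<beta> \<in> nonneg_span Y"
proof -
  have nz0: "y \<noteq> 0" if "y \<in> Y" for y using nz[OF that] linear_0[OF lin(1)] by auto
  \<comment> \<open>Every vector of \<open>Y\<close> has height at least 1, so removing one lowers
    the bound \<open>n\<close> by one.\<close>
  have "ht \<gamma> < real n \<Longrightarrow> ?thesis" for n
    using \<gamma>
  proof (induction n arbitrary: \<gamma>)
    case 0
    then show ?case using ht[of \<gamma>] by simp
  next
    case (Suc n)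
    have half: "\<gamma> - a \<in> nonneg_span Y \<and> \<gamma> - b \<in> nonneg_span Y"
      if ab: "{a, b} = {\<alpha>, \<beta>}" and fab: "fundamental_vectors Y a b" and pos: "0 < \<pi> \<gamma> \<bullet> \<pi> a" for a b
    proof -
      have Y: "a \<in> Y" "b \<in> Y" "a \<notin> nonneg_span (Y - {a})" using fab unfolding fundamental_vectors_def by auto
      have ne: "\<gamma> \<noteq> a" "\<gamma> \<noteq> b" using Suc.prems(3) ab by auto
      obtain \<tau> where \<tau>: "\<tau> \<in> Y" "\<gamma> = a + \<tau> \<or> a = \<gamma> + \<tau>" using step[OF Suc.prems(2) Y(1) ne(1) pos] by blast
      have "a \<noteq> \<gamma> + \<tau>"
      proof
        assume a: "a = \<gamma> + \<tau>"
        then have "\<tau> \<noteq> a" using nz0[OF Suc.prems(2)] by auto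
        then have "\<gamma> + \<tau> \<in> nonneg_span (Y - {a})"
          using Suc.prems(2) \<tau>(1) ne(1) by (intro nonneg_span_add nonneg_span_base) auto
        then show False using Y(3) a by simp
      qed
      then have g: "\<gamma> = a + \<tau>" using \<tau>(2) by blast
      have "\<gamma> - b \<in> nonneg_span Y"
      proof (cases "\<tau> = b")
        case True
        then show ?thesis using g Y(1) by (simp add: nonneg_span_base)
      next
        case False
        have "\<tau> \<noteq> a" using red[OF Y(1)] g Suc.prems(2) by (auto simp: scaleR_2)
        then have "\<tau> \<notin> {\<alpha>, \<beta>}" using False ab by blast
        moreover have "ht \<tau> < real n"
          using Suc.prems(1) ht[OF Y(1)] unfolding g by (simp add: linear_add[OF lin(2)])
        ultimately have "\<tau> - \<alpha> \<in> nonneg_span Y \<and> \<tau> - \<beta> \<in> nonneg_span Y" using Suc.IH[OF _ \<tau>(1)] by simp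
        moreover have "b \<in> {\<alpha>, \<beta>}" using ab by blast
        ultimately have "\<tau> - b \<in> nonneg_span Y" by auto
        then have "a + (\<tau> - b) \<in> nonneg_span Y" using Y(1) by (simp add: nonneg_span_add nonneg_span_base)
        then show ?thesis unfolding g by (simp add: algebra_simps)
      qed
      moreover have "\<gamma> - a \<in> nonneg_span Y" using g \<tau>(1) by (simp add: nonneg_span_base)
      ultimately show ?thesis by blast
    qed
    have fv': "fundamental_vectors Y \<beta> \<alpha>" using fv unfolding fundamental_vectors_def by (auto simp: insert_commute)
    have "\<gamma> \<in> nonneg_span {\<alpha>, \<beta>}" using fv Suc.prems(2) unfolding fundamental_vectors_def by blast
    then obtain c d where cd: "0 \<le> c" "0 \<le> d" "\<gamma> = c *\<^sub>R \<alpha> + d *\<^sub>R \<beta>" by (rule nonneg_span_pairE)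
    have "0 < \<pi> \<gamma> \<bullet> \<pi> \<gamma>" using nz[OF Suc.prems(2)] by simp
    also have "\<pi> \<gamma> \<bullet> \<pi> \<gamma> = \<pi> \<gamma> \<bullet> \<pi> (c *\<^sub>R \<alpha> + d *\<^sub>R \<beta>)" using cd(3) by simp
    also have "\<dots> = c * (\<pi> \<gamma> \<bullet> \<pi> \<alpha>) + d * (\<pi> \<gamma> \<bullet> \<pi> \<beta>)"
      by (simp add: linear_add[OF lin(1)] linear_scale[OF lin(1)] inner_add_right)
    finally have "0 < \<pi> \<gamma> \<bullet> \<pi> \<alpha> \<or> 0 < \<pi> \<gamma> \<bullet> \<pi> \<beta>"
      using cd(1,2) by (smt (verit) mult_nonneg_nonpos)
    then show ?case
    proof
      assume "0 < \<pi> \<gamma> \<bullet> \<pi> \<alpha>"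
      then show ?case using half[OF refl fv] by simp
    next
      assume "0 < \<pi> \<gamma> \<bullet> \<pi> \<beta>"
      then show ?case using half[OF insert_commute fv'] by simp
    qed
  qed
  then show ?thesis using reals_Archimedean2[of "ht \<gamma>"] by blast
qed

lemma full_subset_section:
  assumes "subspace L" shows "full_subset X (X \<inter> L)"
  unfolding full_subset_def
proof (intro conjI ballI)
  fix \<alpha> \<beta> assume "\<alpha> \<in> X \<inter> L" "\<beta> \<in> X \<inter> L"
  then have "span {\<alpha>, \<beta>} \<subseteq> L" using assms by (intro span_minimal) auto
  then show "X \<inter> L \<inter> span {\<alpha>, \<beta>} = X \<inter> span {\<alpha>, \<beta>}" by blast
qed blast

text \<open>As \<eta> is independent of \<open>Z\<close>, its coefficient in a common vector of both
  cones is determined. Since \<eta> belongs to one side only, the coefficient is 0 and the vector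
  already lies in both cones over \<open>Z\<close>.\<close>

lemma clean_insert:
  assumes cl: "clean Z" and \<eta>: "\<eta> \<notin> span Z" and fin: "finite Z"
  shows "clean (insert \<eta> Z)"
  unfolding clean_def
proof (intro allI impI)
  fix B assume B: "B \<subseteq> insert \<eta> Z" "biclosed_in_set (insert \<eta> Z) B"
  define B0 where "B0 = B - {\<eta>}"
  define C0 where "C0 = (insert \<eta> Z - B) - {\<eta>}"
  have \<eta>Z: "\<eta> \<notin> Z" using \<eta> span_base by blast
  have C0: "C0 = Z - B0" unfolding C0_def B0_def using \<eta>Z by blast
  have B0: "B0 \<subseteq> Z" using B(1) by (auto simp: B0_def)
  have "closed_in_set (insert \<eta> Z) B" "closed_in_set (insert \<eta> Z) (insert \<eta> Z - B)"
    using B(2) unfolding biclosed_in_set_def coclosed_in_set_def by blast+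
  then have "closed_in_set Z B0" "closed_in_set Z C0"
    unfolding closed_in_set_def B0_def C0_def using \<eta>Z by blast+
  then have "biclosed_in_set Z B0" unfolding biclosed_in_set_def coclosed_in_set_def C0 by blast
  then have sep: "nonneg_span B0 \<inter> nonneg_span C0 = {0}"
    using cl B0 unfolding clean_def weakly_separable_def C0 by blast
  have finB: "finite B" "finite (insert \<eta> Z - B)" using fin B(1) by (auto intro: finite_subset)
  have split: "\<exists>t\<ge>0. \<exists>u\<in>nonneg_span (S - {\<eta>}). v = t *\<^sub>R \<eta> + u \<and> (\<eta> \<notin> S \<longrightarrow> t = 0)"
    if S: "finite S" "v \<in> nonneg_span S" for S v
  proof (cases "\<eta> \<in> S")
    case True
    obtain c where c: "\<forall>a. 0 \<le> c a" "v = (\<Sum>a\<in>S. c a *\<^sub>R a)" using nonneg_span_finite[OF S] by blast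
    have "v = c \<eta> *\<^sub>R \<eta> + (\<Sum>a\<in>S - {\<eta>}. c a *\<^sub>R a)" unfolding c(2) by (rule sum.remove[OF S(1) True])
    moreover have "(\<Sum>a\<in>S - {\<eta>}. c a *\<^sub>R a) \<in> nonneg_span (S - {\<eta>})"
      using c(1) by (intro nonneg_span_sum nonneg_span_scale nonneg_span_base) simp_all
    ultimately show ?thesis using c(1) True by blast
  next
    case False
    then show ?thesis using S(2) by (intro exI[of _ 0] conjI bexI[of _ v]) simp_all
  qed
  show "weakly_separable (insert \<eta> Z) B"
    unfolding weakly_separable_def
  proof (intro equalityI subsetI)
    fix v assume v: "v \<in> nonneg_span B \<inter> nonneg_span (insert \<eta> Z - B)"
    obtain t u where t: "u \<in> nonneg_span B0" "v = t *\<^sub>R \<eta> + u" "\<eta> \<notin> B \<longrightarrow> t = 0"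
      using split[OF finB(1)] v unfolding B0_def by blast
    obtain s w where s: "w \<in> nonneg_span C0" "v = s *\<^sub>R \<eta> + w" "\<eta> \<notin> insert \<eta> Z - B \<longrightarrow> s = 0"
      using split[OF finB(2)] v unfolding C0_def by blast
    have uw: "u \<in> span Z" "w \<in> span Z"
      using t(1) s(1) nonneg_span_subset_span span_mono[OF B0] span_mono[of C0 Z] C0 by blast+
    have e: "(t - s) *\<^sub>R \<eta> = w - u" using t(2) s(2) by (simp add: algebra_simps)
    have "t = s"
    proof (rule ccontr)
      assume "t \<noteq> s"
      then have "\<eta> = (1 / (t - s)) *\<^sub>R (w - u)" unfolding e[symmetric] by simp
      then show False using \<eta> uw by (metis span_diff span_scale)
    qed
    moreover have "t = 0 \<or> s = 0" using t(3) s(3) by blast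
    ultimately have "v = u" "v = w" using t(2) s(2) by auto
    then show "v \<in> {0}" using t(1) s(1) sep by blast
  qed simp
qed

theorem finite_suitable:
  fixes \<Phi> \<Delta> :: "'v::real_inner set"
  assumes rs: "finite_root_system \<Phi>" and base: "is_base \<Phi> \<Delta>"
    and ord: "is_ordering (pos_roots \<Phi> \<Delta>) g" and refines: "refines_root_poset \<Delta> (pos_roots \<Phi> \<Delta>) g"
  shows "suitable (pos_roots \<Phi> \<Delta>) g"
proof -
  define X where "X = pos_roots \<Phi> \<Delta>"
  have ordX: "is_ordering X g" "refines_root_poset \<Delta> X g" using ord refines by (simp_all add: X_def)
  have \<Delta>: "finite \<Delta>" "independent \<Delta>"
    using rs base finite_subset[of \<Delta> \<Phi>] by (simp_all add: finite_root_system_def is_base_def)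
  obtain ht :: "'v \<Rightarrow> real" where ht: "linear ht" "\<forall>v\<in>nonneg_span \<Delta>. v \<noteq> 0 \<longrightarrow> 0 < ht v"
    "\<forall>c::'v \<Rightarrow> int. ht (\<Sum>a\<in>\<Delta>. of_int (c a) *\<^sub>R a) \<in> \<int>"
    using height_exists[OF \<Delta>] by blast
  have nz: "\<alpha> \<noteq> 0" if "\<alpha> \<in> \<Phi>" for \<alpha> using rs that unfolding finite_root_system_def by auto
  have X: "\<alpha> \<in> X \<longleftrightarrow> \<alpha> \<in> \<Phi> \<and> \<alpha> \<in> nonneg_span \<Delta>" for \<alpha> by (simp add: X_def pos_roots_def)
  have htpos: "0 < ht \<alpha>" if "\<alpha> \<in> X" for \<alpha> using ht(2) that nz X by blast
  have int: "\<exists>c::'v \<Rightarrow> int. \<alpha> = (\<Sum>a\<in>\<Delta>. of_int (c a) *\<^sub>R a)" if "\<alpha> \<in> X" for \<alpha>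
    using base that X unfolding is_base_def by blast
  have ht1: "1 \<le> ht \<alpha>" if \<alpha>: "\<alpha> \<in> X" for \<alpha>
  proof -
    have "ht \<alpha> \<in> \<int>" using int[OF \<alpha>] ht(3) by auto
    then obtain m :: int where "ht \<alpha> = of_int m" by (auto elim: Ints_cases)
    then show ?thesis using htpos[OF \<alpha>] by simp
  qed
  have diff: "\<exists>\<tau>\<in>X. (\<alpha> = \<beta> + \<tau> \<or> \<beta> = \<alpha> + \<tau>) \<and> (\<tau> = \<alpha> - \<beta> \<or> \<tau> = \<beta> - \<alpha>)"
    if ab: "\<alpha> \<in> X" "\<beta> \<in> X" "\<alpha> \<noteq> \<beta>" "0 < \<alpha> \<bullet> \<beta>" for \<alpha> \<beta>
  proof -
    have d: "\<alpha> - \<beta> \<in> \<Phi>" using root_diff[OF rs _ _ ab(4,3)] ab X by blast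
    then have d': "\<beta> - \<alpha> \<in> \<Phi>" using neg_mem_root_system[OF rs d] by simp
    from base_sign[OF base d] show ?thesis
    proof
      assume "\<alpha> - \<beta> \<in> nonneg_span \<Delta>"
      then have "\<alpha> - \<beta> \<in> X" using d X by blast
      then show ?thesis by (intro bexI[of _ "\<alpha> - \<beta>"]) simp_all
    next
      assume "- (\<alpha> - \<beta>) \<in> nonneg_span \<Delta>"
      then have "\<beta> - \<alpha> \<in> X" using d' X by simp
      then show ?thesis by (intro bexI[of _ "\<beta> - \<alpha>"]) simp_all
    qed
  qed
  have id: "linear (\<lambda>v::'v. v)" using linear_id by (simp add: id_def)
  show ?thesis
    unfolding X_def[symmetric]
  proof (rule suitableI[OF ordX])
    fix Y \<alpha> \<beta> \<gamma>
    assume Y: "two_dim_linear_subset X Y" and fv: "fundamental_vectors Y \<alpha> \<beta>" and \<gamma>: "\<gamma> \<in> Y - {\<alpha>, \<beta>}"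
    obtain L where L: "subspace L" "Y = X \<inter> L"
      using Y unfolding two_dim_linear_subset_def linear_subset_def by blast
    have "\<gamma> - \<alpha> \<in> nonneg_span Y \<and> \<gamma> - \<beta> \<in> nonneg_span Y"
    proof (rule fundamental_below[OF id ht(1) _ _ _ _ fv])
      show "\<gamma> \<in> Y" "\<gamma> \<notin> {\<alpha>, \<beta>}" using \<gamma> by auto
      show "y \<noteq> 0" "1 \<le> ht y" if "y \<in> Y" for y using that L nz X ht1 by auto
      show "2 *\<^sub>R y \<notin> Y" if "y \<in> Y" for y
        using root_eq_if_dependent[OF rs, of y 2] that L X by auto
      show "\<exists>\<tau>\<in>Y. \<rho> = \<sigma> + \<tau> \<or> \<sigma> = \<rho> + \<tau>" if rs: "\<rho> \<in> Y" "\<sigma> \<in> Y" "\<rho> \<noteq> \<sigma>" "0 < \<rho> \<bullet> \<sigma>" for \<rho> \<sigma>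
      proof -
        have "\<rho> \<in> X" "\<sigma> \<in> X" "\<rho> \<in> L" "\<sigma> \<in> L" using rs L(2) by auto
        then obtain \<tau> where \<tau>: "\<tau> \<in> X" "\<rho> = \<sigma> + \<tau> \<or> \<sigma> = \<rho> + \<tau>" "\<tau> = \<rho> - \<sigma> \<or> \<tau> = \<sigma> - \<rho>"
          using diff[of \<rho> \<sigma>] rs(3,4) by blast
        have "\<tau> \<in> L" using \<tau>(3) \<open>\<rho> \<in> L\<close> \<open>\<sigma> \<in> L\<close> subspace_diff[OF L(1)] by auto
        then show ?thesis using \<tau>(1,2) L(2) by blast
      qed
    qed
    moreover have "nonneg_span Y \<subseteq> nonneg_span \<Delta>" using L(2) X by (intro nonneg_span_minimal) blast
    ultimately show "root_le \<Delta> \<alpha> \<gamma> \<and> root_le \<Delta> \<beta> \<gamma>" unfolding root_le_def by blast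
  next
    fix i \<alpha> \<beta> \<gamma> assume m: "{\<alpha>, \<beta>, \<gamma>} \<subseteq> init_seg X g i"
    define Z where "Z = init_seg X g i"
    have ZX: "Z \<subseteq> X" unfolding Z_def using init_seg_subset[OF ordX(1)] .
    have "clean Z"
      unfolding clean_def
    proof (intro allI impI)
      fix B assume B: "B \<subseteq> Z" "biclosed_in_set Z B"
      then have cl: "closed_in_set Z B" "closed_in_set Z (Z - B)"
        unfolding biclosed_in_set_def coclosed_in_set_def by blast+
      have BC: "B \<union> (Z - B) = Z" "B \<inter> (Z - B) = {}" using B(1) by auto
      have finZ: "finite Z" by (simp add: Z_def)
      show "weakly_separable Z B"
        unfolding weakly_separable_def
      \<comment> \<open>With \<delta> = 0 and the identity as projection the string alternative is
        void, and the kernel condition is definiteness of the inner product.\<close>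
      proof (rule nonneg_span_Int_eq_0[where \<delta> = 0 and Z = Z, OF finZ \<Delta> _ cl BC id ht(1)])
        show "\<exists>c::'v \<Rightarrow> int. z = (\<Sum>a\<in>\<Delta>. of_int (c a) *\<^sub>R a)" "0 < ht z" if "z \<in> Z" for z
          using that ZX int htpos by blast+
        show "v \<in> span {0}" if "v \<in> span Z" "v = 0" for v using that span_zero by simp
        fix \<beta> \<gamma> assume bg: "\<beta> \<in> Z" "\<gamma> \<in> Z" "\<beta> \<noteq> \<gamma>" "0 < \<beta> \<bullet> \<gamma>"
        obtain \<tau> where \<tau>: "\<tau> \<in> X" "\<beta> = \<gamma> + \<tau> \<or> \<gamma> = \<beta> + \<tau>" using diff[of \<beta> \<gamma>] bg ZX by auto
        have "root_le \<Delta> \<tau> \<beta> \<or> root_le \<Delta> \<tau> \<gamma>" using \<tau>(2) bg(1,2) ZX X by (auto simp: root_le_def)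
        then have "\<tau> \<in> Z" using init_seg_downward[OF ordX _ \<tau>(1)] bg(1,2) unfolding Z_def by blast
        then show "(\<exists>\<rho>\<in>Z. \<beta> = \<gamma> + \<rho> \<or> \<gamma> = \<beta> + \<rho>) \<or> (0::'v) \<noteq> 0 \<and> (\<exists>k::nat. \<exists>m>0. \<exists>\<epsilon>\<in>Z. 0 < k \<and>
          (\<beta> = \<gamma> + real k *\<^sub>R 0 \<and> \<gamma> + \<epsilon> = m *\<^sub>R 0 \<or> \<gamma> = \<beta> + real k *\<^sub>R 0 \<and> \<beta> + \<epsilon> = m *\<^sub>R 0))"
          using \<tau>(2) by blast
      qed simp_all
    qed
    moreover have "full_subset X X" unfolding full_subset_def by simp
    moreover have "X \<inter> init_seg X g i = Z" using ZX by (auto simp: Z_def)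
    ultimately show "\<exists>F. full_subset X F \<and> {\<alpha>, \<beta>, \<gamma>} \<subseteq> F \<and> clean (F \<inter> init_seg X g i)"
      using m ZX unfolding Z_def by (intro exI[of _ X]) auto
  qed
qed

section \<open>The untwisted affine case\<close>

locale untwisted_affine =
  fixes \<Phi>0 \<Delta>0 :: "'v::real_inner set" and \<delta> \<theta> :: 'v
  assumes rs0: "finite_root_system \<Phi>0" and base0: "is_base \<Phi>0 \<Delta>0"
    and highest: "highest_root \<Phi>0 \<Delta>0 \<theta>" and \<delta>_span: "\<delta> \<notin> span \<Phi>0"
begin

definition \<Delta>a :: "'v set" where "\<Delta>a = \<Delta>0 \<union> {\<delta> - \<theta>}"

definition X :: "'v set" where "X = pos_roots (affinization \<Phi>0 \<delta>) \<Delta>a"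

definition offset :: "'v \<Rightarrow> int" where "offset p = (if p \<in> nonneg_span \<Delta>0 then 0 else 1)"

text \<open>The affine form is the inner product of \<open>proj\<close> images. An orthogonal
  projection would not serve, since \<delta> is only assumed to lie outside the span of
  \<open>\<Phi>0\<close> and may be skew to it.\<close>

definition proj :: "'v \<Rightarrow> 'v" where
  "proj = (SOME h. linear h \<and> h \<delta> = 0 \<and> (\<forall>v\<in>span \<Phi>0. h v = v))"

definition height :: "'v \<Rightarrow> real" where
  "height = (SOME ht. linear ht \<and> (\<forall>v\<in>nonneg_span \<Delta>a. v \<noteq> 0 \<longrightarrow> 0 < ht v) \<and>
    (\<forall>c::'v \<Rightarrow> int. ht (\<Sum>a\<in>\<Delta>a. of_int (c a) *\<^sub>R a) \<in> \<int>))"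

lemma \<theta>_root: "\<theta> \<in> \<Phi>0" using highest unfolding highest_root_def by blast

lemma below_\<theta>: "p \<in> \<Phi>0 \<Longrightarrow> \<theta> - p \<in> nonneg_span \<Delta>0"
  using highest unfolding highest_root_def root_le_def by blast

lemma \<Delta>0: "finite \<Delta>0" "independent \<Delta>0" "\<Delta>0 \<subseteq> \<Phi>0"
  using rs0 base0 finite_subset[of \<Delta>0 \<Phi>0] by (simp_all add: finite_root_system_def is_base_def)

lemma simple_not_in_\<Delta>0: "\<delta> - \<theta> \<notin> span \<Delta>0"
proof
  assume "\<delta> - \<theta> \<in> span \<Delta>0"
  then have "\<delta> - \<theta> \<in> span \<Phi>0" using span_mono[OF \<Delta>0(3)] by blast
  then have "(\<delta> - \<theta>) + \<theta> \<in> span \<Phi>0" using \<theta>_root by (intro span_add) (auto intro: span_base)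
  then show False using \<delta>_span by simp
qed

lemma \<Delta>a: "finite \<Delta>a" "independent \<Delta>a"
  using \<Delta>0 simple_not_in_\<Delta>0 independent_insertI[of "\<delta> - \<theta>" \<Delta>0] by (simp_all add: \<Delta>a_def)

lemma cone_mono: "nonneg_span \<Delta>0 \<subseteq> nonneg_span \<Delta>a"
  by (rule nonneg_span_mono) (auto simp: \<Delta>a_def)

lemma \<theta>_nonneg: "\<theta> \<in> nonneg_span \<Delta>0"
proof -
  have "\<theta> - (- \<theta>) \<in> nonneg_span \<Delta>0" by (rule below_\<theta>[OF neg_mem_root_system[OF rs0 \<theta>_root]])
  then have "(1/2) *\<^sub>R (\<theta> - (- \<theta>)) \<in> nonneg_span \<Delta>0" by (rule nonneg_span_scale) simp
  moreover have "(1/2) *\<^sub>R (\<theta> - (- \<theta>)) = \<theta>" by (simp flip: scaleR_2)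
  ultimately show ?thesis by simp
qed

lemma simple_nonneg: "\<delta> - \<theta> \<in> nonneg_span \<Delta>a"
  by (rule nonneg_span_base) (simp add: \<Delta>a_def)

lemma \<delta>_nonneg: "\<delta> \<in> nonneg_span \<Delta>a"
proof -
  have "(\<delta> - \<theta>) + \<theta> \<in> nonneg_span \<Delta>a"
    using simple_nonneg \<theta>_nonneg cone_mono by (intro nonneg_span_add) auto
  then show ?thesis by simp
qed

text \<open>A negative finite root \<open>p\<close> becomes positive after one \<delta>, because
  \<delta> + p = (\<delta> - \<theta>) + (\<theta> + p) and \<open>- p\<close> lies below the
  highest root.\<close>

lemma offset_nonneg:
  assumes p: "p \<in> \<Phi>0" and k: "offset p \<le> k"
  shows "p + of_int k *\<^sub>R \<delta> \<in> nonneg_span \<Delta>a"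
proof (cases "p \<in> nonneg_span \<Delta>0")
  case True
  then show ?thesis using k cone_mono \<delta>_nonneg
    by (intro nonneg_span_add nonneg_span_scale) (auto simp: offset_def)
next
  case False
  have "\<theta> - (- p) \<in> nonneg_span \<Delta>a" using below_\<theta>[OF neg_mem_root_system[OF rs0 p]] cone_mono by blast
  then have "(\<delta> - \<theta>) + (\<theta> - (- p)) + of_int (k - 1) *\<^sub>R \<delta> \<in> nonneg_span \<Delta>a"
    using k False simple_nonneg \<delta>_nonneg by (intro nonneg_span_add nonneg_span_scale) (auto simp: offset_def)
  moreover have "(\<delta> - \<theta>) + (\<theta> - (- p)) + of_int (k - 1) *\<^sub>R \<delta> = p + of_int k *\<^sub>R \<delta>"
    by (simp add: algebra_simps)
  ultimately show ?thesis by (simp only:)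
qed

lemma proj: "linear proj" "proj \<delta> = 0" "v \<in> span \<Phi>0 \<Longrightarrow> proj v = v"
proof -
  obtain B where B: "B \<subseteq> \<Phi>0" "independent B" "\<Phi>0 \<subseteq> span B"
    by (rule basis_exists)
  have sp: "span B = span \<Phi>0" using B span_superset unfolding span_eq by blast
  have "independent (insert \<delta> B)" using B(2) \<delta>_span sp by (intro independent_insertI) simp_all
  then obtain h where h: "linear h" "\<forall>x\<in>insert \<delta> B. h x = (if x = \<delta> then 0 else x)"
    using linear_independent_extend[of "insert \<delta> B" "\<lambda>x. if x = \<delta> then 0 else x"] by blast
  have "\<delta> \<notin> B" using \<delta>_span sp span_base by blast
  then have hB: "h b = id b" if "b \<in> B" for b using h(2) that by auto
  have "h v = id v" if "v \<in> span \<Phi>0" for v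
    by (rule linear_eq_on[OF h(1) linear_id _ hB]) (use that sp in simp_all)
  moreover have "h \<delta> = 0" using h(2) by simp
  ultimately have "\<exists>h. linear h \<and> h \<delta> = 0 \<and> (\<forall>v\<in>span \<Phi>0. h v = v)" using h(1) by auto
  then have *: "linear proj \<and> proj \<delta> = 0 \<and> (\<forall>v\<in>span \<Phi>0. proj v = v)" unfolding proj_def by (rule someI_ex)
  show "linear proj" "proj \<delta> = 0" "v \<in> span \<Phi>0 \<Longrightarrow> proj v = v" using * by blast+
qed

lemma height: "linear height" "v \<in> nonneg_span \<Delta>a \<Longrightarrow> v \<noteq> 0 \<Longrightarrow> 0 < height v"
  "height (\<Sum>a\<in>\<Delta>a. of_int (c a) *\<^sub>R a) \<in> \<int>"
proof -
  have *: "linear height \<and> (\<forall>v\<in>nonneg_span \<Delta>a. v \<noteq> 0 \<longrightarrow> 0 < height v) \<and>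
    (\<forall>c::'v \<Rightarrow> int. height (\<Sum>a\<in>\<Delta>a. of_int (c a) *\<^sub>R a) \<in> \<int>)"
    unfolding height_def by (rule someI_ex[OF height_exists[OF \<Delta>a]])
  then show "linear height" "v \<in> nonneg_span \<Delta>a \<Longrightarrow> v \<noteq> 0 \<Longrightarrow> 0 < height v"
    "height (\<Sum>a\<in>\<Delta>a. of_int (c a) *\<^sub>R a) \<in> \<int>"
    by blast+
qed

lemma \<delta>_ne: "\<delta> \<noteq> 0" using \<delta>_span span_zero by metis

lemma finite_root_ne: "p \<in> \<Phi>0 \<Longrightarrow> p \<noteq> 0"
  using rs0 unfolding finite_root_system_def by auto

lemma affine_root_ne:
  assumes "p \<in> \<Phi>0" shows "p + of_int k *\<^sub>R \<delta> \<noteq> 0"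
proof
  assume "p + of_int k *\<^sub>R \<delta> = 0"
  then have "proj (p + of_int k *\<^sub>R \<delta>) = 0" using linear_0[OF proj(1)] by simp
  moreover have "proj (p + of_int k *\<^sub>R \<delta>) = p"
    using assms by (simp add: linear_add[OF proj(1)] linear_scale[OF proj(1)] proj(2,3) span_base)
  ultimately show False using finite_root_ne[OF assms] by simp
qed

lemma offset_neg:
  assumes p: "p \<in> \<Phi>0" shows "offset (- p) = 1 - offset p"
proof -
  have "\<not> (p \<in> nonneg_span \<Delta>0 \<and> - p \<in> nonneg_span \<Delta>0)"
  proof
    assume "p \<in> nonneg_span \<Delta>0 \<and> - p \<in> nonneg_span \<Delta>0"
    then have "0 < height p" "0 < height (- p)"
      using height(2) cone_mono finite_root_ne[OF p] by auto
    then show False by (simp add: linear_neg[OF height(1)])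
  qed
  then show ?thesis using base_sign[OF base0 p] by (auto simp: offset_def)
qed

lemma affine_int:
  assumes p: "p \<in> \<Phi>0"
  shows "\<exists>c::'v \<Rightarrow> int. p + of_int k *\<^sub>R \<delta> = (\<Sum>a\<in>\<Delta>a. of_int (c a) *\<^sub>R a)"
proof -
  obtain c :: "'v \<Rightarrow> int" where c: "p = (\<Sum>a\<in>\<Delta>0. of_int (c a) *\<^sub>R a)"
    using base0 p unfolding is_base_def by blast
  obtain d :: "'v \<Rightarrow> int" where d: "\<theta> = (\<Sum>a\<in>\<Delta>0. of_int (d a) *\<^sub>R a)"
    using base0 \<theta>_root unfolding is_base_def by blast
  have n: "\<delta> - \<theta> \<notin> \<Delta>0" using simple_not_in_\<Delta>0 span_base by blast
  \<comment> \<open>Coordinates read off from p + k\<delta> = k(\<delta> - \<theta>) + (p +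
    k\<theta>).\<close>
  define e where "e a = (if a = \<delta> - \<theta> then k else c a + k * d a)" for a
  have "(\<Sum>a\<in>\<Delta>a. of_int (e a) *\<^sub>R a) = of_int k *\<^sub>R (\<delta> - \<theta>) + (\<Sum>a\<in>\<Delta>0. of_int (e a) *\<^sub>R a)"
    unfolding \<Delta>a_def using \<Delta>0(1) n by (simp add: e_def)
  also have "(\<Sum>a\<in>\<Delta>0. of_int (e a) *\<^sub>R a) = (\<Sum>a\<in>\<Delta>0. of_int (c a) *\<^sub>R a + of_int k *\<^sub>R (of_int (d a) *\<^sub>R a))"
    by (rule sum.cong) (use n in \<open>auto simp: e_def algebra_simps\<close>)
  also have "\<dots> = p + of_int k *\<^sub>R \<theta>"
    unfolding sum.distrib scaleR_sum_right[symmetric] c[symmetric] d[symmetric] ..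
  also have "of_int k *\<^sub>R (\<delta> - \<theta>) + (p + of_int k *\<^sub>R \<theta>) = p + of_int k *\<^sub>R \<delta>"
    by (simp add: algebra_simps)
  finally show ?thesis by metis
qed

text \<open>Projection, offsets, heights and integrality are inherited from the full system, so a
  section by a subspace can be treated without constructing a base for it.\<close>

lemma affine_roots_subsystem:
  assumes "\<Psi> \<subseteq> \<Phi>0" "finite_root_system \<Psi>"
  shows "affine_roots \<Psi> \<delta> proj offset height \<Delta>a"
proof (rule affine_roots.intro)
  show "finite_root_system \<Psi>" "linear proj" "proj \<delta> = 0" "\<delta> \<noteq> 0" "linear height" "finite \<Delta>a" "independent \<Delta>a"
    using assms proj height(1) \<Delta>a \<delta>_ne by simp_all
  show "0 < height \<delta>" using height(2) \<delta>_nonneg \<delta>_ne by blast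
  fix p assume "p \<in> \<Psi>"
  then have p: "p \<in> \<Phi>0" using assms by blast
  show "proj p = p" using proj(3) span_base[OF p] by blast
  show "offset p = 0 \<or> offset p = 1" by (simp add: offset_def)
  show "offset (- p) = 1 - offset p" by (rule offset_neg[OF p])
  show "0 < height (p + of_int (offset p) *\<^sub>R \<delta>)"
    using height(2) offset_nonneg[OF p order_refl] affine_root_ne[OF p] by blast
  show "\<exists>c::'v \<Rightarrow> int. p + of_int k *\<^sub>R \<delta> = (\<Sum>a\<in>\<Delta>a. of_int (c a) *\<^sub>R a)" for k
    by (rule affine_int[OF p])
qed

sublocale affine_roots \<Phi>0 \<delta> proj offset height \<Delta>a
  by (rule affine_roots_subsystem[OF subset_refl rs0])

text \<open>Below its offset, a lift is the negative of a vector in the cone of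
  \<open>\<Delta>a\<close>; positivity of the height keeps it out of that cone.\<close>

lemma X_eq_F: "X = F"
proof
  show "F \<subseteq> X"
  proof
    fix z assume "z \<in> F"
    then obtain p k where p: "p \<in> \<Phi>0" "offset p \<le> k" "z = af p k" by (rule F_cases)
    then show "z \<in> X" using offset_nonneg[OF p(1,2)]
      unfolding X_def pos_roots_def affinization_def af_def by blast
  qed
  show "X \<subseteq> F"
  proof
    fix z assume "z \<in> X"
    then obtain p k where p: "p \<in> \<Phi>0" "z = af p k" and z: "z \<in> nonneg_span \<Delta>a"
      unfolding X_def pos_roots_def affinization_def af_def by blast
    have "z \<noteq> 0" using affine_root_ne[OF p(1), of k] p(2) unfolding af_def by simp
    have "offset p \<le> k"
    proof (rule ccontr)
      assume "\<not> offset p \<le> k"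
      then have "offset (- p) \<le> - k" using offset_neg[OF p(1)] by simp
      then have "af (- p) (- k) \<in> nonneg_span \<Delta>a" unfolding af_def
        by (rule offset_nonneg[OF neg_mem_root_system[OF rs0 p(1)]])
      moreover have "af (- p) (- k) = - z" unfolding p(2) af_def by simp
      ultimately have "0 < height (- z)" using height(2) \<open>z \<noteq> 0\<close> by simp
      then show False using height(2)[OF z \<open>z \<noteq> 0\<close>] by (simp add: linear_neg[OF height(1)])
    qed
    then show "z \<in> F" using p by (simp add: af_in_F)
  qed
qed

lemma X_nonneg: "X \<subseteq> nonneg_span \<Delta>a"
  by (auto simp: X_def pos_roots_def)

lemma X_cases: "z \<in> X \<Longrightarrow> \<exists>p k. p \<in> \<Phi>0 \<and> offset p \<le> k \<and> z = af p k"
  unfolding X_eq_F F_def by blast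

lemma height_ge_1:
  assumes "z \<in> X" shows "1 \<le> height z"
proof -
  obtain p k where p: "p \<in> \<Phi>0" "z = af p k" using X_cases[OF assms] by blast
  have "height z \<in> \<int>" using affine_int[OF p(1), of k] height(3) unfolding p(2) af_def by metis
  then obtain m :: int where "height z = of_int m" by (auto elim: Ints_cases)
  moreover have "0 < height z" using ht_pos assms X_eq_F by blast
  ultimately show ?thesis by simp
qed

lemma X_scale:
  assumes "z \<in> X" "c *\<^sub>R z \<in> X" shows "c = 1"
proof -
  obtain p k where p: "p \<in> \<Phi>0" "z = af p k" using X_cases[OF assms(1)] by blast
  obtain q l where q: "q \<in> \<Phi>0" "c *\<^sub>R z = af q l" using X_cases[OF assms(2)] by blast
  have "proj (c *\<^sub>R z) = q" using q by simp
  then have "c *\<^sub>R p = q" using p by (simp add: linear_scale[OF proj(1)])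
  then have "c = 1 \<or> c = -1" using root_eq_if_dependent[OF rs0 p(1)] q(1) by blast
  moreover have "0 < height z" "0 < height (c *\<^sub>R z)" using height_ge_1[OF assms(1)] height_ge_1[OF assms(2)] by linarith+
  ultimately show ?thesis by (auto simp: linear_scale[OF height(1)])
qed

text \<open>Exactly one of the two opposite differences is positive. Naming it as a difference shows
  that it stays in every subspace containing \<alpha> and \<beta>.\<close>

lemma X_diff:
  assumes ab: "\<alpha> \<in> X" "\<beta> \<in> X" and ne: "proj \<alpha> \<noteq> proj \<beta>" and pos: "0 < proj \<alpha> \<bullet> proj \<beta>"
  shows "\<exists>\<tau>\<in>X. (\<alpha> = \<beta> + \<tau> \<or> \<beta> = \<alpha> + \<tau>) \<and> (\<tau> = \<alpha> - \<beta> \<or> \<tau> = \<beta> - \<alpha>)"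
proof -
  obtain p k where p: "p \<in> \<Phi>0" "\<alpha> = af p k" using X_cases[OF ab(1)] by blast
  obtain q l where q: "q \<in> \<Phi>0" "\<beta> = af q l" using X_cases[OF ab(2)] by blast
  have pq: "p \<noteq> q" "0 < p \<bullet> q" using ne pos p q by simp_all
  have d: "p - q \<in> \<Phi>0" using root_diff[OF rs0 p(1) q(1) pq(2,1)] .
  have d': "q - p \<in> \<Phi>0" using neg_root[OF d] by simp
  have e: "\<alpha> = \<beta> + af (p - q) (k - l)" "\<beta> = \<alpha> + af (q - p) (l - k)" unfolding p(2) q(2) by (simp_all add: af_add)
  show ?thesis
  proof (cases "offset (p - q) \<le> k - l")
    case True
    then have "af (p - q) (k - l) \<in> X" using d by (simp add: X_eq_F af_in_F)
    then show ?thesis using e(1) by (intro bexI[of _ "af (p - q) (k - l)"]) (auto simp: algebra_simps)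
  next
    case False
    have "offset (q - p) = 1 - offset (p - q)" using offset_neg[OF d] by simp
    then have "af (q - p) (l - k) \<in> X" using d' False by (simp add: X_eq_F af_in_F)
    then show ?thesis using e(2) by (intro bexI[of _ "af (q - p) (l - k)"]) (auto simp: algebra_simps)
  qed
qed

lemma string_nonneg: "l \<le> k \<Longrightarrow> af p k - af p l \<in> nonneg_span \<Delta>a"
proof -
  assume "l \<le> k"
  then have "of_int (k - l) *\<^sub>R \<delta> \<in> nonneg_span \<Delta>a" by (intro nonneg_span_scale \<delta>_nonneg) simp
  then show ?thesis by (simp add: af_def algebra_simps)
qed

text \<open>As \<open>low (- p)\<close> is \<delta> minus \<open>low p\<close>, the difference is
  twice \<open>low p\<close> plus a nonnegative multiple of \<delta>. This justifies the middle
  clause of \<open>ideal\<close> for initial segments.\<close>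

lemma opposite_nonneg:
  assumes p: "p \<in> \<Phi>0" and k: "offset p < k" shows "af p k - low (- p) \<in> nonneg_span \<Delta>a"
proof -
  have "low p \<in> nonneg_span \<Delta>a" using offset_nonneg[OF p order_refl] unfolding af_def .
  then have "2 *\<^sub>R low p + of_int (k - 1 - offset p) *\<^sub>R \<delta> \<in> nonneg_span \<Delta>a"
    using k by (intro nonneg_span_add nonneg_span_scale \<delta>_nonneg) simp_all
  moreover have "2 *\<^sub>R low p + of_int (k - 1 - offset p) *\<^sub>R \<delta> = af p k - low (- p)"
  proof -
    have shift: "af q l + of_int m *\<^sub>R \<delta> = af q (l + m)" for q l m
      by (simp add: af_def scaleR_add_left)
    have "2 *\<^sub>R low p + of_int (k - 1 - offset p) *\<^sub>R \<delta> = af (p + p) (offset p + offset p + (k - 1 - offset p))"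
      unfolding scaleR_2 af_add shift ..
    also have "\<dots> = af p k + af p (- offset (- p))"
      unfolding af_add offset_neg[OF p] by (simp add: algebra_simps)
    also have "af p (- offset (- p)) = - low (- p)" by (simp add: af_def)
    finally show ?thesis by simp
  qed
  ultimately show ?thesis by simp
qed

lemma section_root_system:
  assumes "subspace L" shows "finite_root_system (\<Phi>0 \<inter> L)"
proof -
  have "\<beta> - (2 * (\<beta> \<bullet> \<alpha>) / (\<alpha> \<bullet> \<alpha>)) *\<^sub>R \<alpha> \<in> \<Phi>0 \<inter> L" if "\<alpha> \<in> \<Phi>0 \<inter> L" "\<beta> \<in> \<Phi>0 \<inter> L" for \<alpha> \<beta>
    using that rs0 assms unfolding finite_root_system_def
    by (auto intro: subspace_diff subspace_scale)
  then show ?thesis using rs0 unfolding finite_root_system_def by auto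
qed

end

section \<open>Fundamental vectors and clean sections of the affine system\<close>

context untwisted_affine
begin

text \<open>If \<open>proj\<close> is injective on \<open>Y\<close>, the general argument works with
  the pulled-back form. Otherwise \<delta> lies in the span of \<open>Y\<close>, so \<open>Y\<close>
  consists of the lifts of some \<open>p\<close> and \<open>- p\<close>, and its fundamental vectors
  are the two lowest lifts.\<close>

lemma fundamental_root_le:
  assumes Y: "two_dim_linear_subset X Y" and fv: "fundamental_vectors Y \<alpha> \<beta>" and \<gamma>: "\<gamma> \<in> Y - {\<alpha>, \<beta>}"
  shows "root_le \<Delta>a \<alpha> \<gamma> \<and> root_le \<Delta>a \<beta> \<gamma>"
proof -
  obtain L where L: "subspace L" "Y = X \<inter> L" and dim: "dim (span Y) = 2"
    using Y unfolding two_dim_linear_subset_def linear_subset_def by blast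
  have YN: "nonneg_span Y \<subseteq> nonneg_span \<Delta>a" using L(2) X_nonneg by (intro nonneg_span_minimal) blast
  show ?thesis
  proof (cases "\<forall>\<rho>\<in>Y. \<forall>\<sigma>\<in>Y. proj \<rho> = proj \<sigma> \<longrightarrow> \<rho> = \<sigma>")
    case True
    have "\<gamma> - \<alpha> \<in> nonneg_span Y \<and> \<gamma> - \<beta> \<in> nonneg_span Y"
    proof (rule fundamental_below[OF proj(1) height(1) _ _ _ _ fv])
      show "\<gamma> \<in> Y" "\<gamma> \<notin> {\<alpha>, \<beta>}" using \<gamma> by auto
      show "proj y \<noteq> 0" if "y \<in> Y" for y using X_cases[of y] that L(2) finite_root_ne by auto
      show "1 \<le> height y" if "y \<in> Y" for y using height_ge_1 that L(2) by blast
      show "2 *\<^sub>R y \<notin> Y" if "y \<in> Y" for y using X_scale[of y 2] that L(2) by auto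
      fix \<rho> \<sigma> assume rs: "\<rho> \<in> Y" "\<sigma> \<in> Y" "\<rho> \<noteq> \<sigma>" "0 < proj \<rho> \<bullet> proj \<sigma>"
      have m: "\<rho> \<in> X" "\<sigma> \<in> X" "\<rho> \<in> L" "\<sigma> \<in> L" using rs L(2) by auto
      have "proj \<rho> \<noteq> proj \<sigma>" using True rs by blast
      then obtain \<tau> where \<tau>: "\<tau> \<in> X" "\<rho> = \<sigma> + \<tau> \<or> \<sigma> = \<rho> + \<tau>" "\<tau> = \<rho> - \<sigma> \<or> \<tau> = \<sigma> - \<rho>"
        using X_diff[OF m(1,2) _ rs(4)] by blast
      have "\<tau> \<in> L" using \<tau>(3) m(3,4) subspace_diff[OF L(1)] by auto
      then show "\<exists>\<tau>\<in>Y. \<rho> = \<sigma> + \<tau> \<or> \<sigma> = \<rho> + \<tau>" using \<tau>(1,2) L(2) by blast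
    qed
    then show ?thesis using YN unfolding root_le_def by blast
  next
    case False
    then obtain \<rho> \<sigma> where rs: "\<rho> \<in> Y" "\<sigma> \<in> Y" "proj \<rho> = proj \<sigma>" "\<rho> \<noteq> \<sigma>" by blast
    obtain p a where p: "p \<in> \<Phi>0" "\<rho> = af p a" using X_cases[of \<rho>] rs(1) L(2) by blast
    obtain q b where q: "q \<in> \<Phi>0" "\<sigma> = af q b" using X_cases[of \<sigma>] rs(2) L(2) by blast
    have qp: "q = p" "a \<noteq> b" using rs(3,4) p q by auto
    have \<delta>Y: "\<delta> \<in> span Y"
    proof -
      have "\<rho> - \<sigma> \<in> span Y" using span_base[OF rs(1)] span_base[OF rs(2)] by (rule span_diff)
      moreover have "\<rho> - \<sigma> = of_int (a - b) *\<^sub>R \<delta>" unfolding p(2) q(2) qp(1) by (simp add: af_def algebra_simps)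
      ultimately have "(1 / of_int (a - b)) *\<^sub>R (of_int (a - b) *\<^sub>R \<delta>) \<in> span Y" by (simp only: span_scale)
      then show ?thesis using qp(2) by simp
    qed
    have barY: "u \<in> span Y" if "af u k \<in> Y" for u k
    proof -
      have "af u k - of_int k *\<^sub>R \<delta> \<in> span Y"
        using span_base[OF that] \<delta>Y by (simp only: span_diff span_scale)
      then show ?thesis by (simp add: af_def)
    qed
    have pY: "p \<in> span Y" using barY rs(1) p(2) by blast
    have spY: "span Y \<subseteq> L" using L by (intro span_minimal) auto
    \<comment> \<open>A finite part not proportional to \<open>p\<close> would give three
      independent vectors \<delta>, \<open>u\<close>, \<open>p\<close> in the two-dimensional span
      of \<open>Y\<close>.\<close>
    have bars: "u = p \<or> u = - p" if u: "u \<in> \<Phi>0" "af u k \<in> Y" for u k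
    proof -
      have "u \<in> span {p}"
      proof (rule ccontr)
        assume "u \<notin> span {p}"
        moreover have "independent {p}" using finite_root_ne[OF p(1)] by simp
        ultimately have i2: "independent {u, p}" by (rule independent_insertI)
        have "u \<noteq> p" using \<open>u \<notin> span {p}\<close> span_base by blast
        have "span {u, p} \<subseteq> span \<Phi>0" using u(1) p(1) by (intro span_mono) auto
        then have \<delta>n: "\<delta> \<notin> span {u, p}" using \<delta>_span by blast
        then have "\<delta> \<notin> {u, p}" using span_base by blast
        then have ind: "independent {\<delta>, u, p}" "card {\<delta>, u, p} = 3"
          using independent_insertI[OF \<delta>n i2] \<open>u \<noteq> p\<close> by simp_all
        obtain B where B: "B \<subseteq> span Y" "independent B" "span Y \<subseteq> span B" "card B = 2"
          using basis_exists[of "span Y"] dim by metis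
        have "finite B" using B(4) by (simp add: card_ge_0_finite)
        moreover have "{\<delta>, u, p} \<subseteq> span B" using \<delta>Y barY[OF u(2)] pY B(3) by blast
        ultimately have "card {\<delta>, u, p} \<le> card B" using independent_span_bound[OF _ ind(1)] by blast
        then show False using ind(2) B(4) by simp
      qed
      then obtain c where c: "u = c *\<^sub>R p" by (auto simp: span_singleton)
      then have "c = 1 \<or> c = -1" using root_eq_if_dependent[OF rs0 p(1)] u(1) by blast
      then show ?thesis using c by auto
    qed
    have np: "- p \<in> \<Phi>0" using neg_root[OF p(1)] .
    have inY: "af u k \<in> Y" if "u \<in> {p, - p}" "offset u \<le> k" for u k
    proof -
      have "u \<in> span Y" using that(1) pY span_neg by blast
      then have "af u k \<in> span Y" unfolding af_def using \<delta>Y by (intro span_add span_scale)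
      moreover have "af u k \<in> X" using that p(1) np by (auto simp: X_eq_F af_in_F)
      ultimately show ?thesis using L(2) spY by blast
    qed
    have lowY: "low p \<in> Y" "low (- p) \<in> Y" using inY by simp_all
    have low_ne: "low p \<noteq> low (- p)"
    proof
      assume "low p = low (- p)"
      then have "p = - p" using af_eq_iff[OF p(1) np] by simp
      then have "p \<bullet> p = - (p \<bullet> p)" by (metis inner_minus_left)
      then show False using finite_root_ne[OF p(1)] by simp
    qed
    have gen: "y \<in> nonneg_span {low p, low (- p)}" if y: "y \<in> Y" for y
    proof -
      obtain u k where u: "u \<in> \<Phi>0" "offset u \<le> k" "y = af u k" using X_cases[of y] y L(2) by blast
      have up: "u = p \<or> u = - p" using bars u(1,3) y by blast
      have sum: "low p + low (- p) = \<delta>" using low_neg[OF p(1)] by simp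
      have "y = low u + of_int (k - offset u) *\<^sub>R (low p + low (- p))"
        unfolding sum u(3) by (simp add: af_def algebra_simps)
      moreover have "low u \<in> nonneg_span {low p, low (- p)}" using up by (auto intro: nonneg_span_base)
      moreover have "of_int (k - offset u) *\<^sub>R (low p + low (- p)) \<in> nonneg_span {low p, low (- p)}"
        using u(2) by (intro nonneg_span_scale nonneg_span_add nonneg_span_base) simp_all
      ultimately show ?thesis by (simp only: nonneg_span_add)
    qed
    have extremal: "\<epsilon> \<in> {low p, low (- p)}" if "\<epsilon> \<in> Y" "\<epsilon> \<notin> nonneg_span (Y - {\<epsilon>})" for \<epsilon>
    proof (rule ccontr)
      assume "\<epsilon> \<notin> {low p, low (- p)}"
      then have "{low p, low (- p)} \<subseteq> Y - {\<epsilon>}" using lowY by blast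
      then show False using gen[OF that(1)] that(2) nonneg_span_mono by blast
    qed
    have ab: "\<alpha> \<in> {low p, low (- p)}" "\<beta> \<in> {low p, low (- p)}" "Y \<subseteq> nonneg_span {\<alpha>, \<beta>}"
      using fv extremal unfolding fundamental_vectors_def by blast+
    \<comment> \<open>Distinctness is not part of \<open>fundamental_vectors\<close>; if they
      coincided, \<open>Y\<close> would lie on a single ray and contain only one root.\<close>
    have "\<alpha> \<noteq> \<beta>"
    proof
      assume eq: "\<alpha> = \<beta>"
      have mult: "\<exists>c. y = c *\<^sub>R \<alpha>" if "y \<in> Y" for y
      proof -
        have "y \<in> nonneg_span {\<alpha>, \<beta>}" using ab(3) that by blast
        then obtain c d where "y = c *\<^sub>R \<alpha> + d *\<^sub>R \<beta>" by (rule nonneg_span_pairE)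
        then have "y = (c + d) *\<^sub>R \<alpha>" using eq by (simp add: scaleR_add_left)
        then show ?thesis ..
      qed
      have \<alpha>X: "\<alpha> \<in> X" using fv L(2) unfolding fundamental_vectors_def by blast
      have all: "y = \<alpha>" if y: "y \<in> Y" for y
      proof -
        obtain c where c: "y = c *\<^sub>R \<alpha>" using mult[OF y] by blast
        have "c = 1" by (rule X_scale[OF \<alpha>X]) (use c y L(2) in blast)
        then show ?thesis using c by simp
      qed
      have "low p = low (- p)" using all[OF lowY(1)] all[OF lowY(2)] by simp
      then show False using low_ne by contradiction
    qed
    then have ab_eq: "{low p, low (- p)} = {\<alpha>, \<beta>}" using ab(1,2) by auto
    obtain u k where u: "u \<in> \<Phi>0" "offset u \<le> k" "\<gamma> = af u k" using X_cases[of \<gamma>] \<gamma> L(2) by blast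
    have up: "u = p \<or> u = - p" using bars u(1,3) \<gamma> by blast
    then have lowu: "{low u, low (- u)} = {\<alpha>, \<beta>}" unfolding ab_eq[symmetric] by auto
    have "k \<noteq> offset u" using \<gamma> u(3) lowu by auto
    then have k: "offset u < k" using u(2) by simp
    have "root_le \<Delta>a (low u) \<gamma>" "root_le \<Delta>a (low (- u)) \<gamma>"
      unfolding root_le_def u(3) using string_nonneg[OF u(2)] opposite_nonneg[OF u(1) k] by blast+
    then have "\<forall>\<epsilon>\<in>{low u, low (- u)}. root_le \<Delta>a \<epsilon> \<gamma>" by blast
    then show ?thesis unfolding lowu by blast
  qed
qed

context
  fixes g :: "nat \<Rightarrow> 'v"
  assumes ord: "is_ordering X g" and refines: "refines_root_poset \<Delta>a X g"
begin

text \<open>Because \<delta> is in \<open>L\<close>, a root lies in \<open>L\<close> exactly if its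
  finite part does; so the section of \<open>X\<close> by \<open>L\<close> is the set of positive
  roots attached to the section of \<open>\<Phi>0\<close>.\<close>

lemma segment_ideal:
  assumes L: "subspace L" "\<delta> \<in> L"
  shows "affine_roots.ideal (\<Phi>0 \<inter> L) \<delta> offset (X \<inter> L \<inter> init_seg X g i)"
proof -
  interpret sub: affine_roots "\<Phi>0 \<inter> L" \<delta> proj offset height \<Delta>a
    by (rule affine_roots_subsystem) (use section_root_system[OF L(1)] in auto)
  have subF: "sub.F \<subseteq> X \<inter> L"
  proof
    fix z assume "z \<in> sub.F"
    then obtain p k where p: "p \<in> \<Phi>0 \<inter> L" "offset p \<le> k" "z = af p k" by (rule sub.F_cases)
    then have "z \<in> L" unfolding af_def using L by (auto intro: subspace_add subspace_scale)
    moreover have "z \<in> X" using p by (simp add: X_eq_F af_in_F)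
    ultimately show "z \<in> X \<inter> L" by blast
  qed
  have Fsub: "X \<inter> L \<subseteq> sub.F"
  proof
    fix z assume z: "z \<in> X \<inter> L"
    then obtain p k where p: "p \<in> \<Phi>0" "offset p \<le> k" "z = af p k" using X_cases[of z] by blast
    have "p = z - of_int k *\<^sub>R \<delta>" unfolding p(3) by (simp add: af_def)
    then have "p \<in> L" using z L by (metis IntD2 subspace_diff subspace_scale)
    then show "z \<in> sub.F" using p by (simp add: sub.af_in_F)
  qed
  have down: "y \<in> X \<inter> L \<inter> init_seg X g i"
    if "z \<in> X \<inter> L \<inter> init_seg X g i" "y \<in> sub.F" "z - y \<in> nonneg_span \<Delta>a" for y z
    using init_seg_downward[OF ord refines, of z i y] that subF unfolding root_le_def by blast
  show ?thesis
    unfolding sub.ideal_def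
  proof (intro conjI ballI allI impI)
    show "finite (X \<inter> L \<inter> init_seg X g i)" by simp
    show "X \<inter> L \<inter> init_seg X g i \<subseteq> sub.F" using Fsub by blast
  next
    fix \<rho> \<sigma> assume s: "\<rho> \<in> sub.F" "\<sigma> \<in> sub.F" "\<rho> + \<sigma> \<in> X \<inter> L \<inter> init_seg X g i"
    have "\<sigma> \<in> nonneg_span \<Delta>a" using s(2) subF X_nonneg by blast
    then show "\<rho> \<in> X \<inter> L \<inter> init_seg X g i" by (intro down[OF s(3,1)]) simp
  next
    fix p k assume p: "p \<in> \<Phi>0 \<inter> L" and k: "af p k \<in> X \<inter> L \<inter> init_seg X g i \<and> offset p < k"
    have "low (- p) \<in> sub.F" using sub.neg_root[OF p] by (simp add: sub.af_in_F)
    then show "low (- p) \<in> X \<inter> L \<inter> init_seg X g i"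
      using down[of "af p k" "low (- p)"] k opposite_nonneg[of p k] p by blast
  next
    fix p k l assume p: "p \<in> \<Phi>0 \<inter> L" and k: "af p k \<in> X \<inter> L \<inter> init_seg X g i \<and> offset p \<le> l \<and> l \<le> k"
    have "af p l \<in> sub.F" using p k by (simp add: sub.af_in_F)
    then show "af p l \<in> X \<inter> L \<inter> init_seg X g i"
      using down[of "af p k" "af p l"] k string_nonneg[of l k p] by blast
  qed
qed

lemma clean_section:
  assumes L: "subspace L" "\<delta> \<in> L"
    and "\<And>r s. r \<in> \<Phi>0 \<inter> L \<Longrightarrow> s \<in> \<Phi>0 \<inter> L \<Longrightarrow> r \<bullet> s = 0 \<Longrightarrow>
      \<Phi>0 \<inter> L \<subseteq> span {r, s} \<and> (\<exists>e\<in>\<Phi>0 \<inter> L. e \<bullet> r \<noteq> 0 \<and> e \<bullet> s \<noteq> 0)"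
  shows "clean (X \<inter> L \<inter> init_seg X g i)"
proof -
  have "affine_roots (\<Phi>0 \<inter> L) \<delta> proj offset height \<Delta>a"
    by (rule affine_roots_subsystem) (use section_root_system[OF L(1)] in auto)
  then interpret sub: affine_rank2 "\<Phi>0 \<inter> L" \<delta> proj offset height \<Delta>a
    by (rule affine_rank2.intro[OF _ affine_rank2_axioms.intro]) (use assms(3) in blast)+
  show ?thesis by (rule sub.ideal_clean[OF segment_ideal[OF L]])
qed

text \<open>Without \<delta> in \<open>L\<close>, two elements of the section never differ by a
  multiple of \<delta> and \<delta> lies in neither cone, so the descent works as in the finite
  case, whatever the dimension of \<open>L\<close>.\<close>

lemma clean_section_without_\<delta>:
  assumes L: "subspace L" "\<delta> \<notin> L"
  shows "clean (X \<inter> L \<inter> init_seg X g i)"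
  unfolding clean_def
proof (intro allI impI)
  define Z where "Z = X \<inter> L \<inter> init_seg X g i"
  fix B assume B: "B \<subseteq> X \<inter> L \<inter> init_seg X g i" "biclosed_in_set (X \<inter> L \<inter> init_seg X g i) B"
  then have cl: "closed_in_set Z B" "closed_in_set Z (Z - B)"
    unfolding biclosed_in_set_def coclosed_in_set_def Z_def by blast+
  have BC: "B \<union> (Z - B) = Z" "B \<inter> (Z - B) = {}" using B(1) by (auto simp: Z_def)
  have finZ: "finite Z" by (simp add: Z_def)
  have "nonneg_span B \<inter> nonneg_span (Z - B) = {0}"
  proof (rule nonneg_span_Int_eq_0[OF finZ \<Delta>a _ cl BC proj(1) height(1)])
    show "\<exists>c::'v \<Rightarrow> int. z = (\<Sum>a\<in>\<Delta>a. of_int (c a) *\<^sub>R a)" if z: "z \<in> Z" for z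
    proof -
      have "z \<in> X" using z by (simp add: Z_def)
      then obtain p k where p: "p \<in> \<Phi>0" "z = af p k" using X_cases by blast
      show ?thesis unfolding p(2) af_def by (rule affine_int[OF p(1)])
    qed
    show "0 < height z" if "z \<in> Z" for z using height_ge_1[of z] that by (auto simp: Z_def)
    show "0 < height \<delta>" by (rule ht_\<delta>)
    show "proj \<delta> = 0" by (rule proj(2))
    show "v \<in> span {\<delta>}" if "v \<in> span Z" "proj v = 0" for v
    proof -
      have "Z \<subseteq> F" by (auto simp: Z_def X_eq_F)
      then show ?thesis using diff_\<pi>_in_span[of v] that span_mono[of Z F] by auto
    qed
    have "nonneg_span B \<subseteq> L"
      using nonneg_span_subset_span[of B] span_minimal[of B L] B(1) L(1) by blast
    then show "\<delta> \<notin> nonneg_span B \<or> \<delta> \<notin> nonneg_span (Z - B)" using L(2) by blast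
    fix \<beta> \<gamma> assume bg: "\<beta> \<in> Z" "\<gamma> \<in> Z" "\<beta> \<noteq> \<gamma>" "0 < proj \<beta> \<bullet> proj \<gamma>"
    have m: "\<beta> \<in> X" "\<gamma> \<in> X" "\<beta> \<in> L" "\<gamma> \<in> L" using bg by (auto simp: Z_def)
    have ne: "proj \<beta> \<noteq> proj \<gamma>"
    proof
      assume eq: "proj \<beta> = proj \<gamma>"
      obtain p a where p: "p \<in> \<Phi>0" "\<beta> = af p a" using X_cases[OF m(1)] by blast
      obtain q b where q: "q \<in> \<Phi>0" "\<gamma> = af q b" using X_cases[OF m(2)] by blast
      have qp: "q = p" "a \<noteq> b" using eq bg(3) p q by auto
      have "\<beta> - \<gamma> \<in> L" using m L(1) by (simp add: subspace_diff)
      moreover have "\<beta> - \<gamma> = of_int (a - b) *\<^sub>R \<delta>" unfolding p(2) q(2) qp(1) by (simp add: af_def algebra_simps)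
      ultimately have "(1 / of_int (a - b)) *\<^sub>R (of_int (a - b) *\<^sub>R \<delta>) \<in> L" using L(1) by (simp only: subspace_scale)
      then show False using qp(2) L(2) by simp
    qed
    obtain \<tau> where \<tau>: "\<tau> \<in> X" "\<beta> = \<gamma> + \<tau> \<or> \<gamma> = \<beta> + \<tau>" "\<tau> = \<beta> - \<gamma> \<or> \<tau> = \<gamma> - \<beta>"
      using X_diff[OF m(1,2) ne bg(4)] by blast
    have "\<tau> \<in> L" using \<tau>(3) m(3,4) subspace_diff[OF L(1)] by auto
    moreover have "root_le \<Delta>a \<tau> \<beta> \<or> root_le \<Delta>a \<tau> \<gamma>"
      using \<tau>(2) m(1,2) X_nonneg by (auto simp: root_le_def)
    then have "\<tau> \<in> init_seg X g i"
      using init_seg_downward[OF ord refines _ \<tau>(1)] bg(1,2) unfolding Z_def by blast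
    ultimately have "\<tau> \<in> Z" using \<tau>(1) by (simp add: Z_def)
    then show "(\<exists>\<rho>\<in>Z. \<beta> = \<gamma> + \<rho> \<or> \<gamma> = \<beta> + \<rho>) \<or> \<delta> \<noteq> 0 \<and> (\<exists>k::nat. \<exists>m>0. \<exists>\<epsilon>\<in>Z. 0 < k \<and>
        (\<beta> = \<gamma> + real k *\<^sub>R \<delta> \<and> \<gamma> + \<epsilon> = m *\<^sub>R \<delta> \<or> \<gamma> = \<beta> + real k *\<^sub>R \<delta> \<and> \<beta> + \<epsilon> = m *\<^sub>R \<delta>))"
      using \<tau>(2) by blast
  qed
  then show "weakly_separable (X \<inter> L \<inter> init_seg X g i) B"
    unfolding weakly_separable_def Z_def .
qed

lemma span_\<delta>_cases:
  assumes "p \<in> \<Phi>0" "r \<in> \<Phi>0" shows "af p k \<in> span {r, \<delta>} \<longleftrightarrow> p \<in> span {r}"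
proof
  assume "af p k \<in> span {r, \<delta>}"
  moreover have "\<delta> \<in> span {r, \<delta>}" by (simp add: span_base)
  ultimately have "af p k - of_int k *\<^sub>R \<delta> \<in> span {r, \<delta>}" by (simp only: span_diff span_scale)
  then have "p \<in> span (insert \<delta> {r})" by (simp add: af_def insert_commute)
  then obtain c where c: "p - c *\<^sub>R \<delta> \<in> span {r}" by (auto simp: span_insert)
  have r: "span {r} \<subseteq> span \<Phi>0" using assms(2) by (intro span_mono) auto
  have "c = 0"
  proof (rule ccontr)
    assume "c \<noteq> 0"
    have "p - c *\<^sub>R \<delta> \<in> span \<Phi>0" using c r by blast
    with span_base[OF assms(1)] have "p - (p - c *\<^sub>R \<delta>) \<in> span \<Phi>0" by (rule span_diff)
    then have "(1 / c) *\<^sub>R (p - (p - c *\<^sub>R \<delta>)) \<in> span \<Phi>0" by (rule span_scale)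
    then show False using \<open>c \<noteq> 0\<close> \<delta>_span by simp
  qed
  then show "p \<in> span {r}" using c by simp
next
  assume "p \<in> span {r}"
  then have "p \<in> span {r, \<delta>}" using span_mono[of "{r}" "{r, \<delta>}"] by blast
  moreover have "\<delta> \<in> span {r, \<delta>}" by (simp add: span_base)
  ultimately show "af p k \<in> span {r, \<delta>}" unfolding af_def by (simp only: span_add span_scale)
qed

text \<open>In the reducible case \<open>A1 \<times> A1\<close> the section by \<open>L\<close> need not be clean, but the rank-two string
  through two of the given roots together with the third one is full and clean.\<close>

lemma reducible_section:
  assumes L: "subspace L" "\<delta> \<in> L" and rs: "r \<in> \<Phi>0 \<inter> L" "s \<in> \<Phi>0 \<inter> L" "r \<bullet> s = 0"
    and split: "\<And>e. e \<in> \<Phi>0 \<inter> L \<Longrightarrow> e \<in> span {r} \<or> e \<in> span {s}"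
    and \<eta>: "\<eta> \<in> X \<inter> L \<inter> init_seg X g i"
  shows "full_subset X (insert \<eta> (X \<inter> span {r, \<delta>})) \<and> clean (insert \<eta> (X \<inter> span {r, \<delta>}) \<inter> init_seg X g i)"
proof -
  have r0: "r \<in> \<Phi>0" using rs(1) by blast
  let ?P = "X \<inter> span {r, \<delta>}"
  have cleanP: "clean (?P \<inter> init_seg X g i)"
  proof (rule clean_section[OF subspace_span])
    show "\<delta> \<in> span {r, \<delta>}" by (simp add: span_base)
    \<comment> \<open>All finite roots of this section are multiples of \<open>r\<close>, so no two
      of them are orthogonal and the rank-two conditions hold vacuously.\<close>
    fix p q assume pq: "p \<in> \<Phi>0 \<inter> span {r, \<delta>}" "q \<in> \<Phi>0 \<inter> span {r, \<delta>}" "p \<bullet> q = 0"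
    have "p \<in> span {r}" "q \<in> span {r}"
      using span_\<delta>_cases[OF _ r0, of p 0] span_\<delta>_cases[OF _ r0, of q 0] pq by (simp_all add: af_def)
    then obtain c d where "p = c *\<^sub>R r" "q = d *\<^sub>R r" by (auto simp: span_singleton)
    then have "p = 0 \<or> q = 0" using pq(3) by auto
    then have False using pq(1,2) finite_root_ne by blast
    then show "\<Phi>0 \<inter> span {r, \<delta>} \<subseteq> span {p, q} \<and> (\<exists>e\<in>\<Phi>0 \<inter> span {r, \<delta>}. e \<bullet> p \<noteq> 0 \<and> e \<bullet> q \<noteq> 0)" ..
  qed
  show ?thesis
  proof (cases "\<eta> \<in> span {r, \<delta>}")
    case True
    then have "insert \<eta> ?P = ?P" using \<eta> by blast
    then show ?thesis using full_subset_section[OF subspace_span] cleanP by simp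
  next
    case False
    have "\<eta> \<notin> span (?P \<inter> init_seg X g i)"
      using False span_minimal[OF _ subspace_span, of "?P \<inter> init_seg X g i" "{r, \<delta>}"] by blast
    then have "clean (insert \<eta> (?P \<inter> init_seg X g i))" by (intro clean_insert[OF cleanP]) simp_all
    moreover have "insert \<eta> ?P \<inter> init_seg X g i = insert \<eta> (?P \<inter> init_seg X g i)" using \<eta> by blast
    moreover have "full_subset X (insert \<eta> ?P)"
    proof -
      obtain q k where q: "q \<in> \<Phi>0" "\<eta> = af q k" using X_cases[of \<eta>] \<eta> by blast
      have qL: "q \<in> L"
      proof -
        have "af q k - of_int k *\<^sub>R \<delta> \<in> L" using \<eta> q(2) L by (intro subspace_diff subspace_scale) auto
        then show ?thesis by (simp add: af_def)
      qed
      have "q \<notin> span {r}" using False span_\<delta>_cases[OF q(1) r0] q(2) by simp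
      then have qs: "q \<in> span {s}" using split q(1) qL by blast
      \<comment> \<open>The finite part of \<open>z\<close> combines a multiple of \<open>s\<close>
        from \<eta> with a multiple of \<open>r\<close> from \<open>y\<close>, but it lies on one of
        these two lines. On the first line \<open>z\<close> is in the string, on the second it is a
        multiple of \<eta> and hence equal to \<eta>.\<close>
      have mixed: "z \<in> insert \<eta> ?P" if y: "y \<in> ?P" and z: "z \<in> X" "z \<in> span {\<eta>, y}" for y z
      proof -
        obtain t where "z - t *\<^sub>R \<eta> \<in> span {y}" using z(2) by (auto simp: span_insert)
        then obtain u where "z - t *\<^sub>R \<eta> = u *\<^sub>R y" by (auto simp: span_singleton)
        then have zt: "z = t *\<^sub>R \<eta> + u *\<^sub>R y" by (simp add: algebra_simps)
        obtain p l where p: "p \<in> \<Phi>0" "y = af p l" using X_cases[of y] y by blast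
        obtain e m where e: "e \<in> \<Phi>0" "z = af e m" using X_cases[OF z(1)] by blast
        have pr: "p \<in> span {r}" using y span_\<delta>_cases[OF p(1) r0] p(2) by simp
        have "{r, \<delta>} \<subseteq> L" using rs(1) L(2) by blast
        then have "y \<in> L" using y span_minimal[OF _ L(1)] by blast
        then have "z \<in> L" unfolding zt using \<eta> L(1) by (intro subspace_add subspace_scale) auto
        then have "af e m - of_int m *\<^sub>R \<delta> \<in> L" unfolding e(2) using L by (intro subspace_diff subspace_scale)
        then have "e \<in> L" by (simp add: af_def)
        have "proj z = t *\<^sub>R proj \<eta> + u *\<^sub>R proj y"
          unfolding zt by (simp add: linear_add[OF proj(1)] linear_scale[OF proj(1)])
        then have ee: "e = t *\<^sub>R q + u *\<^sub>R p" using e q p by simp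
        obtain a where a: "q = a *\<^sub>R s" using qs by (auto simp: span_singleton)
        obtain b where b: "p = b *\<^sub>R r" using pr by (auto simp: span_singleton)
        have ab: "a \<noteq> 0" "b \<noteq> 0" using a b finite_root_ne[OF q(1)] finite_root_ne[OF p(1)] by auto
        have sr: "s \<bullet> r = 0" using rs(3) by (simp add: inner_commute)
        have rr: "r \<bullet> r \<noteq> 0" "s \<bullet> s \<noteq> 0" using rs finite_root_ne by auto
        have "e \<in> span {r} \<or> e \<in> span {s}" using split e(1) \<open>e \<in> L\<close> by blast
        then show ?thesis
        proof
          assume "e \<in> span {r}"
          then have "z \<in> span {r, \<delta>}" using span_\<delta>_cases[OF e(1) r0] e(2) by simp
          then show ?thesis using z(1) by blast
        next
          assume "e \<in> span {s}"
          then obtain d where "e = d *\<^sub>R s" by (auto simp: span_singleton)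
          then have "e \<bullet> r = 0" using sr by simp
          then have "u * b * (r \<bullet> r) = 0" unfolding ee a b using sr by (simp add: inner_add_left)
          then have "u = 0" using ab rr by simp
          then have "z = t *\<^sub>R \<eta>" using zt by simp
          then have "t = 1" using X_scale[of \<eta> t] \<eta> z(1) by blast
          then show ?thesis using \<open>z = t *\<^sub>R \<eta>\<close> by simp
        qed
      qed
      have "X \<inter> span {x, y} \<subseteq> insert \<eta> ?P" if xy: "x \<in> insert \<eta> ?P" "y \<in> insert \<eta> ?P" for x y
      proof
        fix z assume z: "z \<in> X \<inter> span {x, y}"
        consider "x \<in> ?P" "y \<in> ?P" | "x = \<eta>" "y = \<eta>" | "x = \<eta>" "y \<in> ?P" | "x \<in> ?P" "y = \<eta>" using xy by blast
        then show "z \<in> insert \<eta> ?P"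
        proof cases
          case 1
          then have "span {x, y} \<subseteq> span {r, \<delta>}" by (intro span_minimal subspace_span) auto
          then show ?thesis using z by blast
        next
          case 2
          then obtain t where "z = t *\<^sub>R \<eta>" using z by (auto simp: span_singleton)
          then have "t = 1" using X_scale[of \<eta> t] \<eta> z by blast
          then show ?thesis using \<open>z = t *\<^sub>R \<eta>\<close> by simp
        next
          case 3
          then show ?thesis using mixed[of y z] z by blast
        next
          case 4
          then show ?thesis using mixed[of x z] z by (metis IntD1 IntD2 insert_commute)
        qed
      qed
      then show ?thesis unfolding full_subset_def using \<eta> by blast
    qed
    ultimately show ?thesis by simp
  qed
qed

text \<open>The whole section by the span of the three roots works unless \<delta> lies in the span
  and the finite section has an orthogonal pair without a linking root. Then it has type
  \<open>A1 \<times> A1\<close>, and a single string together with one more root replaces the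
  section.\<close>

lemma clean_full_subset_exists:
  assumes abc: "{\<alpha>, \<beta>, \<gamma>} \<subseteq> init_seg X g i"
  shows "\<exists>F. full_subset X F \<and> {\<alpha>, \<beta>, \<gamma>} \<subseteq> F \<and> clean (F \<inter> init_seg X g i)"
proof -
  define L where "L = span {\<alpha>, \<beta>, \<gamma>}"
  have L: "subspace L" by (simp add: L_def)
  have IX: "init_seg X g i \<subseteq> X" by (rule init_seg_subset[OF ord])
  have "{\<alpha>, \<beta>, \<gamma>} \<subseteq> L" unfolding L_def by (rule span_superset)
  then have mem: "{\<alpha>, \<beta>, \<gamma>} \<subseteq> X \<inter> L" using abc IX by blast
  have whole: ?thesis if "clean (X \<inter> L \<inter> init_seg X g i)"
    using full_subset_section[OF L] mem that by blast
  show ?thesis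
  proof (cases "\<delta> \<in> L")
    case False
    then show ?thesis by (intro whole clean_section_without_\<delta>[OF L])
  next
    case True
    \<comment> \<open>The section of \<open>\<Phi>0\<close> has rank at most two: \<delta>,
      \<open>e\<close>, \<open>r\<close>, \<open>s\<close> would otherwise be four independent
      vectors in the span of three.\<close>
    have sp: "\<Phi>0 \<inter> L \<subseteq> span {r, s}" if rs: "r \<in> \<Phi>0 \<inter> L" "s \<in> \<Phi>0 \<inter> L" "r \<bullet> s = 0" for r s
    proof
      fix e assume e: "e \<in> \<Phi>0 \<inter> L"
      show "e \<in> span {r, s}"
      proof (rule ccontr)
        assume ne: "e \<notin> span {r, s}"
        have nz: "r \<noteq> 0" "s \<noteq> 0" using rs finite_root_ne by auto
        have "r \<notin> span {s}"
        proof
          assume "r \<in> span {s}"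
          then obtain c where "r = c *\<^sub>R s" by (auto simp: span_singleton)
          then show False using rs(3) nz by auto
        qed
        moreover have "independent {s}" using nz by simp
        ultimately have i2: "independent {r, s}" by (rule independent_insertI)
        have "r \<noteq> s" using \<open>r \<notin> span {s}\<close> span_base by blast
        have i3: "independent {e, r, s}" using ne i2 by (rule independent_insertI)
        have "span {e, r, s} \<subseteq> span \<Phi>0" using e rs by (intro span_mono) auto
        then have \<delta>n: "\<delta> \<notin> span {e, r, s}" using \<delta>_span by blast
        have i4: "independent {\<delta>, e, r, s}" using \<delta>n i3 by (rule independent_insertI)
        have "e \<notin> {r, s}" "\<delta> \<notin> {e, r, s}" using ne \<delta>n span_base[of e "{r, s}"] span_base[of \<delta> "{e, r, s}"] by blast+
        then have c4: "card {\<delta>, e, r, s} = 4" using \<open>r \<noteq> s\<close> by simp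
        have "{\<delta>, e, r, s} \<subseteq> span {\<alpha>, \<beta>, \<gamma>}" using True e rs unfolding L_def by blast
        with _ i4 have "finite {\<delta>, e, r, s} \<and> card {\<delta>, e, r, s} \<le> card {\<alpha>, \<beta>, \<gamma>}"
          by (rule independent_span_bound) simp
        then have "card {\<delta>, e, r, s} \<le> card {\<alpha>, \<beta>, \<gamma>}" ..
        also have "\<dots> \<le> 3" by (simp add: card_insert_if)
        finally show False using c4 by simp
      qed
    qed
    show ?thesis
    proof (cases "\<forall>r\<in>\<Phi>0 \<inter> L. \<forall>s\<in>\<Phi>0 \<inter> L. r \<bullet> s = 0 \<longrightarrow> (\<exists>e\<in>\<Phi>0 \<inter> L. e \<bullet> r \<noteq> 0 \<and> e \<bullet> s \<noteq> 0)")
      case link: True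
      show ?thesis by (rule whole, rule clean_section[OF L True]) (use sp link in blast)
    next
      case False
      then obtain r s where rs: "r \<in> \<Phi>0 \<inter> L" "s \<in> \<Phi>0 \<inter> L" "r \<bullet> s = 0"
        and no: "\<And>e. e \<in> \<Phi>0 \<inter> L \<Longrightarrow> e \<bullet> r = 0 \<or> e \<bullet> s = 0" by blast
      have sr: "s \<bullet> r = 0" using rs(3) by (simp add: inner_commute)
      have nz: "r \<bullet> r \<noteq> 0" "s \<bullet> s \<noteq> 0" using rs finite_root_ne by auto
      have split: "e \<in> span {r} \<or> e \<in> span {s}" if e: "e \<in> \<Phi>0 \<inter> L" for e
      proof -
        have "e \<in> span {r, s}" using sp[OF rs] e by blast
        then obtain a where "e - a *\<^sub>R r \<in> span {s}" by (auto simp: span_insert)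
        then obtain b where "e - a *\<^sub>R r = b *\<^sub>R s" by (auto simp: span_singleton)
        then have ab: "e = a *\<^sub>R r + b *\<^sub>R s" by (simp add: algebra_simps)
        have "a * (r \<bullet> r) = 0 \<or> b * (s \<bullet> s) = 0" using no[OF e] rs(3) sr unfolding ab by (simp add: inner_add_left)
        then have "a = 0 \<or> b = 0" using nz by simp
        then show ?thesis unfolding ab by (auto simp: span_base span_scale)
      qed
      have strings: "z \<in> span {r, \<delta>} \<or> z \<in> span {s, \<delta>}" if z: "z \<in> X \<inter> L" for z
      proof -
        obtain p k where p: "p \<in> \<Phi>0" "z = af p k" using X_cases[of z] z by blast
        have "af p k - of_int k *\<^sub>R \<delta> \<in> L" using z p(2) L True by (intro subspace_diff subspace_scale) auto
        then have "p \<in> L" by (simp add: af_def)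
        then show ?thesis using split[of p] p span_\<delta>_cases rs by auto
      qed
      have two: ?thesis
        if xyz: "{x, y, z} = {\<alpha>, \<beta>, \<gamma>}" and t: "t \<in> \<Phi>0 \<inter> L" "t' \<in> \<Phi>0 \<inter> L" "t \<bullet> t' = 0"
          and sp': "\<And>e. e \<in> \<Phi>0 \<inter> L \<Longrightarrow> e \<in> span {t} \<or> e \<in> span {t'}"
          and xy: "x \<in> span {t, \<delta>}" "y \<in> span {t, \<delta>}" for x y z t t'
      proof -
        have z: "z \<in> X \<inter> L \<inter> init_seg X g i" using xyz mem abc by blast
        have "{x, y} \<subseteq> X" using xyz mem by blast
        then have "{\<alpha>, \<beta>, \<gamma>} \<subseteq> insert z (X \<inter> span {t, \<delta>})" unfolding xyz[symmetric] using xy by blast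
        then show ?thesis using reducible_section[OF L True t sp' z] by blast
      qed
      have s1: "\<alpha> \<in> span {r, \<delta>} \<or> \<alpha> \<in> span {s, \<delta>}" "\<beta> \<in> span {r, \<delta>} \<or> \<beta> \<in> span {s, \<delta>}"
        "\<gamma> \<in> span {r, \<delta>} \<or> \<gamma> \<in> span {s, \<delta>}" using strings mem by blast+
      \<comment> \<open>Pigeonhole: two of the three roots lie in the same string.\<close>
      have "\<exists>x y z. {x, y, z} = {\<alpha>, \<beta>, \<gamma>} \<and>
          (x \<in> span {r, \<delta>} \<and> y \<in> span {r, \<delta>} \<or> x \<in> span {s, \<delta>} \<and> y \<in> span {s, \<delta>})"
      proof -
        have perm: "{\<alpha>, \<gamma>, \<beta>} = {\<alpha>, \<beta>, \<gamma>}" "{\<beta>, \<gamma>, \<alpha>} = {\<alpha>, \<beta>, \<gamma>}" by auto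
        show ?thesis using s1 perm by metis
      qed
      then obtain x y z where xyz: "{x, y, z} = {\<alpha>, \<beta>, \<gamma>}"
        and c: "x \<in> span {r, \<delta>} \<and> y \<in> span {r, \<delta>} \<or> x \<in> span {s, \<delta>} \<and> y \<in> span {s, \<delta>}" by blast
      from c show ?thesis
      proof
        assume "x \<in> span {r, \<delta>} \<and> y \<in> span {r, \<delta>}"
        then show ?thesis using two[OF xyz rs split] by simp
      next
        assume xy: "x \<in> span {s, \<delta>} \<and> y \<in> span {s, \<delta>}"
        have split': "e \<in> span {s} \<or> e \<in> span {r}" if "e \<in> \<Phi>0 \<inter> L" for e using split[OF that] by blast
        show ?thesis using two[OF xyz rs(2,1) sr split'] xy by simp
      qed
    qed
  qed
qed

theorem suitable_X: "suitable X g"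
  by (rule suitableI[OF ord refines fundamental_root_le clean_full_subset_exists])

end

end

theorem theorem6p2:
  fixes \<Phi> \<Delta> :: "'v::real_inner set" and g :: "nat \<Rightarrow> 'v"
  assumes rs: "(finite_root_system \<Phi> \<and> is_base \<Phi> \<Delta>) \<or>
     (\<exists>\<Phi>0 \<Delta>0 \<delta> \<theta>. finite_root_system \<Phi>0 \<and> irreducible_rs \<Phi>0 \<and> is_base \<Phi>0 \<Delta>0 \<and>
        highest_root \<Phi>0 \<Delta>0 \<theta> \<and> \<delta> \<notin> span \<Phi>0 \<and>
        \<Phi> = affinization \<Phi>0 \<delta> \<and> \<Delta> = \<Delta>0 \<union> {\<delta> - \<theta>})"
    and ord: "is_ordering (pos_roots \<Phi> \<Delta>) g"
    and refines: "refines_root_poset \<Delta> (pos_roots \<Phi> \<Delta>) g"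
  shows "suitable (pos_roots \<Phi> \<Delta>) g"
  using rs
proof
  assume "finite_root_system \<Phi> \<and> is_base \<Phi> \<Delta>"
  then show ?thesis using finite_suitable ord refines by blast
next
  assume "\<exists>\<Phi>0 \<Delta>0 \<delta> \<theta>. finite_root_system \<Phi>0 \<and> irreducible_rs \<Phi>0 \<and> is_base \<Phi>0 \<Delta>0 \<and>
        highest_root \<Phi>0 \<Delta>0 \<theta> \<and> \<delta> \<notin> span \<Phi>0 \<and>
        \<Phi> = affinization \<Phi>0 \<delta> \<and> \<Delta> = \<Delta>0 \<union> {\<delta> - \<theta>}"
  then obtain \<Phi>0 \<Delta>0 \<delta> \<theta> where a: "finite_root_system \<Phi>0" "is_base \<Phi>0 \<Delta>0" "highest_root \<Phi>0 \<Delta>0 \<theta>"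
      "\<delta> \<notin> span \<Phi>0" and eq: "\<Phi> = affinization \<Phi>0 \<delta>" "\<Delta> = \<Delta>0 \<union> {\<delta> - \<theta>}" by blast
  interpret untwisted_affine \<Phi>0 \<Delta>0 \<delta> \<theta> by (rule untwisted_affine.intro[OF a])
  have "pos_roots \<Phi> \<Delta> = X" "\<Delta> = \<Delta>a" by (simp_all add: X_def \<Delta>a_def eq)
  then show ?thesis using suitable_X ord refines by simp
qed

end
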